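(* For ${\rm APP}=\{{\rm APP}_d\}_{d\in\mathbb N}$ in the average case setting with the absolute error criterion, ${\rm APP}$ is EXP-UWT for $\Lambda^{\rm all}$ iff it is EXP-UWT for $\Lambda^{\rm std}$.
   Context: Setting (average case approximation). For each $d\in\mathbb N$: $D_d\subset\mathbb R^d$ is a Borel set of positive Lebesgue measure, $\rho_d$ is a probability density on $D_d$, and $G_d=L_2(D_d,\rho_d(x)\,dx)$. $F_d$ is a separable Banach space of real-valued functions on $D_d$, continuously embedded in $G_d$, such that every point evaluation $f\mapsto f(x)$, $x\in D_d$, is a continuous linear functional on $F_d$; $F_d$ carries a zero-mean Gaussian measure $\mu_d$. ${\rm APP}_d:F_d\to G_d$, ${\rm APP}_d f=f$. $\Lambda^{\rm all}$ is the class of all continuous linear functionals on $F_d$, $\Lambda^{\rm std}$ the class of point evaluations. For $\Lambda\in\{\Lambda^{\rm all},\Lambda^{\rm std}\}$, an algorithm is $A_{n,d}f=\phi_{n,d}(L_1(f),\dots,L_n(f))$ with $L_i\in\Lambda$ and $\phi_{n,d}:\mathbb R^n\to G_d$ measurable; its average case error is $e^{\rm avg}(A_{n,d})=\big(\int_{F_d}\|f-A_{n,d}f\|_{G_d}^2\,\mu_d(df)\big)^{1/2}$, and $e^{\rm avg}(n,d;\Lambda)$ is the infimum of $e^{\rm avg}(A_{n,d})$ over all such algorithms using $n$ functionals from $\Lambda$ (for $n=0$, $A_{0,d}=0$). Absolute-error information complexity: $n^{\rm ABS}(\varepsilon,d;\Lambda)=\min\{n\ge0:\ e^{\rm avg}(n,d;\Lambda)\le\varepsilon\}$.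 EXP-UWT for $\Lambda$: for all $\alpha,\beta>0$, $\lim_{\varepsilon^{-1}+d\to\infty}\frac{\ln n^{\rm ABS}(\varepsilon,d;\Lambda)}{(1+\ln\varepsilon^{-1})^{\alpha}+d^{\beta}}=0$, where the limit means: for every $\eta>0$ there is $M$ such that the quotient is $<\eta$ for all $d\in\mathbb N$, $\varepsilon\in(0,1)$ with $\varepsilon^{-1}+d>M$. *)

theory Defs
  imports "HOL-Probability.Probability"
begin

type_synonym point = "nat \<Rightarrow> real"
type_synonym fn = "point \<Rightarrow> real"

definition Rd :: "nat \<Rightarrow> point measure" where
  "Rd d = Pi\<^sub>M {..<d} (\<lambda>_. lborel)"

definition G_sqnorm :: "nat \<Rightarrow> point set \<Rightarrow> (point \<Rightarrow> real) \<Rightarrow> fn \<Rightarrow> ennreal" where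
  "G_sqnorm d D \<rho> g = (\<integral>\<^sup>+ x \<in> D. ennreal (\<rho> x * (g x)\<^sup>2) \<partial>Rd d)"

definition norm_open :: "fn set \<Rightarrow> (fn \<Rightarrow> real) \<Rightarrow> fn set \<Rightarrow> bool" where
  "norm_open V N U \<longleftrightarrow> U \<subseteq> V \<and>
     (\<forall>f\<in>U. \<exists>r>0. \<forall>g\<in>V. N (\<lambda>x. g x - f x) < r \<longrightarrow> g \<in> U)"

definition cont_lin_fun :: "fn set \<Rightarrow> (fn \<Rightarrow> real) \<Rightarrow> (fn \<Rightarrow> real) \<Rightarrow> bool" where
  "cont_lin_fun V N L \<longleftrightarrow>
     (\<forall>f\<in>V. \<forall>g\<in>V. L (\<lambda>x. f x + g x) = L f + L g) \<and>
     (\<forall>c. \<forall>f\<in>V. L (\<lambda>x. c * f x) = c * L f) \<and>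
     (\<exists>C. \<forall>f\<in>V. \<bar>L f\<bar> \<le> C * N f)"

definition avg_setting :: "nat \<Rightarrow> point set \<Rightarrow> (point \<Rightarrow> real) \<Rightarrow> fn set \<Rightarrow> (fn \<Rightarrow> real)
    \<Rightarrow> fn measure \<Rightarrow> bool" where
  "avg_setting d D \<rho> V N \<mu> \<longleftrightarrow>
     \<comment> \<open>D_d Borel subset of R^d of positive Lebesgue measure\<close>
     D \<in> sets (Rd d) \<and> emeasure (Rd d) D > 0 \<and>
     \<comment> \<open>rho_d probability density on D_d\<close>
     \<rho> \<in> borel_measurable (Rd d) \<and> (\<forall>x\<in>D. 0 \<le> \<rho> x) \<and>
     (\<integral>\<^sup>+ x \<in> D. ennreal (\<rho> x) \<partial>Rd d) = 1 \<and>
     \<comment> \<open>F_d a linear space of real functions on D_d\<close>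
     (\<forall>f\<in>V. \<forall>x. x \<notin> D \<longrightarrow> f x = 0) \<and>
     (\<lambda>_. 0) \<in> V \<and>
     (\<forall>f\<in>V. \<forall>g\<in>V. (\<lambda>x. f x + g x) \<in> V) \<and>
     (\<forall>c. \<forall>f\<in>V. (\<lambda>x. c * f x) \<in> V) \<and>
     \<comment> \<open>N is a norm on F_d\<close>
     (\<forall>f\<in>V. N f = 0 \<longleftrightarrow> f = (\<lambda>_. 0)) \<and>
     (\<forall>f\<in>V. \<forall>g\<in>V. N (\<lambda>x. f x + g x) \<le> N f + N g) \<and>
     (\<forall>c. \<forall>f\<in>V. N (\<lambda>x. c * f x) = \<bar>c\<bar> * N f) \<and>
     \<comment> \<open>complete (Banach)\<close>
     (\<forall>s::nat \<Rightarrow> fn. (\<forall>k. s k \<in> V) \<longrightarrow>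
        (\<forall>e>0. \<exists>K. \<forall>m\<ge>K. \<forall>k\<ge>K. N (\<lambda>x. s m x - s k x) < e) \<longrightarrow>
        (\<exists>g\<in>V. \<forall>e>0. \<exists>K. \<forall>k\<ge>K. N (\<lambda>x. s k x - g x) < e)) \<and>
     \<comment> \<open>separable\<close>
     (\<exists>S\<subseteq>V. countable S \<and> (\<forall>f\<in>V. \<forall>e>0. \<exists>g\<in>S. N (\<lambda>x. f x - g x) < e)) \<and>
     \<comment> \<open>continuously embedded in G_d\<close>
     (\<forall>f\<in>V. f \<in> borel_measurable (Rd d) \<and> G_sqnorm d D \<rho> f < \<infinity>) \<and>
     (\<exists>C. \<forall>f\<in>V. G_sqnorm d D \<rho> f \<le> ennreal ((C * N f)\<^sup>2)) \<and>
     \<comment> \<open>point evaluations are continuous\<close>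
     (\<forall>x\<in>D. \<exists>C. \<forall>f\<in>V. \<bar>f x\<bar> \<le> C * N f) \<and>
     \<comment> \<open>mu_d zero-mean Gaussian (Borel) measure on F_d\<close>
     prob_space \<mu> \<and> space \<mu> = V \<and>
     sets \<mu> = sigma_sets V {U. norm_open V N U} \<and>
     (\<forall>L. cont_lin_fun V N L \<longrightarrow>
        (\<exists>\<sigma>\<ge>0. distr \<mu> borel L =
           (if \<sigma> = 0 then return borel 0 else density lborel (normal_density 0 \<sigma>))))"

datatype info_class = Lambda_all | Lambda_std

definition admissible :: "info_class \<Rightarrow> point set \<Rightarrow> fn set \<Rightarrow> (fn \<Rightarrow> real) \<Rightarrow> (fn \<Rightarrow> real) \<Rightarrow> bool" where
  "admissible c D V N L = (case c of
      Lambda_all \<Rightarrow> cont_lin_fun V N L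
    | Lambda_std \<Rightarrow> (\<exists>x\<in>D. L = (\<lambda>f. f x)))"

definition err_sq :: "nat \<Rightarrow> point set \<Rightarrow> (point \<Rightarrow> real) \<Rightarrow> fn measure \<Rightarrow> nat
    \<Rightarrow> (nat \<Rightarrow> fn \<Rightarrow> real) \<Rightarrow> (point \<Rightarrow> point \<Rightarrow> real) \<Rightarrow> ennreal" where
  "err_sq d D \<rho> \<mu> n Ls \<phi> =
     (\<integral>\<^sup>+ f. G_sqnorm d D \<rho> (\<lambda>x. f x - \<phi> (restrict (\<lambda>i. Ls i f) {..<n}) x) \<partial>\<mu>)"

text \<open>Squared n-th minimal average case error e^avg(n,d;Lambda)^2.
  phi : R^n -> G_d measurable is rendered as joint measurability of (y,x) \<mapsto> phi y x.\<close>
definition e_avg_sq :: "info_class \<Rightarrow> nat \<Rightarrow> point set \<Rightarrow> (point \<Rightarrow> real) \<Rightarrow> fn set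
    \<Rightarrow> (fn \<Rightarrow> real) \<Rightarrow> fn measure \<Rightarrow> nat \<Rightarrow> ennreal" where
  "e_avg_sq c d D \<rho> V N \<mu> n =
     (if n = 0 then (\<integral>\<^sup>+ f. G_sqnorm d D \<rho> f \<partial>\<mu>)
      else (INF p \<in> {(Ls, \<phi>). (\<forall>i<n. admissible c D V N (Ls i)) \<and>
                      (\<lambda>(y, x). \<phi> y x) \<in> borel_measurable (Rd n \<Otimes>\<^sub>M Rd d)}.
              err_sq d D \<rho> \<mu> n (fst p) (snd p)))"

definition n_ABS :: "info_class \<Rightarrow> real \<Rightarrow> nat \<Rightarrow> point set \<Rightarrow> (point \<Rightarrow> real) \<Rightarrow> fn set
    \<Rightarrow> (fn \<Rightarrow> real) \<Rightarrow> fn measure \<Rightarrow> nat" where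
  "n_ABS c \<epsilon> d D \<rho> V N \<mu> = (LEAST n. e_avg_sq c d D \<rho> V N \<mu> n \<le> ennreal (\<epsilon>\<^sup>2))"

definition EXP_UWT :: "info_class \<Rightarrow> (nat \<Rightarrow> point set) \<Rightarrow> (nat \<Rightarrow> point \<Rightarrow> real)
    \<Rightarrow> (nat \<Rightarrow> fn set) \<Rightarrow> (nat \<Rightarrow> fn \<Rightarrow> real) \<Rightarrow> (nat \<Rightarrow> fn measure) \<Rightarrow> bool" where
  "EXP_UWT c D \<rho> V N \<mu> \<longleftrightarrow>
     (\<forall>\<alpha>>0. \<forall>\<beta>>0. \<forall>\<eta>>0. \<exists>M. \<forall>d\<ge>1. \<forall>\<epsilon>::real. 0 < \<epsilon> \<and> \<epsilon> < 1 \<and> 1 / \<epsilon> + real d > M \<longrightarrow>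
        ln (real (n_ABS c \<epsilon> d (D d) (\<rho> d) (V d) (N d) (\<mu> d)))
          / ((1 + ln (1 / \<epsilon>)) powr \<alpha> + real d powr \<beta>) < \<eta>)"

end

theory Submission
  imports Defs
begin

text \<open>
  The point is the inequality that \<open>n\<^sup>2\<close> function values are, up to a factor 2 in the
  error, as good as \<open>n\<close> arbitrary linear functionals. Given an algorithm using functionals
  \<open>L\<^sub>1, \<dots>, L\<^sub>n\<close>, Gaussianity makes the best linear reconstruction of \<open>f(x)\<close> from \<open>L\<^sub>i f\<close> optimal
  for every \<open>x\<close>, and it takes values in a space \<open>W\<close> of dimension \<open>m \<le> n\<close> in \<open>G\<close>; hence the error is at
  least that of the \<open>G\<close>-orthogonal projection onto \<open>W\<close>. With an orthonormal basis \<open>b\<close> of \<open>W\<close> and nodes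
  \<open>x\<^sub>1, \<dots>, x\<^sub>m\<close> drawn with density \<open>det(b\<^sub>j(x\<^sub>i))\<^sup>2 / m!\<close>, interpolation in \<open>W\<close> estimates the coefficients of the
  projection without bias and with variance at most the squared distance to \<open>W\<close> (Ermakov and Zolotukhin).
  Averaging \<open>n\<close> independent copies gives a total variance of at most \<open>m/n \<le> 1\<close> times the squared
  projection error, and suitable nodes exist by averaging over the Gaussian measure.

  Consequently \<open>n(\<epsilon>; std) \<le> n(\<epsilon>/2; all)\<^sup>2\<close>, and the logarithm turns the square into a factor 2, which
  is harmless for EXP-UWT. All minima defining the complexities are attained because the second moment
  \<open>\<integral> \<parallel>f\<parallel>\<^sup>2 d\<mu>\<close> is finite, which follows from a Paley-Zygmund argument.
\<close>

section \<open>Orthonormal systems of square integrable functions\<close>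

text \<open>Gaussianity is given only for single functionals, never for joint laws. For uncorrelated
  \<open>Z\<close> and \<open>Y\<close>, however, the functionals \<open>Y + Z\<close> and
  \<open>Y - Z\<close> have the same variance and therefore the same law, and the addition formulas
  then make \<open>sin (s * Z)\<close> orthogonal to the cosine and sine of every linear combination
  of the information. Uniqueness of characteristic functions turns this into conditional mean zero
  of \<open>Z\<close> given the information, which is all that a squared error asks for.

  The squared norm of G is an integral over x, so this optimality can be applied at each x alone.
  Fubini reassembles the pieces, and separability supplies the joint measurability of
  \<open>(f, x) \<mapsto> f x\<close> that it needs. The space W is spanned by the covariances of
  \<open>f x\<close> with the normalised functionals. These are square integrable because the second
  moment is finite, and they vanish off D, which forces every node tuple with nonzero determinant
  into D.\<close>

definition sqint :: "'a measure \<Rightarrow> ('a \<Rightarrow> real) \<Rightarrow> bool" where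
  "sqint M f \<longleftrightarrow> f \<in> borel_measurable M \<and> integrable M (\<lambda>x. (f x)\<^sup>2)"

definition ip :: "'a measure \<Rightarrow> ('a \<Rightarrow> real) \<Rightarrow> ('a \<Rightarrow> real) \<Rightarrow> real" where
  "ip M f g = (\<integral>x. f x * g x \<partial>M)"

lemma sqint_measurable [measurable_dest]: "sqint M f \<Longrightarrow> f \<in> borel_measurable M"
  by (simp add: sqint_def)

lemma sqint_integrable: "sqint M f \<Longrightarrow> integrable M (\<lambda>x. (f x)\<^sup>2)"
  by (simp add: sqint_def)

lemma sqint_mult:
  assumes f: "sqint M f" and g: "sqint M g"
  shows "integrable M (\<lambda>x. f x * g x)"
proof (rule Bochner_Integration.integrable_bound)
  show "integrable M (\<lambda>x. (f x)\<^sup>2 + (g x)\<^sup>2)"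
    using f g by (auto simp: sqint_def)
  show "(\<lambda>x. f x * g x) \<in> borel_measurable M"
    using f g by (auto simp: sqint_def)
  have "\<bar>a * b\<bar> \<le> a\<^sup>2 + b\<^sup>2" for a b :: real
  proof -
    have "0 \<le> \<bar>a\<bar> * \<bar>b\<bar>" by simp
    moreover have "2 * (\<bar>a\<bar> * \<bar>b\<bar>) \<le> a\<^sup>2 + b\<^sup>2"
      using sum_squares_bound[of "\<bar>a\<bar>" "\<bar>b\<bar>"] by (simp add: mult.assoc)
    ultimately show ?thesis unfolding abs_mult by linarith
  qed
  then show "AE x in M. norm (f x * g x) \<le> norm ((f x)\<^sup>2 + (g x)\<^sup>2)"
    by (intro AE_I2) (simp add: abs_mult)
qed

lemma sqint_cmult: "sqint M f \<Longrightarrow> sqint M (\<lambda>x. c * f x)"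
  by (auto simp: sqint_def power_mult_distrib)

lemma sqint_add:
  assumes f: "sqint M f" and g: "sqint M g"
  shows "sqint M (\<lambda>x. f x + g x)"
  using f g sqint_mult[OF f g] by (auto simp: sqint_def power2_sum mult.assoc)

lemma sqint_diff:
  assumes f: "sqint M f" and g: "sqint M g"
  shows "sqint M (\<lambda>x. f x - g x)"
  using sqint_add[OF f sqint_cmult[OF g, of "-1"]] by simp

lemma sqint_zero: "sqint M (\<lambda>_. 0)"
  by (simp add: sqint_def)

lemma sqint_sum: "(\<And>i. i \<in> I \<Longrightarrow> sqint M (f i)) \<Longrightarrow> sqint M (\<lambda>x. \<Sum>i\<in>I. f i x)"
  by (induction I rule: infinite_finite_induct) (auto intro: sqint_zero sqint_add)

lemma sqint_lincomb: "(\<And>i. i \<in> I \<Longrightarrow> sqint M (f i)) \<Longrightarrow> sqint M (\<lambda>x. \<Sum>i\<in>I. c i * f i x)"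
  by (intro sqint_sum sqint_cmult)

lemma ip_commute: "ip M f g = ip M g f"
  by (simp add: ip_def mult.commute)

lemma ip_self: "ip M f f = (\<integral>x. (f x)\<^sup>2 \<partial>M)"
  by (simp add: ip_def power2_eq_square)

lemma ip_self_nonneg: "0 \<le> ip M f f"
  by (simp add: ip_self)

lemma ip_add_left: "sqint M f \<Longrightarrow> sqint M g \<Longrightarrow> sqint M h \<Longrightarrow>
    ip M (\<lambda>x. f x + g x) h = ip M f h + ip M g h"
  by (simp add: ip_def distrib_right sqint_mult)

lemma ip_diff_left: "sqint M f \<Longrightarrow> sqint M g \<Longrightarrow> sqint M h \<Longrightarrow>
    ip M (\<lambda>x. f x - g x) h = ip M f h - ip M g h"
  by (simp add: ip_def left_diff_distrib sqint_mult)

lemma ip_add_self: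
  assumes f: "sqint M f" and g: "sqint M g"
  shows "ip M (\<lambda>x. f x + g x) (\<lambda>x. f x + g x) = ip M f f + 2 * ip M g f + ip M g g"
  unfolding ip_def using sqint_mult[OF f f] sqint_mult[OF f g] sqint_mult[OF g f] sqint_mult[OF g g]
  by (simp add: distrib_left distrib_right mult.commute[of "f _" "g _"])

lemma ip_cmult_left: "ip M (\<lambda>x. c * f x) h = c * ip M f h"
  by (simp add: ip_def mult.assoc)

lemma ip_sum_left: "(\<And>i. i \<in> I \<Longrightarrow> sqint M (f i)) \<Longrightarrow> sqint M h \<Longrightarrow>
    ip M (\<lambda>x. \<Sum>i\<in>I. c i * f i x) h = (\<Sum>i\<in>I. c i * ip M (f i) h)"
  by (simp add: ip_def sum_distrib_right mult.assoc sqint_mult)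

lemma ip_cong_AE:
  assumes "AE x in M. f x = f' x" "sqint M f" "sqint M f'" "sqint M h"
  shows "ip M f h = ip M f' h"
  unfolding ip_def using assms by (intro integral_cong_AE) auto

lemma nn_sqint: "sqint M f \<Longrightarrow> (\<integral>\<^sup>+x. ennreal ((f x)\<^sup>2) \<partial>M) = ennreal (ip M f f)"
  by (simp add: ip_self nn_integral_eq_integral sqint_integrable)

lemma sqintI:
  "f \<in> borel_measurable M \<Longrightarrow> (\<integral>\<^sup>+x. ennreal ((f x)\<^sup>2) \<partial>M) < \<infinity> \<Longrightarrow> sqint M f"
  by (auto simp: sqint_def intro!: integrableI_nonneg)

text \<open>Cauchy-Schwarz against a unit vector, read off from the nonnegative squared norm of
  \<open>f - ip M f h * h\<close>.\<close>

lemma ip_sq_le: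
  assumes f: "sqint M f" and h: "sqint M h" "ip M h h = 1"
  shows "(ip M f h)\<^sup>2 \<le> ip M f f"
proof -
  let ?B = "ip M f h"
  have "0 \<le> ip M (\<lambda>x. f x + (- ?B) * h x) (\<lambda>x. f x + (- ?B) * h x)" by (rule ip_self_nonneg)
  also have "\<dots> = ip M f f - ?B\<^sup>2"
    unfolding ip_add_self[OF f sqint_cmult[OF h(1)]]
    by (simp only: ip_cmult_left ip_commute[of M h "\<lambda>x. - ?B * h x"] ip_commute[of M h f] h(2))
      (simp add: power2_eq_square)
  finally show ?thesis by simp
qed

lemma ip_self_cong_AE:
  assumes "AE x in M. f x = g x" "sqint M f" "sqint M g"
  shows "ip M f f = ip M g g"
  unfolding ip_def using assms by (intro integral_cong_AE) auto

section \<open>Orthonormal systems, best approximation and Gram-Schmidt\<close>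

definition orthonormal :: "'a measure \<Rightarrow> nat \<Rightarrow> (nat \<Rightarrow> 'a \<Rightarrow> real) \<Rightarrow> bool" where
  "orthonormal M m b \<longleftrightarrow> (\<forall>j<m. sqint M (b j)) \<and>
     (\<forall>j<m. \<forall>k<m. ip M (b j) (b k) = (if j = k then 1 else 0))"

definition proj :: "'a measure \<Rightarrow> nat \<Rightarrow> (nat \<Rightarrow> 'a \<Rightarrow> real) \<Rightarrow> ('a \<Rightarrow> real) \<Rightarrow> 'a \<Rightarrow> real" where
  "proj M m b f x = (\<Sum>j<m. ip M f (b j) * b j x)"

lemma sqint_orthonormal: "orthonormal M m b \<Longrightarrow> j < m \<Longrightarrow> sqint M (b j)"
  by (simp add: orthonormal_def)

lemma sqint_lincomb_orthonormal: "orthonormal M m b \<Longrightarrow> sqint M (\<lambda>x. \<Sum>j<m. c j * b j x)"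
  by (rule sqint_lincomb) (simp add: orthonormal_def)

lemma ip_lincomb_orthonormal:
  assumes "orthonormal M m b" "k < m"
  shows "ip M (\<lambda>x. \<Sum>j<m. c j * b j x) (b k) = c k"
  using assms by (subst ip_sum_left) (auto simp: orthonormal_def if_distrib[of "(*) _"] cong: if_cong)

lemma sqint_proj: "orthonormal M m b \<Longrightarrow> sqint M (proj M m b f)"
  unfolding proj_def[abs_def] by (rule sqint_lincomb_orthonormal)

lemma sqint_resid:
  "orthonormal M m b \<Longrightarrow> sqint M f \<Longrightarrow> sqint M (\<lambda>x. f x - proj M m b f x)"
  by (intro sqint_diff sqint_proj)

lemma ip_resid:
  assumes "orthonormal M m b" "sqint M f" "k < m"
  shows "ip M (\<lambda>x. f x - proj M m b f x) (b k) = 0"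
proof -
  have "ip M (proj M m b f) (b k) = ip M f (b k)"
    unfolding proj_def[abs_def] by (rule ip_lincomb_orthonormal[OF assms(1,3)])
  then show ?thesis
    using assms by (subst ip_diff_left) (auto simp: sqint_proj sqint_orthonormal)
qed

lemma ip_lincomb_self:
  assumes "orthonormal M m b"
  shows "ip M (\<lambda>x. \<Sum>j<m. c j * b j x) (\<lambda>x. \<Sum>j<m. c j * b j x) = (\<Sum>j<m. (c j)\<^sup>2)"
proof -
  have s: "sqint M (\<lambda>x. \<Sum>j<m. c j * b j x)"
    using assms by (rule sqint_lincomb_orthonormal)
  have "ip M (\<lambda>x. \<Sum>j<m. c j * b j x) (\<lambda>x. \<Sum>j<m. c j * b j x)
      = (\<Sum>j<m. c j * ip M (b j) (\<lambda>x. \<Sum>j<m. c j * b j x))"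
    using assms by (intro ip_sum_left s) (auto simp: orthonormal_def)
  also have "\<dots> = (\<Sum>j<m. (c j)\<^sup>2)"
    using assms by (intro sum.cong refl)
      (auto simp: power2_eq_square ip_lincomb_orthonormal ip_commute[where g="\<lambda>x. \<Sum>j<m. c j * b j x"])
  finally show ?thesis .
qed

text \<open>Pythagoras: a competitor differs from the projection by an element \<open>p\<close> of
  the span, and the residual \<open>r\<close> is orthogonal to \<open>p\<close>.\<close>

lemma proj_best:
  assumes b: "orthonormal M m b" and f: "sqint M f"
  shows "ip M (\<lambda>x. f x - proj M m b f x) (\<lambda>x. f x - proj M m b f x)
       \<le> ip M (\<lambda>x. f x - (\<Sum>j<m. c j * b j x)) (\<lambda>x. f x - (\<Sum>j<m. c j * b j x))"
proof -
  define r where "r x = f x - proj M m b f x" for x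
  define p where "p x = (\<Sum>j<m. (ip M f (b j) - c j) * b j x)" for x
  have r: "sqint M r" unfolding r_def[abs_def] by (rule sqint_resid[OF b f])
  have p: "sqint M p" unfolding p_def[abs_def] by (rule sqint_lincomb_orthonormal[OF b])
  have rp: "ip M p r = 0"
    unfolding p_def[abs_def]
    by (subst ip_sum_left)
      (auto simp: r sqint_orthonormal[OF b] ip_commute[of M _ r] ip_resid[OF b f, folded r_def[abs_def]])
  have eq: "(\<lambda>x. f x - (\<Sum>j<m. c j * b j x)) = (\<lambda>x. r x + p x)"
    by (rule ext) (simp add: r_def p_def proj_def left_diff_distrib sum_subtractf)
  have "ip M (\<lambda>x. r x + p x) (\<lambda>x. r x + p x) = ip M r r + ip M p p"
    using rp by (simp add: ip_add_self[OF r p])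
  then show ?thesis
    unfolding eq r_def[symmetric] using ip_self_nonneg[of M p] by simp
qed

text \<open>The competitor needs to lie in the span only almost everywhere, which is what
  \<open>gram_schmidt\<close> can deliver.\<close>

lemma resid_le:
  assumes b: "orthonormal M m b" and f: "sqint M f" and h: "sqint M h"
    and ae: "AE x in M. h x = (\<Sum>j<m. c j * b j x)"
  shows "ip M (\<lambda>x. f x - proj M m b f x) (\<lambda>x. f x - proj M m b f x) \<le> ip M (\<lambda>x. f x - h x) (\<lambda>x. f x - h x)"
proof -
  have "ip M (\<lambda>x. f x - (\<Sum>j<m. c j * b j x)) (\<lambda>x. f x - (\<Sum>j<m. c j * b j x)) = ip M (\<lambda>x. f x - h x) (\<lambda>x. f x - h x)"
    using ae by (intro ip_self_cong_AE sqint_diff f h sqint_lincomb_orthonormal[OF b]) auto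
  then show ?thesis using proj_best[OF b f, of c] by simp
qed

text \<open>Vectors of norm zero are dropped instead of normalised; hence \<open>m\<close> may be
  smaller than \<open>n\<close>, and the span is recovered only almost everywhere. The coefficients
  \<open>A\<close>, in contrast, express \<open>b\<close> exactly, at every point. Thus linearity,
  continuity and zeros of the given functions pass to the basis.\<close>

lemma gram_schmidt:
  assumes "\<And>i. i < n \<Longrightarrow> sqint M (g i)"
  shows "\<exists>m b A. m \<le> n \<and> orthonormal M m b \<and> (\<forall>j<m. b j = (\<lambda>x. \<Sum>i<n. A j i * g i x)) \<and>
           (\<forall>i<n. AE x in M. g i x = proj M m b (g i) x)"
  using assms
proof (induction n)
  case 0
  show ?case by (intro exI[of _ 0]) (auto simp: orthonormal_def)
next
  case (Suc n)
  have "\<exists>m b A. m \<le> n \<and> orthonormal M m b \<and> (\<forall>j<m. b j = (\<lambda>x. \<Sum>i<n. A j i * g i x)) \<and>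
           (\<forall>i<n. AE x in M. g i x = proj M m b (g i) x)"
    by (rule Suc.IH) (use Suc.prems in simp)
  then obtain m b A where m: "m \<le> n" and b: "orthonormal M m b"
    and "\<forall>j<m. b j = (\<lambda>x. \<Sum>i<n. A j i * g i x)" "\<forall>i<n. AE x in M. g i x = proj M m b (g i) x"
    by (elim exE conjE)
  then have A: "\<And>j. j < m \<Longrightarrow> b j = (\<lambda>x. \<Sum>i<n. A j i * g i x)"
    and ae: "\<And>i. i < n \<Longrightarrow> AE x in M. g i x = proj M m b (g i) x"
    by simp_all
  have gn: "sqint M (g n)" using Suc.prems by simp
  define r where "r x = g n x - proj M m b (g n) x" for x
  have r: "sqint M r" unfolding r_def[abs_def] by (rule sqint_resid[OF b gn])
  have rb: "ip M r (b k) = 0" if "k < m" for k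
    unfolding r_def[abs_def] by (rule ip_resid[OF b gn that])
  show ?case
  proof (cases "ip M r r = 0")
    case True
    then have "AE x in M. (r x)\<^sup>2 = 0"
      unfolding ip_self using integral_nonneg_eq_0_iff_AE[OF sqint_integrable[OF r]] by simp
    then have aen: "AE x in M. g n x = proj M m b (g n) x"
      by (simp add: r_def)
    show ?thesis
    proof (intro exI conjI allI impI)
      show "m \<le> Suc n" using m by simp
      show "orthonormal M m b" by (rule b)
      show "b j = (\<lambda>x. \<Sum>i<Suc n. (if i < n then A j i else 0) * g i x)" if "j < m" for j
        using A[OF that] by simp
      show "AE x in M. g i x = proj M m b (g i) x" if "i < Suc n" for i
        using that aen ae[of i] by (cases "i = n") auto
    qed
  next
    case False
    define s where "s = sqrt (ip M r r)"
    have s: "s > 0" "s * s = ip M r r"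
      using False ip_self_nonneg[of M r] by (auto simp: s_def)
    define b' where "b' = b(m := \<lambda>x. (1 / s) * r x)"
    have b'_lt: "b' j = b j" if "j < m" for j using that by (simp add: b'_def)
    have b'_m: "b' m = (\<lambda>x. (1 / s) * r x)" by (simp add: b'_def)
    have gs: "ip M (\<lambda>x. (1/s) * r x) h = ip M r h / s" for h
      by (simp only: ip_cmult_left) simp
    have b': "orthonormal M (Suc m) b'"
      unfolding orthonormal_def
    proof (intro conjI allI impI)
      show "sqint M (b' j)" if "j < Suc m" for j
        using that r by (cases "j = m") (auto simp: b'_m b'_lt sqint_orthonormal[OF b] intro: sqint_cmult[where c="1/s", simplified])
      fix j k assume "j < Suc m" "k < Suc m"
      then consider "j < m" "k < m" | "j = m" "k < m" | "j < m" "k = m" | "j = m" "k = m"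
        by linarith
      then show "ip M (b' j) (b' k) = (if j = k then 1 else 0)"
      proof cases
        case 1 then show ?thesis using b by (simp add: b'_lt orthonormal_def)
      next
        case 2 then show ?thesis by (simp only: b'_lt b'_m gs rb) simp
      next
        case 3 then show ?thesis by (subst ip_commute) (simp only: b'_lt b'_m gs rb, simp)
      next
        case 4
        have "ip M (b' m) (b' m) = ip M r (\<lambda>x. (1/s) * r x) / s" by (simp only: b'_m gs)
        also have "\<dots> = 1" using s False by (subst ip_commute) (simp only: gs, simp add: field_simps)
        finally show ?thesis using 4 by simp
      qed
    qed
    have projS: "proj M (Suc m) b' h x = proj M m b h x + ip M h r / s * (r x / s)" for h x
    proof -
      have "ip M h (\<lambda>x. (1/s) * r x) = ip M h r / s" by (subst ip_commute, simp only: gs, simp add: ip_commute)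
      then show ?thesis by (simp add: proj_def b'_m b'_lt)
    qed
    \<comment> \<open>The new row is \<open>r / s\<close>, with the basis vectors in the projection
      of \<open>g n\<close> expanded through \<open>A\<close>.\<close>
    define A' where "A' j i = (if j < m then (if i < n then A j i else 0)
        else (if i = n then 1 else - (\<Sum>k<m. ip M (g n) (b k) * A k i)) / s)" for j i
    show ?thesis
    proof (intro exI conjI allI impI)
      show "Suc m \<le> Suc n" using m by simp
      show "orthonormal M (Suc m) b'" by (rule b')
      show "b' j = (\<lambda>x. \<Sum>i<Suc n. A' j i * g i x)" if "j < Suc m" for j
      proof (cases "j = m")
        case True
        have "(1 / s) * r x = (\<Sum>i<Suc n. A' m i * g i x)" for x
        proof -
          have "proj M m b (g n) x = (\<Sum>k<m. ip M (g n) (b k) * (\<Sum>i<n. A k i * g i x))"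
            unfolding proj_def using A by (intro sum.cong refl) auto
          also have "\<dots> = (\<Sum>i<n. (\<Sum>k<m. ip M (g n) (b k) * A k i) * g i x)"
            unfolding sum_distrib_left sum_distrib_right by (subst sum.swap) (simp add: mult.assoc)
          finally show ?thesis
            by (simp add: A'_def r_def sum_negf sum_divide_distrib diff_divide_distrib)
        qed
        then show ?thesis using True by (simp add: b'_m fun_eq_iff)
      next
        case False
        then show ?thesis using that A[of j] by (simp add: b'_lt A'_def)
      qed
      show "AE x in M. g i x = proj M (Suc m) b' (g i) x" if "i < Suc n" for i
      proof (cases "i = n")
        case True
        \<comment> \<open>Since \<open>r\<close> is orthogonal to the projection, the coefficient of
          \<open>g n\<close> on \<open>r / s\<close> is \<open>s\<close>, so the new term of the
          projection is exactly \<open>r\<close>.\<close>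
        have "ip M (g n) r = ip M (\<lambda>x. r x + proj M m b (g n) x) r"
          by (simp add: r_def)
        also have "\<dots> = ip M r r + ip M (proj M m b (g n)) r"
          by (rule ip_add_left[OF r sqint_proj[OF b] r])
        also have "ip M (proj M m b (g n)) r = 0"
          unfolding proj_def[abs_def]
          by (subst ip_sum_left) (auto simp: r sqint_orthonormal[OF b] ip_commute[of M _ r] rb)
        finally have "ip M (g n) r = s * s" using s by simp
        then have "g n x = proj M (Suc m) b' (g n) x" for x
          using s(1) by (simp add: projS r_def)
        then show ?thesis using True by simp
      next
        case False
        then have i: "i < n" using that by simp
        have "ip M (g i) r = ip M (proj M m b (g i)) r"
          using Suc.prems that by (intro ip_cong_AE ae[OF i] r sqint_proj[OF b]) auto
        also have "\<dots> = 0"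
          unfolding proj_def[abs_def]
          by (subst ip_sum_left) (auto simp: r sqint_orthonormal[OF b] ip_commute[of M _ r] rb)
        finally show ?thesis using ae[OF i] by (simp add: projS)
      qed
    qed
  qed
qed

section \<open>Uncorrelated Gaussian functionals and nonlinear reconstruction\<close>

lemma (in prob_space) integrable_bounded:
  fixes u :: "'a \<Rightarrow> real"
  assumes "u \<in> borel_measurable M" "\<And>x. \<bar>u x\<bar> \<le> c"
  shows "integrable M u"
  by (rule integrable_const_bound[of _ c]) (use assms in auto)

text \<open>Dividing by \<open>c + 1\<close> keeps \<open>1 + u / (c + 1)\<close> nonnegative, with
  a positive divisor even if \<open>c = 0\<close>; the vanishing integral of \<open>u\<close> keeps
  the total mass at 1.\<close>

lemma (in prob_space) tilt:
  fixes u :: "'a \<Rightarrow> real"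
  assumes [measurable]: "u \<in> borel_measurable M" and bd: "\<And>x. \<bar>u x\<bar> \<le> c"
    and zero: "(\<integral>x. u x \<partial>M) = 0"
  obtains w :: "'a \<Rightarrow> real" where "w \<in> borel_measurable M" "\<And>x. 0 \<le> w x" "\<And>x. w x = 1 + u x / (c + 1)"
    "prob_space (density M (\<lambda>x. ennreal (w x)))" "c + 1 > 0"
proof
  have c: "c \<ge> 0" using bd[of undefined] by linarith
  then show "c + 1 > 0" by simp
  show "(\<lambda>x. 1 + u x / (c + 1)) \<in> borel_measurable M" by measurable
  have "- (u x / (c + 1)) \<le> 1" for x
    using bd[of x] c by (simp add: field_simps abs_le_iff)
  then show w0: "0 \<le> 1 + u x / (c + 1)" for x
    by (metis add.commute diff_ge_0_iff_ge diff_minus_eq_add)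
  have "(\<integral>\<^sup>+x. ennreal (1 + u x / (c + 1)) \<partial>M) = ennreal (\<integral>x. 1 + u x / (c + 1) \<partial>M)"
    by (intro nn_integral_eq_integral) (auto simp: w0 intro!: Bochner_Integration.integrable_add
        integrable_divide_zero integrable_bounded[OF assms(1) bd])
  also have "(\<integral>x. 1 + u x / (c + 1) \<partial>M) = 1"
    using integrable_bounded[OF assms(1) bd] zero
    by (subst Bochner_Integration.integral_add) (auto simp: prob_space)
  finally show "prob_space (density M (\<lambda>x. ennreal (1 + u x / (c + 1))))"
    by (intro prob_spaceI) (simp add: emeasure_density cong: nn_integral_cong)
qed simp

text \<open>The density \<open>u\<close> may be signed; adding a constant reduces the claim to Levy's theorem for probability measures.\<close>

lemma (in prob_space) signed_Levy_uniqueness: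
  fixes u Y :: "'a \<Rightarrow> real"
  assumes [measurable]: "u \<in> borel_measurable M" "Y \<in> borel_measurable M" and bd: "\<And>x. \<bar>u x\<bar> \<le> c"
    and cos0: "\<And>s. (\<integral>x. u x * cos (s * Y x) \<partial>M) = 0"
    and sin0: "\<And>s. (\<integral>x. u x * sin (s * Y x) \<partial>M) = 0"
    and [measurable]: "A \<in> sets borel"
  shows "(\<integral>x. u x * indicator A (Y x) \<partial>M) = 0"
proof -
  have "(\<integral>x. u x \<partial>M) = 0" using cos0[of 0] by simp
  then obtain w where w[measurable]: "w \<in> borel_measurable M" and w0: "\<And>x. 0 \<le> w x"
    and w_eq: "\<And>x. w x = 1 + u x / (c + 1)"
    and pw: "prob_space (density M (\<lambda>x. ennreal (w x)))" and c: "c + 1 > 0"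
    using tilt[OF assms(1) bd] by blast
  define M1 where "M1 = distr (density M (\<lambda>x. ennreal (w x))) borel Y"
  define M2 where "M2 = distr M borel Y"
  have ub: "integrable M (\<lambda>x. u x * f (Y x))" if "f \<in> borel_measurable borel" "\<And>x. \<bar>f x\<bar> \<le> 1" for f :: "real \<Rightarrow> real"
  proof (rule integrable_bounded)
    show "(\<lambda>x. u x * f (Y x)) \<in> borel_measurable M" using that by measurable
    show "\<bar>u x * f (Y x)\<bar> \<le> c * 1" for x
      unfolding abs_mult using bd[of x] that(2)[of "Y x"] by (intro mult_mono) auto
  qed
  interpret W: prob_space "density M (\<lambda>x. ennreal (w x))" by (rule pw)
  interpret M1: real_distribution M1
    unfolding M1_def by (intro real_distribution.intro W.prob_space_distr) (auto simp: real_distribution_axioms_def)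
  interpret M2: real_distribution M2
    unfolding M2_def by (intro real_distribution.intro prob_space_distr) (auto simp: real_distribution_axioms_def)
  have "char M1 t = char M2 t" for t
  proof -
    have i1: "integrable M (\<lambda>x. u x * cos (t * Y x))" by (rule ub) auto
    have i2: "integrable M (\<lambda>x. u x * sin (t * Y x))" by (rule ub) auto
    have i3: "integrable M (\<lambda>x. iexp (t * Y x))"
      by (rule integrable_const_bound[of _ 1]) auto
    \<comment> \<open>The two characteristic functions differ by the Fourier integral of
      \<open>u\<close> divided by \<open>c + 1\<close>, and the hypotheses say that its cosine and
      sine parts vanish.\<close>
    have e: "w x *\<^sub>R iexp (t * Y x) = iexp (t * Y x) +
        (complex_of_real (u x * cos (t * Y x)) + \<i> * complex_of_real (u x * sin (t * Y x))) / complex_of_real (c + 1)" for x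
    proof -
      have "iexp (t * Y x) = complex_of_real (cos (t * Y x)) + \<i> * complex_of_real (sin (t * Y x))"
        by (simp add: cis_conv_exp[symmetric] complex_eq_iff del: of_real_mult)
      then show ?thesis
        by (simp add: w_eq scaleR_conv_of_real algebra_simps add_divide_distrib)
    qed
    have z: "(\<integral>x. complex_of_real (u x * cos (t * Y x)) + \<i> * complex_of_real (u x * sin (t * Y x)) \<partial>M) = 0"
      using i1 i2 cos0[of t] sin0[of t]
      by (subst Bochner_Integration.integral_add)
        (auto simp del: of_real_mult)
    have "char M1 t = (\<integral>x. w x *\<^sub>R iexp (t * Y x) \<partial>M)"
      unfolding char_def M1_def using w0
      by (subst integral_distr, simp, simp, subst integral_density) auto
    also have "\<dots> = (\<integral>x. iexp (t * Y x) \<partial>M)"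
      unfolding e using i1 i2 i3 z
      by (subst Bochner_Integration.integral_add) (auto simp del: of_real_mult of_real_add)
    also have "\<dots> = char M2 t"
      unfolding char_def M2_def by (subst integral_distr) auto
    finally show ?thesis .
  qed
  then have "M1 = M2"
    by (intro Levy_uniqueness M1.real_distribution_axioms M2.real_distribution_axioms ext)
  then have "(\<integral>y. indicator A y \<partial>M1) = (\<integral>y. (indicator A y :: real) \<partial>M2)"
    by simp
  moreover have "(\<integral>y. indicator A y \<partial>M1) = (\<integral>x. w x * indicator A (Y x) \<partial>M)"
    unfolding M1_def using w0
    by (subst integral_distr, simp, simp, subst integral_density) auto
  moreover have "(\<integral>y. (indicator A y :: real) \<partial>M2) = (\<integral>x. indicator A (Y x) \<partial>M)"
    unfolding M2_def by (subst integral_distr) auto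
  moreover have "(\<integral>x. w x * indicator A (Y x) \<partial>M)
      = (\<integral>x. indicator A (Y x) + u x * indicator A (Y x) / (c + 1) \<partial>M)"
    by (intro Bochner_Integration.integral_cong refl) (simp add: w_eq algebra_simps)
  moreover have "\<dots> = (\<integral>x. indicator A (Y x) \<partial>M) + (\<integral>x. u x * indicator A (Y x) \<partial>M) / (c + 1)"
  proof (subst Bochner_Integration.integral_add)
    show "integrable M (\<lambda>x. indicator A (Y x) :: real)"
      by (rule integrable_bounded[of _ 1]) (auto simp: indicator_def)
    show "integrable M (\<lambda>x. u x * indicator A (Y x) / (c + 1))"
      by (intro integrable_divide_zero ub) (auto simp: indicator_def)
  qed simp
  ultimately show ?thesis using c by simp
qed

text \<open>The induction trades one frequency for one indicator at a time. With \<open>u\<close>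
  times the cosine or sine of the first \<open>n\<close> coordinates as signed density, the
  one-dimensional lemma treats \<open>Y n\<close>; then \<open>u * indicator (A n) (Y n)\<close> is
  the density for the induction hypothesis. Therefore \<open>u\<close> has to be signed and
  arbitrary.\<close>

lemma (in prob_space) signed_Levy_uniqueness_prod:
  fixes u :: "'a \<Rightarrow> real" and Y :: "nat \<Rightarrow> 'a \<Rightarrow> real"
  assumes "u \<in> borel_measurable M" "\<And>i. i < n \<Longrightarrow> Y i \<in> borel_measurable M" "\<And>x. \<bar>u x\<bar> \<le> c"
    and "\<And>t. (\<integral>x. u x * cos (\<Sum>i<n. t i * Y i x) \<partial>M) = 0"
    and "\<And>t. (\<integral>x. u x * sin (\<Sum>i<n. t i * Y i x) \<partial>M) = 0"
    and "\<And>i. i < n \<Longrightarrow> A i \<in> sets borel"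
  shows "(\<integral>x. u x * (\<Prod>i<n. indicator (A i) (Y i x)) \<partial>M) = 0"
  using assms
proof (induction n arbitrary: u)
  case 0
  from 0(4)[of "\<lambda>_. 0"] show ?case by simp
next
  case (Suc n)
  note [measurable] = Suc.prems(1)
  have [measurable]: "Y i \<in> borel_measurable M" if "i < Suc n" for i using Suc.prems(2)[OF that] .
  have [measurable]: "A n \<in> sets borel" using Suc.prems(6) by simp
  have Yn[measurable]: "Y n \<in> borel_measurable M" using Suc.prems(2) by simp
  have th[measurable]: "(\<lambda>x. \<Sum>i<n. t i * Y i x) \<in> borel_measurable M" for t
    by (intro borel_measurable_sum borel_measurable_times) auto
  have bdd: "\<bar>u x * b\<bar> \<le> c" if "\<bar>b\<bar> \<le> 1" for x b
  proof -
    have "\<bar>u x\<bar> * \<bar>b\<bar> \<le> c * 1" using Suc.prems(3)[of x] that by (intro mult_mono) auto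
    then show ?thesis by (simp add: abs_mult)
  qed
  have int: "integrable M (\<lambda>x. u x * f x)" if "f \<in> borel_measurable M" "\<And>x. \<bar>f x\<bar> \<le> 1" for f
  proof (rule integrable_bounded)
    show "(\<lambda>x. u x * f x) \<in> borel_measurable M" using that by measurable
  qed (use bdd that in auto)
  have Sc: "(\<integral>x. u x * cos ((\<Sum>i<n. t i * Y i x) + s * Y n x) \<partial>M) = 0" for t s
    using Suc.prems(4)[of "t(n := s)"] by simp
  have Ss: "(\<integral>x. u x * sin ((\<Sum>i<n. t i * Y i x) + s * Y n x) \<partial>M) = 0" for t s
    using Suc.prems(5)[of "t(n := s)"] by simp
  have ic: "integrable M (\<lambda>x. u x * cos ((\<Sum>i<n. t i * Y i x) + s * Y n x))"
    and isn: "integrable M (\<lambda>x. u x * sin ((\<Sum>i<n. t i * Y i x) + s * Y n x))" for t s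
    by (auto intro!: int)
  \<comment> \<open>The product-to-sum formulas separate the last coordinate; the difference of
    angles is the hypothesis at frequency \<open>-s\<close>.\<close>
  have cc: "(\<integral>x. u x * cos (\<Sum>i<n. t i * Y i x) * cos (s * Y n x) \<partial>M) = 0"
    and cs: "(\<integral>x. u x * cos (\<Sum>i<n. t i * Y i x) * sin (s * Y n x) \<partial>M) = 0"
    and sc: "(\<integral>x. u x * sin (\<Sum>i<n. t i * Y i x) * cos (s * Y n x) \<partial>M) = 0"
    and ss: "(\<integral>x. u x * sin (\<Sum>i<n. t i * Y i x) * sin (s * Y n x) \<partial>M) = 0" for t s
  proof -
    have "cos a * cos b = (cos (a + b) + cos (a + - b)) / 2" for a b :: real
      by (simp add: cos_times_cos)
    then have "(\<lambda>x. u x * cos (\<Sum>i<n. t i * Y i x) * cos (s * Y n x)) =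
       (\<lambda>x. (u x * cos ((\<Sum>i<n. t i * Y i x) + s * Y n x) + u x * cos ((\<Sum>i<n. t i * Y i x) + (-s) * Y n x)) / 2)"
      by (simp add: fun_eq_iff mult.assoc distrib_left)
    then show "(\<integral>x. u x * cos (\<Sum>i<n. t i * Y i x) * cos (s * Y n x) \<partial>M) = 0"
      by (simp only: integral_divide_zero Bochner_Integration.integral_add[OF ic ic] Sc) simp
    have "sin a * sin b = (cos (a + - b) - cos (a + b)) / 2" for a b :: real
      by (simp add: sin_times_sin)
    then have "(\<lambda>x. u x * sin (\<Sum>i<n. t i * Y i x) * sin (s * Y n x)) =
       (\<lambda>x. (u x * cos ((\<Sum>i<n. t i * Y i x) + (-s) * Y n x) - u x * cos ((\<Sum>i<n. t i * Y i x) + s * Y n x)) / 2)"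
      by (simp add: fun_eq_iff mult.assoc right_diff_distrib)
    then show "(\<integral>x. u x * sin (\<Sum>i<n. t i * Y i x) * sin (s * Y n x) \<partial>M) = 0"
      by (simp only: integral_divide_zero Bochner_Integration.integral_diff[OF ic ic] Sc) simp
    have "sin a * cos b = (sin (a + b) + sin (a + - b)) / 2" for a b :: real
      by (simp add: sin_times_cos)
    then have "(\<lambda>x. u x * sin (\<Sum>i<n. t i * Y i x) * cos (s * Y n x)) =
       (\<lambda>x. (u x * sin ((\<Sum>i<n. t i * Y i x) + s * Y n x) + u x * sin ((\<Sum>i<n. t i * Y i x) + (-s) * Y n x)) / 2)"
      by (simp add: fun_eq_iff mult.assoc distrib_left)
    then show "(\<integral>x. u x * sin (\<Sum>i<n. t i * Y i x) * cos (s * Y n x) \<partial>M) = 0"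
      by (simp only: integral_divide_zero Bochner_Integration.integral_add[OF isn isn] Ss) simp
    have "cos a * sin b = (sin (a + b) - sin (a + - b)) / 2" for a b :: real
      by (simp add: cos_times_sin)
    then have "(\<lambda>x. u x * cos (\<Sum>i<n. t i * Y i x) * sin (s * Y n x)) =
       (\<lambda>x. (u x * sin ((\<Sum>i<n. t i * Y i x) + s * Y n x) - u x * sin ((\<Sum>i<n. t i * Y i x) + (-s) * Y n x)) / 2)"
      by (simp add: fun_eq_iff mult.assoc right_diff_distrib)
    then show "(\<integral>x. u x * cos (\<Sum>i<n. t i * Y i x) * sin (s * Y n x) \<partial>M) = 0"
      by (simp only: integral_divide_zero Bochner_Integration.integral_diff[OF isn isn] Ss) simp
  qed
  have "(\<integral>x. (u x * indicator (A n) (Y n x)) * (\<Prod>i<n. indicator (A i) (Y i x)) \<partial>M) = 0"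
  proof (rule Suc.IH)
    show "(\<lambda>x. u x * indicator (A n) (Y n x)) \<in> borel_measurable M" by measurable
    show "\<bar>u x * indicator (A n) (Y n x)\<bar> \<le> c" for x by (rule bdd) (simp add: indicator_def)
    fix t
    have "(\<integral>x. (u x * cos (\<Sum>i<n. t i * Y i x)) * indicator (A n) (Y n x) \<partial>M) = 0"
      by (rule signed_Levy_uniqueness[where c=c]) (auto intro!: bdd simp: cc cs)
    then show "(\<integral>x. u x * indicator (A n) (Y n x) * cos (\<Sum>i<n. t i * Y i x) \<partial>M) = 0"
      by (simp add: ac_simps)
    have "(\<integral>x. (u x * sin (\<Sum>i<n. t i * Y i x)) * indicator (A n) (Y n x) \<partial>M) = 0"
      by (rule signed_Levy_uniqueness[where c=c]) (auto intro!: bdd simp: sc ss)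
    then show "(\<integral>x. u x * indicator (A n) (Y n x) * sin (\<Sum>i<n. t i * Y i x) \<partial>M) = 0"
      by (simp add: ac_simps)
  qed (use Suc.prems in auto)
  then show ?case by (simp add: ac_simps)
qed

text \<open>Products of indicators are indicators of boxes, an intersection-stable generator.
  Tilting by \<open>u\<close> again replaces the signed measure by two probability laws of the
  vector \<open>Y\<close>, which agree on boxes and hence everywhere.\<close>

lemma (in prob_space) signed_Levy_uniqueness_PiM:
  fixes u :: "'a \<Rightarrow> real" and Y :: "nat \<Rightarrow> 'a \<Rightarrow> real"
  assumes [measurable]: "u \<in> borel_measurable M" and Y: "\<And>i. i < n \<Longrightarrow> Y i \<in> borel_measurable M" and bd: "\<And>x. \<bar>u x\<bar> \<le> c"
    and cos0: "\<And>t. (\<integral>x. u x * cos (\<Sum>i<n. t i * Y i x) \<partial>M) = 0"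
    and sin0: "\<And>t. (\<integral>x. u x * sin (\<Sum>i<n. t i * Y i x) \<partial>M) = 0"
    and B[measurable]: "B \<in> sets (Pi\<^sub>M {..<n} (\<lambda>_. borel))"
  shows "(\<integral>x. u x * indicator B (\<lambda>i\<in>{..<n}. Y i x) \<partial>M) = 0"
proof -
  let ?P = "Pi\<^sub>M {..<n} (\<lambda>_. borel :: real measure)"
  have [measurable]: "(\<lambda>x. \<lambda>i\<in>{..<n}. Y i x) \<in> M \<rightarrow>\<^sub>M ?P"
    using Y by (intro measurable_restrict) auto
  have "(\<integral>x. u x \<partial>M) = 0" using cos0[of "\<lambda>_. 0"] by simp
  then obtain w where w[measurable]: "w \<in> borel_measurable M" and w0: "\<And>x. 0 \<le> w x"
    and w_eq: "\<And>x. w x = 1 + u x / (c + 1)"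
    and pw: "prob_space (density M (\<lambda>x. ennreal (w x)))" and c: "c + 1 > 0"
    using tilt[OF assms(1) bd] by blast
  interpret W: prob_space "density M (\<lambda>x. ennreal (w x))" by (rule pw)
  define M1 where "M1 = distr (density M (\<lambda>x. ennreal (w x))) ?P (\<lambda>x. \<lambda>i\<in>{..<n}. Y i x)"
  define M2 where "M2 = distr M ?P (\<lambda>x. \<lambda>i\<in>{..<n}. Y i x)"
  interpret M1: prob_space M1 unfolding M1_def by (rule W.prob_space_distr) simp
  interpret M2: prob_space M2 unfolding M2_def by (rule prob_space_distr) simp
  have ub: "integrable M (\<lambda>x. u x * f x)" if "f \<in> borel_measurable M" "\<And>x. \<bar>f x\<bar> \<le> 1" for f :: "'a \<Rightarrow> real"
  proof (rule integrable_bounded)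
    show "(\<lambda>x. u x * f x) \<in> borel_measurable M" using that by measurable
    show "\<bar>u x * f x\<bar> \<le> c * 1" for x
      unfolding abs_mult using bd[of x] that(2)[of "x"] by (intro mult_mono) auto
  qed
  have diff: "(\<integral>y. indicator C y \<partial>M1) = (\<integral>y. indicator C y \<partial>M2) + (\<integral>x. u x * indicator C (\<lambda>i\<in>{..<n}. Y i x) \<partial>M) / (c + 1)"
    if [measurable]: "C \<in> sets ?P" for C
  proof -
    have "(\<integral>y. indicator C y \<partial>M1) = (\<integral>x. w x * indicator C (\<lambda>i\<in>{..<n}. Y i x) \<partial>M)"
      unfolding M1_def using w0
      by (subst integral_distr, simp, simp, subst integral_density) auto
    also have "\<dots> = (\<integral>x. indicator C (\<lambda>i\<in>{..<n}. Y i x) + u x * indicator C (\<lambda>i\<in>{..<n}. Y i x) / (c + 1) \<partial>M)"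
      by (intro Bochner_Integration.integral_cong refl) (simp add: w_eq algebra_simps)
    also have "\<dots> = (\<integral>x. indicator C (\<lambda>i\<in>{..<n}. Y i x) \<partial>M) + (\<integral>x. u x * indicator C (\<lambda>i\<in>{..<n}. Y i x) \<partial>M) / (c + 1)"
    proof (subst Bochner_Integration.integral_add)
      show "integrable M (\<lambda>x. indicator C (\<lambda>i\<in>{..<n}. Y i x) :: real)"
        by (rule integrable_bounded[of _ 1]) (auto simp: indicator_def)
      show "integrable M (\<lambda>x. u x * indicator C (\<lambda>i\<in>{..<n}. Y i x) / (c + 1))"
        by (intro integrable_divide_zero ub) (auto simp: indicator_def)
    qed simp
    also have "(\<integral>x. (indicator C (\<lambda>i\<in>{..<n}. Y i x) :: real) \<partial>M) = (\<integral>y. indicator C y \<partial>M2)"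
      unfolding M2_def by (subst integral_distr) auto
    finally show ?thesis .
  qed
  have "M1 = M2"
  proof (rule measure_eqI_PiM_finite[where I="{..<n}" and A="\<lambda>_. space ?P"])
    show "sets M1 = sets ?P" "sets M2 = sets ?P" by (auto simp: M1_def M2_def)
    fix A :: "nat \<Rightarrow> real set" assume A: "\<And>i. i \<in> {..<n} \<Longrightarrow> A i \<in> sets borel"
    have C: "Pi\<^sub>E {..<n} A \<in> sets ?P" using A by (intro sets_PiM_I_finite) auto
    have "indicator (Pi\<^sub>E {..<n} A) (\<lambda>i\<in>{..<n}. Y i x) = (\<Prod>i<n. indicator (A i) (Y i x) :: real)" for x
      by (auto simp: indicator_def prod.If_cases PiE_iff split: if_splits intro!: prod_zero)
    then have "(\<integral>x. u x * indicator (Pi\<^sub>E {..<n} A) (\<lambda>i\<in>{..<n}. Y i x) \<partial>M) = 0"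
      using signed_Levy_uniqueness_prod[OF assms(1) Y bd cos0 sin0, where A=A] A by simp
    then have "(\<integral>y. indicator (Pi\<^sub>E {..<n} A) y \<partial>M1) = (\<integral>y. (indicator (Pi\<^sub>E {..<n} A) y :: real) \<partial>M2)"
      using diff[OF C] by simp
    moreover have "Pi\<^sub>E {..<n} A \<in> sets M1" "Pi\<^sub>E {..<n} A \<in> sets M2"
      using C by (auto simp: M1_def M2_def)
    ultimately show "emeasure M1 (Pi\<^sub>E {..<n} A) = emeasure M2 (Pi\<^sub>E {..<n} A)"
      by (simp add: M1.emeasure_eq_measure M2.emeasure_eq_measure)
  next
    show "range (\<lambda>_. space ?P) \<subseteq> prod_algebra {..<n} (\<lambda>_. borel :: real measure)"
      by (auto simp: space_PiM intro!: prod_algebraI_finite)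
  qed (auto simp: M1.emeasure_eq_measure)
  then show ?thesis using diff[OF B] c by simp
qed

text \<open>The hypotheses force the conditional mean of \<open>Z\<close> given \<open>Y\<close> to
  be zero. Then every square integrable function of \<open>Y\<close> is orthogonal to
  \<open>Z\<close>, and adding it can only enlarge the second moment.\<close>

lemma (in prob_space) nonlinear_no_better:
  fixes Z :: "'a \<Rightarrow> real" and Y :: "nat \<Rightarrow> 'a \<Rightarrow> real"
  assumes Z: "sqint M Z" and Y: "\<And>i. i < n \<Longrightarrow> Y i \<in> borel_measurable M"
    and cos0: "\<And>s t. (\<integral>x. sin (s * Z x) * cos (\<Sum>i<n. t i * Y i x) \<partial>M) = 0"
    and sin0: "\<And>s t. (\<integral>x. sin (s * Z x) * sin (\<Sum>i<n. t i * Y i x) \<partial>M) = 0"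
    and h[measurable]: "h \<in> borel_measurable (Pi\<^sub>M {..<n} (\<lambda>_. borel))"
  shows "(\<integral>\<^sup>+x. ennreal ((Z x)\<^sup>2) \<partial>M) \<le> (\<integral>\<^sup>+x. ennreal ((Z x + h (\<lambda>i\<in>{..<n}. Y i x))\<^sup>2) \<partial>M)"
\<comment> \<open>A finite right-hand side makes \<open>h\<close> of \<open>Y\<close> square
  integrable, as the difference of \<open>Z + h\<close> and \<open>Z\<close>; an infinite one leaves
  nothing to show.\<close>
proof (cases "(\<integral>\<^sup>+x. ennreal ((Z x + h (\<lambda>i\<in>{..<n}. Y i x))\<^sup>2) \<partial>M) < \<infinity>")
  case False
  then show ?thesis by (simp add: less_top[symmetric])
next
  case True
  let ?P = "Pi\<^sub>M {..<n} (\<lambda>_. borel :: real measure)"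
  let ?Y = "\<lambda>x. \<lambda>i\<in>{..<n}. Y i x"
  have Ym[measurable]: "?Y \<in> M \<rightarrow>\<^sub>M ?P"
    using Y by (intro measurable_restrict) auto
  have Zm[measurable]: "Z \<in> borel_measurable M" using Z by (rule sqint_measurable)
  have sZh: "sqint M (\<lambda>x. Z x + h (?Y x))"
    by (rule sqintI[OF _ True]) measurable
  have sh: "sqint M (\<lambda>x. h (?Y x))"
    using sqint_diff[OF sZh Z] by simp
  have intZ: "integrable M Z"
    using sqint_mult[OF Z, of "\<lambda>_. 1"] by (simp add: sqint_def)
  \<comment> \<open>\<open>Z\<close> is the limit of the bounded functions \<open>k sin(Z/k)\<close>, which the hypotheses control.\<close>
  have ZB: "(\<integral>x. Z x * indicator B (?Y x) \<partial>M) = 0" if [measurable]: "B \<in> sets ?P" for B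
  proof -
    have 0: "(\<integral>x. sin (s * Z x) * indicator B (?Y x) \<partial>M) = 0" for s
      by (rule signed_Levy_uniqueness_PiM[where c=1 and u="\<lambda>x. sin (s * Z x)"])
        (use Y cos0 sin0 in auto)
    have "(\<lambda>k. \<integral>x. real (Suc k) * sin ((1 / real (Suc k)) * Z x) * indicator B (?Y x) \<partial>M)
        \<longlonglongrightarrow> (\<integral>x. Z x * indicator B (?Y x) \<partial>M)"
    proof (rule integral_dominated_convergence[where w="\<lambda>x. \<bar>Z x\<bar>"])
      show "integrable M (\<lambda>x. \<bar>Z x\<bar>)" using intZ by simp
      have "(\<lambda>k. real (Suc k) * sin ((1 / real (Suc k)) * z)) \<longlonglongrightarrow> z" for z
      proof (cases "z = 0")
        case False
        have "(\<lambda>k. z / real (Suc k)) \<longlonglongrightarrow> 0"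
          by (rule LIMSEQ_Suc[OF lim_const_over_n])
        then have "filterlim (\<lambda>k. z / real (Suc k)) (at 0) sequentially"
          using False by (intro filterlim_atI) auto
        moreover have "((\<lambda>x::real. sin x / x) \<longlongrightarrow> 1) (at 0)"
          using DERIV_sin[of "0::real"] by (simp add: DERIV_def)
        ultimately have "(\<lambda>k. sin (z / real (Suc k)) / (z / real (Suc k))) \<longlonglongrightarrow> 1"
          by (rule filterlim_compose[rotated])
        then have "(\<lambda>k. z * (sin (z / real (Suc k)) / (z / real (Suc k)))) \<longlonglongrightarrow> z * 1"
          by (rule tendsto_mult_left)
        moreover have "z * (sin (z / real (Suc k)) / (z / real (Suc k))) = real (Suc k) * sin ((1 / real (Suc k)) * z)" for k
          using False by (simp del: of_nat_Suc)
        ultimately show ?thesis by simp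
      qed simp
      then show "AE x in M. (\<lambda>k. real (Suc k) * sin ((1 / real (Suc k)) * Z x) * indicator B (?Y x))
          \<longlonglongrightarrow> Z x * indicator B (?Y x)"
        by (intro AE_I2 tendsto_mult_right)
      have "\<bar>real (Suc k) * sin ((1 / real (Suc k)) * z) * indicator B y\<bar> \<le> \<bar>z\<bar>" for k z y
      proof -
        have "\<bar>sin ((1 / real (Suc k)) * z)\<bar> \<le> \<bar>(1 / real (Suc k)) * z\<bar>"
          by (rule abs_sin_x_le_abs_x)
        then have "real (Suc k) * \<bar>sin ((1 / real (Suc k)) * z)\<bar> \<le> \<bar>z\<bar>"
          by (simp add: abs_mult field_simps)
        then show ?thesis by (simp add: abs_mult indicator_def)
      qed
      then show "AE x in M. norm (real (Suc k) * sin ((1 / real (Suc k)) * Z x) * indicator B (?Y x)) \<le> \<bar>Z x\<bar>" for k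
        by simp
    qed measurable
    moreover have "(\<integral>x. real (Suc k) * sin ((1 / real (Suc k)) * Z x) * indicator B (?Y x) \<partial>M) = 0" for k
      using 0[of "1 / real (Suc k)"] by (simp add: mult.assoc del: of_nat_Suc)
    ultimately show ?thesis by (simp add: LIMSEQ_const_iff)
  qed
  \<comment> \<open>The events of this sigma-algebra are exactly the preimages under the vector
    \<open>Y\<close>, so \<open>ZB\<close> is the defining property of a vanishing conditional
    expectation.\<close>
  define F where "F = vimage_algebra (space M) ?Y ?P"
  have Yspace: "?Y \<in> space M \<rightarrow> space ?P" by (auto simp: space_PiM)
  have sub: "subalgebra M F"
    unfolding subalgebra_def F_def using Ym
    by (auto simp: sets_vimage_algebra2[OF Yspace] measurable_sets)
  interpret F: finite_measure_subalgebra M F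
    by unfold_locales (rule sub)
  have ce: "AE x in M. real_cond_exp M F Z x = 0"
  proof (rule F.real_cond_exp_charact)
    fix A assume "A \<in> sets F"
    then obtain B where B: "B \<in> sets ?P" "A = ?Y -` B \<inter> space M"
      by (auto simp: F_def sets_vimage_algebra2[OF Yspace])
    have "(\<integral>x\<in>A. Z x \<partial>M) = (\<integral>x. Z x * indicator B (?Y x) \<partial>M)"
      unfolding set_lebesgue_integral_def
      by (intro Bochner_Integration.integral_cong refl) (auto simp: B indicator_def)
    then show "(\<integral>x\<in>A. Z x \<partial>M) = (\<integral>x\<in>A. 0 \<partial>M)" using ZB[OF B(1)] by simp
  qed (use intZ in auto)
  have hF: "(\<lambda>x. h (?Y x)) \<in> borel_measurable F"
    unfolding F_def by (rule measurable_compose[OF measurable_vimage_algebra1[OF Yspace] h])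
  have "(\<integral>x. h (?Y x) * Z x \<partial>M) = (\<integral>x. h (?Y x) * real_cond_exp M F Z x \<partial>M)"
    by (rule F.real_cond_exp_intg(2)[symmetric]) (use sqint_mult[OF sh Z] hF in auto)
  also have "\<dots> = 0"
    using ce by (intro integral_eq_zero_AE) auto
  finally have "ip M (\<lambda>x. h (?Y x)) Z = 0" by (simp add: ip_def)
  moreover have "ip M (\<lambda>x. Z x + h (?Y x)) (\<lambda>x. Z x + h (?Y x))
      = ip M Z Z + 2 * ip M (\<lambda>x. h (?Y x)) Z + ip M (\<lambda>x. h (?Y x)) (\<lambda>x. h (?Y x))"
    by (rule ip_add_self[OF Z sh])
  ultimately have "ip M Z Z \<le> ip M (\<lambda>x. Z x + h (?Y x)) (\<lambda>x. Z x + h (?Y x))"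
    using ip_self_nonneg[of M "\<lambda>x. h (?Y x)"] by linarith
  then show ?thesis
    unfolding nn_sqint[OF Z] nn_sqint[OF sZh] by (rule ennreal_leI)
qed

section \<open>Random interpolation with determinantal density\<close>

text \<open>The first moment method. The almost sure property \<open>P\<close> is carried along
  because the chosen nodes must also have a nonzero determinant.\<close>

lemma (in prob_space) exists_le_nn_integral:
  assumes [measurable]: "F \<in> borel_measurable M" and le: "(\<integral>\<^sup>+x. F x \<partial>M) \<le> B" and B: "B < \<infinity>"
    and P: "AE x in M. P x"
  shows "\<exists>x\<in>space M. P x \<and> F x \<le> B"
proof (rule ccontr)
  assume "\<not> ?thesis"
  then have n: "B < F x" if "x \<in> space M" "P x" for x using that by (meson not_le)
  have ae: "AE x in M. B < F x" using P AE_space by eventually_elim (rule n)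
  have "(\<integral>\<^sup>+x. B \<partial>M) < (\<integral>\<^sup>+x. F x \<partial>M)"
  proof (rule nn_integral_less)
    show "(\<integral>\<^sup>+x. B \<partial>M) \<noteq> \<infinity>" using B by (simp add: emeasure_space_1)
    show "AE x in M. B \<le> F x" using ae by eventually_elim simp
    show "\<not> (AE x in M. F x \<le> B)"
    proof
      assume "AE x in M. F x \<le> B"
      with ae have "AE x in M. False" by eventually_elim simp
      then show False by simp
    qed
  qed auto
  with le show False by (simp add: emeasure_space_1)
qed

text \<open>
  Derandomised averaging of \<open>k\<close> independent copies of an unbiased estimator: choosing the sample
  points one after the other avoids \<open>k\<close>-fold product measures, since the cross terms vanish at each step.
\<close>

lemma averaging_selection:
  fixes c :: "nat \<Rightarrow> 'x \<Rightarrow> 'v \<Rightarrow> real"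
  assumes T: "prob_space T" and Q: "prob_space Q"
    and meas: "\<And>j. j < m \<Longrightarrow> (\<lambda>(x, f). c j x f) \<in> borel_measurable (T \<Otimes>\<^sub>M Q)"
    and sq: "\<And>j f. j < m \<Longrightarrow> f \<in> space Q \<Longrightarrow> sqint T (\<lambda>x. c j x f)"
    and zero: "\<And>j f. j < m \<Longrightarrow> f \<in> space Q \<Longrightarrow> (\<integral>x. c j x f \<partial>T) = 0"
    and second: "\<And>j f. j < m \<Longrightarrow> f \<in> space Q \<Longrightarrow> (\<integral>x. (c j x f)\<^sup>2 \<partial>T) \<le> r f"
    and r[measurable]: "r \<in> borel_measurable Q" and R: "(\<integral>\<^sup>+f. ennreal (r f) \<partial>Q) < \<infinity>"
    and P: "AE x in T. P x"
  shows "\<exists>X. (\<forall>i<k. X i \<in> space T \<and> P (X i)) \<and>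
     (\<integral>\<^sup>+f. (\<Sum>j<m. ennreal ((\<Sum>i<k. c j (X i) f)\<^sup>2)) \<partial>Q) \<le> of_nat (k * m) * (\<integral>\<^sup>+f. ennreal (r f) \<partial>Q)"
proof (induction k)
  case 0
  show ?case by simp
next
  case (Suc k)
  interpret T: prob_space T by fact
  interpret Q: prob_space Q by fact
  interpret TQ: pair_sigma_finite T Q ..
  let ?R = "\<integral>\<^sup>+f. ennreal (r f) \<partial>Q"
  from Suc obtain X where X: "\<And>i. i < k \<Longrightarrow> X i \<in> space T \<and> P (X i)"
    and le: "(\<integral>\<^sup>+f. (\<Sum>j<m. ennreal ((\<Sum>i<k. c j (X i) f)\<^sup>2)) \<partial>Q) \<le> of_nat (k * m) * ?R"
    by auto
  define S where "S j f = (\<Sum>i<k. c j (X i) f)" for j f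
  have [measurable]: "c j x \<in> borel_measurable Q" if "j < m" "x \<in> space T" for j x
    using measurable_compose[OF measurable_Pair1'[OF that(2)] meas[OF that(1)]] by simp
  have S[measurable]: "S j \<in> borel_measurable Q" if "j < m" for j
    unfolding S_def[abs_def] using that X by (intro borel_measurable_sum) auto
  have [measurable]: "(\<lambda>xf. c j (fst xf) (snd xf)) \<in> borel_measurable (T \<Otimes>\<^sub>M Q)" if "j < m" for j
    using meas[OF that] by (simp add: case_prod_beta)
  define G where "G x f = (\<Sum>j<m. ennreal ((S j f + c j x f)\<^sup>2))" for x f
  have G[measurable]: "(\<lambda>xf. G (fst xf) (snd xf)) \<in> borel_measurable (T \<Otimes>\<^sub>M Q)"
    unfolding G_def
  proof (intro borel_measurable_sum)
    fix j assume "j \<in> {..<m}"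
    then have [measurable]: "(\<lambda>xf. c j (fst xf) (snd xf)) \<in> borel_measurable (T \<Otimes>\<^sub>M Q)"
      "S j \<in> borel_measurable Q" using meas[of j] S[of j] by (auto simp: case_prod_beta)
    show "(\<lambda>xf. ennreal ((S j (snd xf) + c j (fst xf) (snd xf))\<^sup>2)) \<in> borel_measurable (T \<Otimes>\<^sub>M Q)"
      by measurable
  qed
  have G'[measurable]: "case_prod G \<in> borel_measurable (T \<Otimes>\<^sub>M Q)"
    using G by (simp add: case_prod_beta')
  have inner: "(\<integral>\<^sup>+x. G x f \<partial>T) \<le> (\<Sum>j<m. ennreal ((S j f)\<^sup>2)) + of_nat m * ennreal (r f)" if f: "f \<in> space Q" for f
  proof -
    have sub: "(\<integral>\<^sup>+x. ennreal ((S j f + c j x f)\<^sup>2) \<partial>T) \<le> ennreal ((S j f)\<^sup>2) + ennreal (r f)" if j: "j < m" for j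
    proof -
      have c1: "sqint T (\<lambda>x. S j f)" by (simp add: sqint_def)
      have "(\<integral>\<^sup>+x. ennreal ((S j f + c j x f)\<^sup>2) \<partial>T)
          = ennreal (ip T (\<lambda>x. S j f + c j x f) (\<lambda>x. S j f + c j x f))"
        by (rule nn_sqint[OF sqint_add[OF c1 sq[OF j f]]])
      also have "ip T (\<lambda>x. S j f + c j x f) (\<lambda>x. S j f + c j x f) = (S j f)\<^sup>2 + (\<integral>x. (c j x f)\<^sup>2 \<partial>T)"
        unfolding ip_add_self[OF c1 sq[OF j f]]
        by (simp add: ip_self zero[OF j f] ip_def T.prob_space power2_eq_square)
      also have "ennreal \<dots> \<le> ennreal ((S j f)\<^sup>2 + r f)"
        using second[OF j f] by (intro ennreal_leI) simp
      also have "\<dots> = ennreal ((S j f)\<^sup>2) + ennreal (r f)"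
      proof (rule ennreal_plus)
        have "0 \<le> (\<integral>x. (c j x f)\<^sup>2 \<partial>T)" by simp
        then show "0 \<le> r f" using second[OF j f] by linarith
      qed simp
      finally show ?thesis .
    qed
    have "(\<integral>\<^sup>+x. G x f \<partial>T) = (\<Sum>j<m. \<integral>\<^sup>+x. ennreal ((S j f + c j x f)\<^sup>2) \<partial>T)"
      unfolding G_def using sq[OF _ f] by (intro nn_integral_sum) (auto dest!: sqint_measurable)
    also have "\<dots> \<le> (\<Sum>j<m. ennreal ((S j f)\<^sup>2) + ennreal (r f))"
      by (intro sum_mono sub) simp
    finally show ?thesis by (simp add: sum.distrib)
  qed
  have "(\<integral>\<^sup>+x. (\<integral>\<^sup>+f. G x f \<partial>Q) \<partial>T) = (\<integral>\<^sup>+f. (\<integral>\<^sup>+x. G x f \<partial>T) \<partial>Q)"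
    by (rule TQ.Fubini'[symmetric]) simp
  also have "\<dots> \<le> (\<integral>\<^sup>+f. (\<Sum>j<m. ennreal ((S j f)\<^sup>2)) + of_nat m * ennreal (r f) \<partial>Q)"
    by (rule nn_integral_mono) (rule inner)
  also have "\<dots> = (\<integral>\<^sup>+f. (\<Sum>j<m. ennreal ((S j f)\<^sup>2)) \<partial>Q) + of_nat m * ?R"
    by (subst nn_integral_add) (auto simp: nn_integral_cmult)
  also have "\<dots> \<le> of_nat (k * m) * ?R + of_nat m * ?R"
    using le unfolding S_def by (rule add_right_mono)
  also have "\<dots> = of_nat (Suc k * m) * ?R"
    by (simp add: distrib_right[symmetric] add.commute)
  finally have *: "(\<integral>\<^sup>+x. (\<integral>\<^sup>+f. G x f \<partial>Q) \<partial>T) \<le> of_nat (Suc k * m) * ?R" .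
  have fin: "of_nat (Suc k * m) * ?R < \<infinity>"
    using R of_nat_less_top[of "Suc k * m"] by (simp add: ennreal_mult_less_top del: of_nat_mult of_nat_Suc mult_Suc)
  have "\<exists>x\<in>space T. P x \<and> (\<integral>\<^sup>+f. G x f \<partial>Q) \<le> of_nat (Suc k * m) * ?R"
    by (rule T.exists_le_nn_integral[OF _ * fin P]) (rule Q.borel_measurable_nn_integral[OF G'])
  then obtain x where x: "x \<in> space T" "P x" "(\<integral>\<^sup>+f. G x f \<partial>Q) \<le> of_nat (Suc k * m) * ?R" by blast
  have "(\<Sum>i<Suc k. c j ((X(k := x)) i) f) = S j f + c j x f" for j f
    by (simp add: S_def)
  then show ?case
    using X x by (intro exI[of _ "X(k := x)"]) (auto simp: less_Suc_eq G_def simp del: sum.lessThan_Suc)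
qed

section \<open>The Leibniz determinant of the matrix \<open>b l (x i)\<close> and Cramer's
  rule\<close>

definition vdet :: "nat \<Rightarrow> (nat \<Rightarrow> 'a \<Rightarrow> real) \<Rightarrow> (nat \<Rightarrow> 'a) \<Rightarrow> real" where
  "vdet m b x = (\<Sum>p | p permutes {..<m}. of_int (sign p) * (\<Prod>l<m. b l (x (p l))))"

text \<open>The determinant with column \<open>j\<close> replaced by the vector \<open>w\<close>, the numerator in Cramer's rule.\<close>

definition cofac :: "nat \<Rightarrow> (nat \<Rightarrow> 'a \<Rightarrow> real) \<Rightarrow> (nat \<Rightarrow> 'a) \<Rightarrow> nat \<Rightarrow> (nat \<Rightarrow> real) \<Rightarrow> real" where
  "cofac m b x j w =
     (\<Sum>p | p permutes {..<m}. of_int (sign p) * (w (p j) * (\<Prod>l\<in>{..<m}-{j}. b l (x (p l)))))"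

lemma cofac_eq_vdet:
  assumes "j < m"
  shows "cofac m b x j (\<lambda>i. h (x i)) = vdet m (b(j := h)) x"
  unfolding cofac_def vdet_def
  using assms by (intro sum.cong refl) (auto simp: prod.remove[of "{..<m}" j])

lemma cofac_diff: "cofac m b x j (\<lambda>i. v i - w i) = cofac m b x j v - cofac m b x j w"
  by (simp add: cofac_def left_diff_distrib right_diff_distrib sum_subtractf)

lemma cofac_sum: "cofac m b x j (\<lambda>i. \<Sum>k\<in>K. a k * w k i) = (\<Sum>k\<in>K. a k * cofac m b x j (w k))"
  unfolding cofac_def sum_distrib_left sum_distrib_right
  by (subst sum.swap) (simp add: ac_simps)

text \<open>Composing every permutation with the transposition of the two columns flips the sign and
  leaves the products unchanged, so the determinant is its own negative.\<close>

lemma vdet_equal_columns: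
  assumes "j < m" "k < m" "j \<noteq> k" "u j = u k"
  shows "vdet m u x = 0"
proof -
  let ?t = "Transposition.transpose j k"
  have t: "?t permutes {..<m}" using assms by (intro permutes_swap_id) auto
  have "vdet m u x = (\<Sum>p | p permutes {..<m}. of_int (sign (p \<circ> ?t)) * (\<Prod>l<m. u l (x ((p \<circ> ?t) l))))"
    unfolding vdet_def by (rule sum_permutations_compose_right[OF t])
  also have "\<dots> = (\<Sum>p | p permutes {..<m}. - (of_int (sign p) * (\<Prod>l<m. u l (x (p l)))))"
  proof (intro sum.cong refl)
    fix p assume "p \<in> {p. p permutes {..<m}}"
    then have p: "permutation p" by (auto simp: permutation_permutes intro: exI[of _ "{..<m}"])
    have "sign (p \<circ> ?t) = - sign p"
      using assms p by (simp add: sign_compose permutation_swap_id sign_swap_id)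
    moreover have "u l = u (?t l)" for l using assms by (auto simp: Transposition.transpose_def)
    then have "(\<Prod>l<m. u l (x ((p \<circ> ?t) l))) = (\<Prod>l<m. u (?t l) (x (p (?t l))))"
      by simp
    moreover have "\<dots> = (\<Prod>l<m. u l (x (p l)))"
      using prod.permute[OF t, of "\<lambda>l. u l (x (p l))"] by (simp add: o_def)
    ultimately show "of_int (sign (p \<circ> ?t)) * (\<Prod>l<m. u l (x ((p \<circ> ?t) l))) =
        - (of_int (sign p) * (\<Prod>l<m. u l (x (p l))))" by simp
  qed
  also have "\<dots> = - vdet m u x" by (simp add: vdet_def sum_negf)
  finally show ?thesis by simp
qed

text \<open>After division by the determinant, Cramer's rule reproduces the coefficients of every
  function in the span. Interpolation is exact there, and only the residual of \<open>f\<close>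
  causes an error.\<close>

lemma cofac_basis:
  assumes "j < m" "k < m"
  shows "cofac m b x j (\<lambda>i. b k (x i)) = (if k = j then vdet m b x else 0)"
  using assms by (auto simp: cofac_eq_vdet fun_upd_idem intro!: vdet_equal_columns[of j m k])

lemma cofac_cong:
  assumes "j < m" and *: "\<And>i. i < m \<Longrightarrow> v i = w i"
  shows "cofac m b x j v = cofac m b x j w"
  unfolding cofac_def
proof (intro sum.cong refl)
  fix p assume "p \<in> {p. p permutes {..<m}}"
  then have "p j < m" using permutes_in_image[of p "{..<m}" j] assms(1) by simp
  then show "of_int (sign p) * (v (p j) * (\<Prod>l\<in>{..<m} - {j}. b l (x (p l)))) =
      of_int (sign p) * (w (p j) * (\<Prod>l\<in>{..<m} - {j}. b l (x (p l))))"
    using * by simp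
qed

text \<open>Used to place the nodes: the basis vanishes off the domain, so a tuple with a nonzero
  determinant has all its nodes inside.\<close>

lemma vdet_zero_row:
  assumes "l < m" "\<And>k. k < m \<Longrightarrow> b k (x l) = 0"
  shows "vdet m b x = 0"
  unfolding vdet_def
proof (intro sum.neutral ballI)
  fix p assume "p \<in> {p. p permutes {..<m}}"
  then have p: "p permutes {..<m}" by simp
  have "inv p l < m" using permutes_in_image[OF permutes_inv[OF p], of l] assms(1) by simp
  moreover have "p (inv p l) = l" using permutes_inverses(1)[OF p] by simp
  ultimately have "(\<Prod>k<m. b k (x (p k))) = 0"
    using assms(2) by (intro prod_zero) (auto intro!: bexI[of _ "inv p l"])
  then show "of_int (sign p) * (\<Prod>k<m. b k (x (p k))) = 0" by simp
qed

text \<open>The law of the determinantal (projection) ensemble of \<open>b\<close>. For orthonormal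
  \<open>b\<close> the normalisation is \<open>fact m\<close>, one unit for each permutation in the
  expansion of the squared determinant.\<close>

definition tilted :: "'a measure \<Rightarrow> nat \<Rightarrow> (nat \<Rightarrow> 'a \<Rightarrow> real) \<Rightarrow> (nat \<Rightarrow> 'a) measure" where
  "tilted M m b = density (Pi\<^sub>M {..<m} (\<lambda>_. M)) (\<lambda>x. ennreal ((vdet m b x)\<^sup>2 / fact m))"

section \<open>Integrals of products of determinants and the law of the random nodes\<close>

context
  fixes M :: "'a measure"
  assumes prob: "prob_space M"
begin

interpretation M: prob_space M by (rule prob)
interpretation PM: product_sigma_finite "\<lambda>_::nat. M" ..

lemma vdet_measurable:
  assumes "\<And>l. l < m \<Longrightarrow> u l \<in> borel_measurable M"
  shows "vdet m u \<in> borel_measurable (Pi\<^sub>M {..<m} (\<lambda>_. M))"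
  unfolding vdet_def[abs_def]
proof (intro borel_measurable_sum borel_measurable_times borel_measurable_const borel_measurable_prod)
  fix p l assume "p \<in> {p. p permutes {..<m}}" "l \<in> {..<m}"
  then have "p l \<in> {..<m}" "u l \<in> borel_measurable M" using permutes_in_image assms by fastforce+
  then show "(\<lambda>x. u l (x (p l))) \<in> borel_measurable (Pi\<^sub>M {..<m} (\<lambda>_. M))"
    by (intro measurable_compose[OF measurable_component_singleton]) auto
qed

text \<open>\<open>inv p i\<close> is the column matched with node \<open>i\<close>. Sorting the
  products by node instead of column lets the integral over the product measure factorise.\<close>

lemma vdet_mult:
  "vdet m u x * vdet m v x = (\<Sum>p | p permutes {..<m}. \<Sum>q | q permutes {..<m}.
     of_int (sign p * sign q) * (\<Prod>i<m. u (inv p i) (x i) * v (inv q i) (x i)))"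
proof -
  have *: "(\<Prod>l<m. u l (x (p l))) = (\<Prod>i<m. u (inv p i) (x i))" if "p permutes {..<m}" for p and u :: "nat \<Rightarrow> 'b \<Rightarrow> real"
    using prod.permute[OF that, of "\<lambda>i. u (inv p i) (x i)"] that
    by (simp add: o_def permutes_inverses)
  show ?thesis
    unfolding vdet_def sum_product
    by (intro sum.cong refl) (simp add: * prod.distrib ac_simps)
qed

lemma vdet_mult_integrable:
  assumes u: "\<And>l. l < m \<Longrightarrow> sqint M (u l)" and v: "\<And>l. l < m \<Longrightarrow> sqint M (v l)"
  shows "integrable (Pi\<^sub>M {..<m} (\<lambda>_. M)) (\<lambda>x. vdet m u x * vdet m v x)"
  unfolding vdet_mult
proof (intro Bochner_Integration.integrable_sum integrable_mult_right PM.product_integrable_prod sqint_mult u v)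
  fix p i assume "p \<in> {p. p permutes {..<m}}" "i \<in> {..<m}"
  then show "inv p i < m" using permutes_in_image[OF permutes_inv, of p "{..<m}" i] by simp
qed (auto dest: permutes_inv simp: permutes_in_image[OF permutes_inv, of _ "{..<m}", simplified])

text \<open>The Andreief identity in the biorthogonal case. For two different permutations some node
  carries two different columns, whose inner product is zero; the \<open>fact m\<close> diagonal
  pairs all give the same product.\<close>

lemma vdet_mult_integral:
  assumes u: "\<And>l. l < m \<Longrightarrow> sqint M (u l)" and v: "\<And>l. l < m \<Longrightarrow> sqint M (v l)"
    and orth: "\<And>a c. a < m \<Longrightarrow> c < m \<Longrightarrow> a \<noteq> c \<Longrightarrow> ip M (u a) (v c) = 0"
  shows "(\<integral>x. vdet m u x * vdet m v x \<partial>Pi\<^sub>M {..<m} (\<lambda>_. M)) = fact m * (\<Prod>l<m. ip M (u l) (v l))"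
proof -
  have lt: "inv p i < m" if "p permutes {..<m}" "i < m" for p i
    using permutes_in_image[OF permutes_inv[OF that(1)], of i] that(2) by simp
  have int: "integrable (Pi\<^sub>M {..<m} (\<lambda>_. M)) (\<lambda>x. \<Prod>i<m. u (inv p i) (x i) * v (inv q i) (x i))"
    if "p permutes {..<m}" "q permutes {..<m}" for p q
    using that by (intro PM.product_integrable_prod sqint_mult u v lt) auto
  have val: "(\<integral>x. (\<Prod>i<m. u (inv p i) (x i) * v (inv q i) (x i)) \<partial>Pi\<^sub>M {..<m} (\<lambda>_. M))
      = (if p = q then \<Prod>l<m. ip M (u l) (v l) else 0)"
    if p: "p permutes {..<m}" and q: "q permutes {..<m}" for p q
  proof -
    have "(\<integral>x. (\<Prod>i<m. u (inv p i) (x i) * v (inv q i) (x i)) \<partial>Pi\<^sub>M {..<m} (\<lambda>_. M))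
        = (\<Prod>i<m. ip M (u (inv p i)) (v (inv q i)))"
      unfolding ip_def using p q by (intro PM.product_integral_prod sqint_mult u v lt) auto
    also have "\<dots> = (if p = q then \<Prod>l<m. ip M (u l) (v l) else 0)"
    proof (cases "p = q")
      case True
      then show ?thesis
        using prod.permute[OF permutes_inv[OF p], of "\<lambda>l. ip M (u l) (v l)"] by (simp add: o_def)
    next
      case False
      then have "inv p \<noteq> inv q" using p q by (metis permutes_inv_inv)
      then obtain i where i: "inv p i \<noteq> inv q i" by auto
      then have "i < m" using permutes_not_in[OF permutes_inv[OF p], of i] permutes_not_in[OF permutes_inv[OF q], of i]
        by (metis lessThan_iff)
      then show ?thesis using False i orth[OF lt[OF p] lt[OF q]] by (auto intro!: prod_zero)
    qed
    finally show ?thesis .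
  qed
  have "(\<integral>x. vdet m u x * vdet m v x \<partial>Pi\<^sub>M {..<m} (\<lambda>_. M)) =
      (\<Sum>p | p permutes {..<m}. \<Sum>q | q permutes {..<m}.
        of_int (sign p * sign q) * (if p = q then \<Prod>l<m. ip M (u l) (v l) else 0))"
    unfolding vdet_mult using int val
    by (subst Bochner_Integration.integral_sum, force)
      (intro sum.cong refl, subst Bochner_Integration.integral_sum, auto)
  also have "\<dots> = (\<Sum>p | p permutes {..<m}. \<Prod>l<m. ip M (u l) (v l))"
    by (intro sum.cong refl)
      (simp add: if_distrib[of "(*) _"] finite_permutations of_int_mult[symmetric] del: of_int_mult cong: if_cong)
  also have "\<dots> = fact m * (\<Prod>l<m. ip M (u l) (v l))"
    by (simp add: card_permutations)
  finally show ?thesis .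
qed

context
  fixes m b
  assumes b: "orthonormal M m b"
begin

lemma vdet_b_measurable[measurable]: "vdet m b \<in> borel_measurable (Pi\<^sub>M {..<m} (\<lambda>_. M))"
  using b by (intro vdet_measurable) (auto simp: orthonormal_def)

lemma prob_space_tilted: "prob_space (tilted M m b)"
proof
  have bs: "sqint M (b l)" if "l < m" for l using b that by (simp add: orthonormal_def)
  have "(\<integral>x. (vdet m b x)\<^sup>2 \<partial>Pi\<^sub>M {..<m} (\<lambda>_. M)) = fact m"
    using vdet_mult_integral[OF bs bs] b by (simp add: orthonormal_def power2_eq_square)
  then have "(\<integral>x. (vdet m b x)\<^sup>2 / fact m \<partial>Pi\<^sub>M {..<m} (\<lambda>_. M)) = 1"
    by (simp del: of_nat_fact)
  moreover have "integrable (Pi\<^sub>M {..<m} (\<lambda>_. M)) (\<lambda>x. (vdet m b x)\<^sup>2 / fact m)"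
    using vdet_mult_integrable[OF bs bs] by (simp add: power2_eq_square)
  ultimately show "emeasure (tilted M m b) (space (tilted M m b)) = 1"
    unfolding tilted_def
    by (subst emeasure_density) (auto simp: nn_integral_eq_integral simp del: integral_divide_zero cong: nn_integral_cong)
qed

lemma AE_tilted: "AE x in tilted M m b. vdet m b x \<noteq> 0"
  unfolding tilted_def by (subst AE_density) auto

text \<open>By Cramer's rule \<open>c\<close> is a quotient of determinants, with \<open>g\<close>
  in place of column \<open>j\<close> in the numerator. In the mean, the density cancels the
  denominator once and leaves a mixed determinant integral with the factor
  \<open>ip M g (b j) = 0\<close>. In the second moment it cancels the squared denominator and
  leaves the squared norms of \<open>g\<close> and of the other, normalised columns.\<close>

lemma tilted_interpolation:
  assumes g: "sqint M g" and orth: "\<And>k. k < m \<Longrightarrow> ip M g (b k) = 0" and j: "j < m"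
  defines "c \<equiv> \<lambda>x. cofac m b x j (\<lambda>i. g (x i)) / vdet m b x"
  shows "sqint (tilted M m b) c" "(\<integral>x. c x \<partial>tilted M m b) = 0"
    "(\<integral>x. (c x)\<^sup>2 \<partial>tilted M m b) \<le> ip M g g"
proof -
  let ?P = "Pi\<^sub>M {..<m} (\<lambda>_. M)"
  let ?v = "b(j := g)"
  have bs: "sqint M (b l)" if "l < m" for l using b that by (simp add: orthonormal_def)
  have vs: "sqint M (?v l)" if "l < m" for l using bs[OF that] g by simp
  have c_eq: "c x = vdet m ?v x / vdet m b x" for x
    unfolding c_def using j by (simp add: cofac_eq_vdet)
  have [measurable]: "vdet m ?v \<in> borel_measurable ?P"
    by (rule vdet_measurable) (use vs in auto)
  have cm[measurable]: "c \<in> borel_measurable ?P"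
    unfolding c_eq[abs_def] by measurable
  have vv: "integrable ?P (\<lambda>x. (vdet m ?v x)\<^sup>2)"
    using vdet_mult_integrable[of m ?v ?v, OF vs vs] by (simp add: power2_eq_square)
  have "ip M (?v a) (?v k) = 0" if "a < m" "k < m" "a \<noteq> k" for a k
    using that b orth[of a] orth[of k] by (auto simp: orthonormal_def ip_commute[of M _ g])
  then have "(\<integral>x. vdet m ?v x * vdet m ?v x \<partial>?P) = fact m * (\<Prod>l<m. ip M (?v l) (?v l))"
    by (intro vdet_mult_integral vs) auto
  also have "(\<Prod>l<m. ip M (?v l) (?v l)) = ip M g g"
    using b j by (simp add: prod.remove[of "{..<m}" j] orthonormal_def)
  finally have vvi: "(\<integral>x. (vdet m ?v x)\<^sup>2 \<partial>?P) = fact m * ip M g g"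
    unfolding power2_eq_square .
  \<comment> \<open>Only an inequality: where \<open>vdet m b x = 0\<close> the left-hand side is 0,
    while the determinant with the replaced column may be nonzero.\<close>
  have le: "(vdet m b x)\<^sup>2 / fact m * (c x)\<^sup>2 \<le> (vdet m ?v x)\<^sup>2 / fact m" for x
    by (cases "vdet m b x = 0") (auto simp: c_eq power_divide)
  have ci: "integrable ?P (\<lambda>x. (vdet m b x)\<^sup>2 / fact m * (c x)\<^sup>2)"
    by (rule Bochner_Integration.integrable_bound[OF integrable_divide_zero[OF vv, of "fact m"]])
      (use le in auto)
  show "sqint (tilted M m b) c"
    unfolding sqint_def tilted_def using ci by (subst integrable_density) auto
  have "(\<integral>x. (c x)\<^sup>2 \<partial>tilted M m b) = (\<integral>x. (vdet m b x)\<^sup>2 / fact m * (c x)\<^sup>2 \<partial>?P)"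
    unfolding tilted_def by (subst integral_density) auto
  also have "\<dots> \<le> (\<integral>x. (vdet m ?v x)\<^sup>2 / fact m \<partial>?P)"
    using ci vv le by (intro integral_mono) auto
  also have "\<dots> = ip M g g" using vvi by simp
  finally show "(\<integral>x. (c x)\<^sup>2 \<partial>tilted M m b) \<le> ip M g g" .
  have "ip M (?v a) (b k) = 0" if "a < m" "k < m" "a \<noteq> k" for a k
    using that b orth[of k] by (auto simp: orthonormal_def)
  then have "(\<integral>x. vdet m ?v x * vdet m b x \<partial>?P) = fact m * (\<Prod>l<m. ip M (?v l) (b l))"
    by (intro vdet_mult_integral vs bs) auto
  also have "(\<Prod>l<m. ip M (?v l) (b l)) = 0"
    using j orth[OF j] by (intro prod_zero) (auto intro!: bexI[of _ j])
  finally have z: "(\<integral>x. vdet m ?v x * vdet m b x \<partial>?P) = 0" unfolding mult_zero_right .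
  have "(\<integral>x. c x \<partial>tilted M m b) = (\<integral>x. (vdet m b x)\<^sup>2 / fact m * c x \<partial>?P)"
    unfolding tilted_def by (subst integral_density) auto
  also have "\<dots> = (\<integral>x. vdet m ?v x * vdet m b x / fact m \<partial>?P)"
    by (intro Bochner_Integration.integral_cong refl) (simp add: c_eq power2_eq_square)
  finally show "(\<integral>x. c x \<partial>tilted M m b) = 0" using z by simp
qed

end

end

section \<open>The average case setting for a fixed dimension\<close>

locale avg_case =
  fixes d :: nat and D :: "point set" and \<rho> :: "point \<Rightarrow> real" and V :: "fn set"
    and N :: "fn \<Rightarrow> real" and \<mu> :: "fn measure"
  assumes setting: "avg_setting d D \<rho> V N \<mu>"
begin

lemma D_sets [measurable]: "D \<in> sets (Rd d)"
  and D_pos: "emeasure (Rd d) D > 0"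
  and rho_measurable [measurable]: "\<rho> \<in> borel_measurable (Rd d)"
  and rho_nonneg: "x \<in> D \<Longrightarrow> 0 \<le> \<rho> x"
  and rho_integral: "(\<integral>\<^sup>+ x \<in> D. ennreal (\<rho> x) \<partial>Rd d) = 1"
  and V_off: "f \<in> V \<Longrightarrow> x \<notin> D \<Longrightarrow> f x = 0"
  and V_zero: "(\<lambda>_. 0) \<in> V"
  and V_add: "f \<in> V \<Longrightarrow> g \<in> V \<Longrightarrow> (\<lambda>x. f x + g x) \<in> V"
  and V_cmult: "f \<in> V \<Longrightarrow> (\<lambda>x. c * f x) \<in> V"
  and N_zero: "f \<in> V \<Longrightarrow> N f = 0 \<longleftrightarrow> f = (\<lambda>_. 0)"
  and N_triangle: "f \<in> V \<Longrightarrow> g \<in> V \<Longrightarrow> N (\<lambda>x. f x + g x) \<le> N f + N g"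
  and N_cmult: "f \<in> V \<Longrightarrow> N (\<lambda>x. c * f x) = \<bar>c\<bar> * N f"
  and separable: "\<exists>S\<subseteq>V. countable S \<and> (\<forall>f\<in>V. \<forall>e>0. \<exists>g\<in>S. N (\<lambda>x. f x - g x) < e)"
  and V_measurable [measurable_dest]: "f \<in> V \<Longrightarrow> f \<in> borel_measurable (Rd d)"
  and V_finite: "f \<in> V \<Longrightarrow> G_sqnorm d D \<rho> f < \<infinity>"
  and embedding: "\<exists>C. \<forall>f\<in>V. G_sqnorm d D \<rho> f \<le> ennreal ((C * N f)\<^sup>2)"
  and evaluation: "x \<in> D \<Longrightarrow> \<exists>C. \<forall>f\<in>V. \<bar>f x\<bar> \<le> C * N f"
  and prob_mu: "prob_space \<mu>"
  and space_mu [simp]: "space \<mu> = V"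
  and sets_mu: "sets \<mu> = sigma_sets V {U. norm_open V N U}"
  and gaussian: "cont_lin_fun V N L \<Longrightarrow> \<exists>\<sigma>\<ge>0. distr \<mu> borel L =
      (if \<sigma> = 0 then return borel 0 else density lborel (normal_density 0 \<sigma>))"
  by (insert setting[unfolded avg_setting_def]; elim conjE; (assumption | erule (1) bspec | simp | fast))+

sublocale mu: prob_space \<mu> by (rule prob_mu)

lemma V_diff: "f \<in> V \<Longrightarrow> g \<in> V \<Longrightarrow> (\<lambda>x. f x - g x) \<in> V"
  using V_add[OF _ V_cmult[of g "-1"], of f] by simp

lemma N_nonneg:
  assumes "f \<in> V" shows "0 \<le> N f"
proof -
  have "N (\<lambda>x. f x + (-1) * f x) \<le> N f + N (\<lambda>x. (-1) * f x)"
    by (rule N_triangle[OF assms V_cmult[OF assms]])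
  moreover have "N (\<lambda>x. (-1) * f x) = N f" using N_cmult[OF assms, of "-1"] by simp
  moreover have "N (\<lambda>x. f x + (-1) * f x) = 0" using N_zero[OF V_zero] by simp
  ultimately show ?thesis by simp
qed

definition \<nu> :: "point measure" where
  "\<nu> = density (Rd d) (\<lambda>x. ennreal (\<rho> x) * indicator D x)"

lemma sets_nu [simp, measurable_cong]: "sets \<nu> = sets (Rd d)"
  and space_nu [simp]: "space \<nu> = space (Rd d)"
  by (simp_all add: \<nu>_def)

sublocale nu: prob_space \<nu>
proof
  show "emeasure \<nu> (space \<nu>) = 1"
    unfolding \<nu>_def using rho_integral by (simp add: emeasure_density cong: nn_integral_cong)
qed

lemma emeasure_nu_space [simp]: "emeasure \<nu> (space (Rd d)) = 1"
  and emeasure_mu_space [simp]: "emeasure \<mu> V = 1"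
  using nu.emeasure_space_1 mu.emeasure_space_1 by simp_all

sublocale mu_nu: pair_prob_space \<mu> \<nu> ..

lemma G_sqnorm_eq:
  assumes [measurable]: "g \<in> borel_measurable (Rd d)"
  shows "G_sqnorm d D \<rho> g = (\<integral>\<^sup>+x. ennreal ((g x)\<^sup>2) \<partial>\<nu>)"
proof -
  have "(\<integral>\<^sup>+x. ennreal ((g x)\<^sup>2) \<partial>\<nu>) = (\<integral>\<^sup>+x. (ennreal (\<rho> x) * indicator D x) * ennreal ((g x)\<^sup>2) \<partial>Rd d)"
    unfolding \<nu>_def by (rule nn_integral_density) measurable
  also have "\<dots> = G_sqnorm d D \<rho> g"
    unfolding G_sqnorm_def
    by (intro nn_integral_cong) (auto simp: indicator_def ennreal_mult rho_nonneg)
  finally show ?thesis by simp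
qed

lemma sqint_V: "f \<in> V \<Longrightarrow> sqint \<nu> f"
  using V_finite[of f] V_measurable[of f] by (intro sqintI) (auto simp: G_sqnorm_eq)

lemma ip_nu_embedding: "\<exists>C. \<forall>f\<in>V. ip \<nu> f f \<le> (C * N f)\<^sup>2"
proof -
  obtain C where C: "\<forall>f\<in>V. G_sqnorm d D \<rho> f \<le> ennreal ((C * N f)\<^sup>2)" using embedding by blast
  have "ip \<nu> f f \<le> (C * N f)\<^sup>2" if "f \<in> V" for f
    using bspec[OF C that] nn_sqint[OF sqint_V[OF that]] V_measurable[OF that]
    by (simp add: G_sqnorm_eq ennreal_le_iff)
  then show ?thesis by blast
qed

section \<open>Continuous linear functionals: measurability and closure properties\<close>

lemma cont_lin_measurable [measurable_dest]:
  assumes L: "cont_lin_fun V N L"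
  shows "L \<in> borel_measurable \<mu>"
proof (rule borel_measurableI)
  fix S :: "real set" assume S: "open S"
  obtain C where C: "\<And>f. f \<in> V \<Longrightarrow> \<bar>L f\<bar> \<le> C * N f" using L unfolding cont_lin_fun_def by blast
  have "norm_open V N (L -` S \<inter> V)"
    unfolding norm_open_def
  proof (intro conjI ballI)
    fix f assume "f \<in> L -` S \<inter> V"
    then have f: "f \<in> V" "L f \<in> S" by auto
    then obtain e where e: "e > 0" "\<And>y. dist y (L f) < e \<Longrightarrow> y \<in> S"
      using S unfolding open_dist by blast
    define C' where "C' = \<bar>C\<bar> + 1"
    have C': "C' > 0" "C \<le> C'" by (auto simp: C'_def)
    show "\<exists>r>0. \<forall>g\<in>V. N (\<lambda>x. g x - f x) < r \<longrightarrow> g \<in> L -` S \<inter> V"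
    proof (intro exI[of _ "e / C'"] conjI ballI impI)
      show "e / C' > 0" using e C' by simp
      fix g assume g: "g \<in> V" and lt: "N (\<lambda>x. g x - f x) < e / C'"
      have "L (\<lambda>x. f x + (g x - f x)) = L f + L (\<lambda>x. g x - f x)"
        using L[unfolded cont_lin_fun_def, THEN conjunct1, THEN bspec, OF f(1), THEN bspec, OF V_diff[OF g f(1)]] .
      then have "\<bar>L g - L f\<bar> = \<bar>L (\<lambda>x. g x - f x)\<bar>" by simp
      also have "\<dots> \<le> C * N (\<lambda>x. g x - f x)" by (rule C[OF V_diff[OF g f(1)]])
      also have "\<dots> \<le> C' * N (\<lambda>x. g x - f x)"
        using C' N_nonneg[OF V_diff[OF g f(1)]] by (intro mult_right_mono) auto
      also have "\<dots> < e" using lt C' by (simp add: field_simps)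
      finally show "g \<in> L -` S \<inter> V" using g e(2) by (simp add: dist_real_def)
    qed
  qed simp
  then show "L -` S \<inter> space \<mu> \<in> sets \<mu>" by (auto simp: sets_mu)
qed

lemma cont_lin_zero: "cont_lin_fun V N (\<lambda>_. 0)"
  using N_nonneg by (auto simp: cont_lin_fun_def intro!: exI[of _ 0])

lemma cont_lin_add:
  assumes L: "cont_lin_fun V N L" and L': "cont_lin_fun V N L'"
  shows "cont_lin_fun V N (\<lambda>f. L f + L' f)"
proof -
  obtain C C' where C: "\<And>f. f \<in> V \<Longrightarrow> \<bar>L f\<bar> \<le> C * N f" "\<And>f. f \<in> V \<Longrightarrow> \<bar>L' f\<bar> \<le> C' * N f"
    using L L' unfolding cont_lin_fun_def by blast
  have "\<bar>L f + L' f\<bar> \<le> (C + C') * N f" if "f \<in> V" for f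
    using C[OF that] by (simp add: distrib_right)
  then show ?thesis
    using L L' by (auto simp: cont_lin_fun_def distrib_left)
qed

lemma cont_lin_cmult:
  assumes L: "cont_lin_fun V N L"
  shows "cont_lin_fun V N (\<lambda>f. a * L f)"
proof -
  obtain C where C: "\<And>f. f \<in> V \<Longrightarrow> \<bar>L f\<bar> \<le> C * N f"
    using L unfolding cont_lin_fun_def by blast
  have "\<bar>a * L f\<bar> \<le> (\<bar>a\<bar> * C) * N f" if "f \<in> V" for f
    using mult_left_mono[OF C[OF that], of "\<bar>a\<bar>"] by (simp add: abs_mult mult.assoc)
  then show ?thesis
    using L by (auto simp: cont_lin_fun_def distrib_left)
qed

lemma cont_lin_sum: "(\<And>i. i \<in> I \<Longrightarrow> cont_lin_fun V N (L i)) \<Longrightarrow> cont_lin_fun V N (\<lambda>f. \<Sum>i\<in>I. a i * L i f)"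
proof (induction I rule: infinite_finite_induct)
  case (insert i I)
  have "cont_lin_fun V N (\<lambda>f. a i * L i f + (\<Sum>i\<in>I. a i * L i f))"
    by (rule cont_lin_add[OF cont_lin_cmult]) (use insert in auto)
  then show ?case using insert.hyps by simp
qed (simp_all add: cont_lin_zero)

text \<open>Points off \<open>D\<close> give the zero functional. Including them allows
  \<open>\<nu>\<close> to be integrated over the whole space without case distinctions.\<close>

lemma cont_lin_eval: "cont_lin_fun V N (\<lambda>f. f x)"
proof (cases "x \<in> D")
  case True
  then show ?thesis using evaluation[OF True] by (simp add: cont_lin_fun_def)
next
  case False
  then show ?thesis
    using V_off N_nonneg by (auto simp: cont_lin_fun_def intro!: exI[of _ 0])
qed

text \<open>Cauchy-Schwarz in G followed by the continuous embedding. Coefficients with respect to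
  an orthonormal system are thus measurable in \<open>f\<close> and admissible as arbitrary linear
  information.\<close>

lemma cont_lin_ip:
  assumes h: "sqint \<nu> h" "ip \<nu> h h = 1"
  shows "cont_lin_fun V N (\<lambda>f. ip \<nu> f h)"
proof -
  obtain C where C: "\<And>f. f \<in> V \<Longrightarrow> ip \<nu> f f \<le> (C * N f)\<^sup>2" using ip_nu_embedding by blast
  have "\<bar>ip \<nu> f h\<bar> \<le> \<bar>C\<bar> * N f" if f: "f \<in> V" for f
  proof -
    have "(ip \<nu> f h)\<^sup>2 \<le> (C * N f)\<^sup>2"
      using ip_sq_le[OF sqint_V[OF f] h] C[OF f] by simp
    then have "\<bar>ip \<nu> f h\<bar> \<le> \<bar>C * N f\<bar>" by (simp add: abs_le_square_iff)
    then show ?thesis using N_nonneg[OF f] by (simp add: abs_mult)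
  qed
  then show ?thesis
    using sqint_V h by (auto simp: cont_lin_fun_def ip_cmult_left intro!: ip_add_left)
qed

section \<open>Gaussian laws of functionals and optimality of linear prediction\<close>

lemma gaussian_moments:
  assumes L: "cont_lin_fun V N L"
  obtains \<sigma> where "\<sigma> \<ge> 0" "distr \<mu> borel L = (if \<sigma> = 0 then return borel 0 else density lborel (normal_density 0 \<sigma>))"
    "sqint \<mu> L" "ip \<mu> L L = \<sigma>\<^sup>2" "integrable \<mu> (\<lambda>f. (L f)^4)" "(\<integral>f. (L f)^4 \<partial>\<mu>) = 3 * \<sigma>^4"
proof -
  obtain \<sigma> where \<sigma>: "\<sigma> \<ge> 0" and d: "distr \<mu> borel L = (if \<sigma> = 0 then return borel 0 else density lborel (normal_density 0 \<sigma>))"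
    using gaussian[OF L] by blast
  have [measurable]: "L \<in> borel_measurable \<mu>" by (rule cont_lin_measurable[OF L])
  have tr: "integrable \<mu> (\<lambda>f. (L f)^k) \<longleftrightarrow> integrable (distr \<mu> borel L) (\<lambda>x. x^k)"
    "(\<integral>f. (L f)^k \<partial>\<mu>) = (\<integral>x. x^k \<partial>distr \<mu> borel L)" for k
    by (simp_all add: integrable_distr_eq integral_distr)
  have "integrable \<mu> (\<lambda>f. (L f)^2) \<and> (\<integral>f. (L f)^2 \<partial>\<mu>) = \<sigma>^2 \<and>
      integrable \<mu> (\<lambda>f. (L f)^4) \<and> (\<integral>f. (L f)^4 \<partial>\<mu>) = 3 * \<sigma>^4"
  proof (cases "\<sigma> = 0")
    case True
    have "integrable (return borel (0::real)) (\<lambda>x. x^k)" if "k > 0" for k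
      using that by (intro integrableI_bounded) (auto simp: nn_integral_return)
    then show ?thesis unfolding tr d using True by (simp add: integral_return)
  next
    case False
    then have pos: "\<sigma> > 0" using \<sigma> by simp
    have m: "has_bochner_integral lborel (\<lambda>x. normal_density 0 \<sigma> x * x^2) (\<sigma>^2)"
      using normal_moment_even[OF pos, of 0 1] by (simp add: fact_numeral)
    have "has_bochner_integral lborel (\<lambda>x. normal_density 0 \<sigma> x * x^4) (fact 4 / ((2 / \<sigma>\<^sup>2)^2 * fact 2))"
      using normal_moment_even[OF pos, of 0 2] by simp
    moreover have "fact 4 / ((2 / \<sigma>\<^sup>2)^2 * fact 2) = 3 * \<sigma>^4"
      using pos by (simp add: fact_numeral field_simps)
    ultimately have m4: "has_bochner_integral lborel (\<lambda>x. normal_density 0 \<sigma> x * x^4) (3 * \<sigma>^4)" by simp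
    show ?thesis
      unfolding tr d using False pos m m4
      by (simp add: integrable_density integral_density has_bochner_integral_iff)
  qed
  then show ?thesis using that[OF \<sigma> d] by (simp add: sqint_def ip_self)
qed

lemma sqint_cont_lin: "cont_lin_fun V N L \<Longrightarrow> sqint \<mu> L"
  by (elim gaussian_moments)

lemma distr_eqI:
  assumes "cont_lin_fun V N L" "cont_lin_fun V N L'" "ip \<mu> L L = ip \<mu> L' L'"
  shows "distr \<mu> borel L = distr \<mu> borel L'"
proof -
  obtain \<sigma> where 1: "\<sigma> \<ge> 0" "distr \<mu> borel L = (if \<sigma> = 0 then return borel 0 else density lborel (normal_density 0 \<sigma>))"
    "ip \<mu> L L = \<sigma>\<^sup>2" using gaussian_moments[OF assms(1)] by metis
  obtain \<tau> where 2: "\<tau> \<ge> 0" "distr \<mu> borel L' = (if \<tau> = 0 then return borel 0 else density lborel (normal_density 0 \<tau>))"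
    "ip \<mu> L' L' = \<tau>\<^sup>2" using gaussian_moments[OF assms(2)] by metis
  have "\<sigma> = \<tau>" using 1 2 assms(3) by simp
  then show ?thesis using 1 2 by simp
qed

lemma integral_cont_lin_eqI:
  assumes L: "cont_lin_fun V N L" and L': "cont_lin_fun V N L'" and "ip \<mu> L L = ip \<mu> L' L'"
    and [measurable]: "g \<in> borel_measurable borel"
  shows "(\<integral>f. g (L f) \<partial>\<mu>) = (\<integral>f. (g (L' f) :: real) \<partial>\<mu>)"
proof -
  have [measurable]: "L \<in> borel_measurable \<mu>" "L' \<in> borel_measurable \<mu>"
    by (intro cont_lin_measurable L L')+
  have "(\<integral>f. g (L f) \<partial>\<mu>) = (\<integral>x. g x \<partial>distr \<mu> borel L)"
    by (subst integral_distr) auto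
  also have "\<dots> = (\<integral>f. g (L' f) \<partial>\<mu>)"
    unfolding distr_eqI[OF assms(1-3)] by (subst integral_distr) auto
  finally show ?thesis .
qed

text \<open>Orthogonality gives \<open>Y + Z\<close> and \<open>Y - Z\<close> equal variances, hence
  equal laws. Both integrands are half the difference of the same function evaluated at these two
  functionals.\<close>

lemma gaussian_symmetry:
  assumes Z: "cont_lin_fun V N Z" and Y: "cont_lin_fun V N Y" and orth: "ip \<mu> Z Y = 0"
  shows "(\<integral>f. sin (Z f) * cos (Y f) \<partial>\<mu>) = 0" "(\<integral>f. sin (Z f) * sin (Y f) \<partial>\<mu>) = 0"
proof -
  have p: "cont_lin_fun V N (\<lambda>f. Y f + 1 * Z f)" "cont_lin_fun V N (\<lambda>f. Y f + (-1) * Z f)"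
    by (intro cont_lin_add cont_lin_cmult Y Z)+
  have sY: "sqint \<mu> Y" and sZ: "sqint \<mu> Z" by (intro sqint_cont_lin Y Z)+
  have mm: "ip \<mu> (\<lambda>f. Y f + a * Z f) (\<lambda>f. Y f + a * Z f) = ip \<mu> Y Y + a\<^sup>2 * ip \<mu> Z Z" for a
    unfolding ip_add_self[OF sY sqint_cmult[OF sZ]]
    by (simp only: ip_cmult_left ip_commute[of \<mu> Z "\<lambda>f. a * Z f"] orth) (simp add: power2_eq_square)
  have e: "ip \<mu> (\<lambda>f. Y f + 1 * Z f) (\<lambda>f. Y f + 1 * Z f) = ip \<mu> (\<lambda>f. Y f + (-1) * Z f) (\<lambda>f. Y f + (-1) * Z f)"
    unfolding mm by simp
  have [measurable]: "Y \<in> borel_measurable \<mu>" "Z \<in> borel_measurable \<mu>" by (intro cont_lin_measurable Y Z)+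
  have i: "integrable \<mu> (\<lambda>f. g (Y f + a * Z f))" if "g \<in> borel_measurable borel" "\<And>x. \<bar>g x\<bar> \<le> 1" for g :: "real \<Rightarrow> real" and a
    by (rule mu.integrable_bounded[of _ 1]) (use that in auto)
  have is2: "integrable \<mu> (\<lambda>f. sin (Y f + a * Z f))" and ic2: "integrable \<mu> (\<lambda>f. cos (Y f + a * Z f))" for a
    by (intro i; simp)+
  have "sin (Z f) * cos (Y f) = (sin (Y f + 1 * Z f) - sin (Y f + (-1) * Z f)) / 2" for f
    by (simp add: sin_add sin_diff)
  then have "(\<integral>f. sin (Z f) * cos (Y f) \<partial>\<mu>) = ((\<integral>f. sin (Y f + 1 * Z f) \<partial>\<mu>) - (\<integral>f. sin (Y f + (-1) * Z f) \<partial>\<mu>)) / 2"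
    by (simp only: integral_divide_zero Bochner_Integration.integral_diff[OF is2 is2])
  also have "\<dots> = 0" using integral_cont_lin_eqI[OF p e, of sin] by simp
  finally show "(\<integral>f. sin (Z f) * cos (Y f) \<partial>\<mu>) = 0" .
  have "sin (Z f) * sin (Y f) = (cos (Y f + (-1) * Z f) - cos (Y f + 1 * Z f)) / 2" for f
    by (simp add: cos_add cos_diff)
  then have "(\<integral>f. sin (Z f) * sin (Y f) \<partial>\<mu>) = ((\<integral>f. cos (Y f + (-1) * Z f) \<partial>\<mu>) - (\<integral>f. cos (Y f + 1 * Z f) \<partial>\<mu>)) / 2"
    by (simp only: integral_divide_zero Bochner_Integration.integral_diff[OF ic2 ic2])
  also have "\<dots> = 0" using integral_cont_lin_eqI[OF p e, of cos] by simp
  finally show "(\<integral>f. sin (Z f) * sin (Y f) \<partial>\<mu>) = 0" .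
qed

lemma gaussian_nonlinear_no_better:
  assumes Z: "cont_lin_fun V N Z" and Y: "\<And>i. i < n \<Longrightarrow> cont_lin_fun V N (Y i)"
    and orth: "\<And>i. i < n \<Longrightarrow> ip \<mu> Z (Y i) = 0"
    and h: "h \<in> borel_measurable (Rd n)"
  shows "(\<integral>\<^sup>+f. ennreal ((Z f)\<^sup>2) \<partial>\<mu>) \<le> (\<integral>\<^sup>+f. ennreal ((Z f + h (\<lambda>i\<in>{..<n}. Y i f))\<^sup>2) \<partial>\<mu>)"
proof (rule mu.nonlinear_no_better)
  fix s and t :: "nat \<Rightarrow> real"
  have *: "cont_lin_fun V N (\<lambda>f. s * Z f)" "cont_lin_fun V N (\<lambda>f. \<Sum>i<n. t i * Y i f)"
    by (auto intro!: cont_lin_sum cont_lin_cmult Y Z)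
  have "ip \<mu> (\<lambda>f. \<Sum>i<n. t i * Y i f) Z = (\<Sum>i<n. t i * ip \<mu> (Y i) Z)"
    by (rule ip_sum_left) (auto intro!: sqint_cont_lin Y Z)
  also have "\<dots> = 0" using orth by (simp add: ip_commute[of \<mu> _ Z])
  finally have "ip \<mu> (\<lambda>f. s * Z f) (\<lambda>f. \<Sum>i<n. t i * Y i f) = 0"
    by (simp add: ip_cmult_left ip_commute[of \<mu> Z])
  then show "(\<integral>f. sin (s * Z f) * cos (\<Sum>i<n. t i * Y i f) \<partial>\<mu>) = 0"
    "(\<integral>f. sin (s * Z f) * sin (\<Sum>i<n. t i * Y i f) \<partial>\<mu>) = 0"
    by (intro gaussian_symmetry *; simp)+
next
  have "sets (Rd n) = sets (Pi\<^sub>M {..<n} (\<lambda>_. borel))" unfolding Rd_def by (intro sets_PiM_cong) auto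
  then show "h \<in> borel_measurable (Pi\<^sub>M {..<n} (\<lambda>_. borel))" using h by (simp cong: measurable_cong_sets)
qed (use Z Y in \<open>auto intro: sqint_cont_lin cont_lin_measurable\<close>)

section \<open>Joint measurability of point evaluation\<close>

lemma dense_sequence:
  "\<exists>s. (\<forall>i. s i \<in> V) \<and> (\<forall>f\<in>V. \<forall>e>0. \<exists>i::nat. N (\<lambda>x. f x - s i x) < e)"
proof -
  obtain S where S: "S \<subseteq> V" "countable S" "\<And>f e. f \<in> V \<Longrightarrow> e > 0 \<Longrightarrow> \<exists>g\<in>S. N (\<lambda>x. f x - g x) < e"
    using separable by blast
  have ne: "S \<noteq> {}" using S(3)[OF V_zero, of 1] by auto
  show ?thesis
  proof (intro exI[of _ "from_nat_into S"] conjI allI ballI impI)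
    show "from_nat_into S i \<in> V" for i using S(1) from_nat_into[OF ne] by auto
    show "\<exists>i. N (\<lambda>x. f x - from_nat_into S i x) < e" if f: "f \<in> V" and e: "e > 0" for f e
    proof -
      obtain g where "g \<in> S" "N (\<lambda>x. f x - g x) < e" using S(3)[OF f e] by blast
      then show ?thesis using S(2) by (intro exI[of _ "to_nat_on S g"]) simp
    qed
  qed
qed

text \<open>Replace \<open>f\<close> by the first member of a dense sequence within distance
  \<open>1 / (k + 1)\<close>. The index is measurable in \<open>f\<close> with countably many
  values, so each approximation is jointly measurable; continuity of evaluations gives convergence
  at every point.\<close>

lemma evaluation_jointly_measurable:
  "(\<lambda>(f, x). f x) \<in> borel_measurable (\<mu> \<Otimes>\<^sub>M \<nu>)"
proof -
  obtain s where sd: "\<forall>i. s i \<in> V" "\<forall>f\<in>V. \<forall>e>0. \<exists>i::nat. N (\<lambda>x. f x - s i x) < e"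
    using dense_sequence by (elim exE conjE)
  then have s: "\<And>i. s i \<in> V" and dense: "\<And>f e. f \<in> V \<Longrightarrow> e > 0 \<Longrightarrow> \<exists>i. N (\<lambda>x. f x - s i x) < e"
    by simp_all
  define idx where "idx k f = (LEAST i. N (\<lambda>x. f x - s i x) < 1 / real (Suc k))" for k f
  have op: "{f \<in> V. N (\<lambda>x. f x - s i x) < r} \<in> sets \<mu>" for i r
  proof -
    have "norm_open V N {f \<in> V. N (\<lambda>x. f x - s i x) < r}"
      unfolding norm_open_def
    proof (intro conjI ballI)
      fix f assume "f \<in> {f \<in> V. N (\<lambda>x. f x - s i x) < r}"
      then have f: "f \<in> V" "N (\<lambda>x. f x - s i x) < r" by auto
      show "\<exists>r'>0. \<forall>g\<in>V. N (\<lambda>x. g x - f x) < r' \<longrightarrow> g \<in> {f \<in> V. N (\<lambda>x. f x - s i x) < r}"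
      proof (intro exI[of _ "r - N (\<lambda>x. f x - s i x)"] conjI ballI impI)
        fix g assume g: "g \<in> V" "N (\<lambda>x. g x - f x) < r - N (\<lambda>x. f x - s i x)"
        have "N (\<lambda>x. (g x - f x) + (f x - s i x)) \<le> N (\<lambda>x. g x - f x) + N (\<lambda>x. f x - s i x)"
          by (intro N_triangle V_diff g f s)
        then show "g \<in> {f \<in> V. N (\<lambda>x. f x - s i x) < r}" using g by simp
      qed (use f in simp)
    qed auto
    then show ?thesis by (auto simp: sets_mu)
  qed
  have idx_m: "idx k \<in> measurable \<mu> (count_space UNIV)" for k
    unfolding idx_def[abs_def]
  proof (rule measurable_Least)
    fix i
    have "Measurable.pred \<mu> (\<lambda>f. N (\<lambda>x. f x - s i x) < 1 / real (Suc k))"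
      unfolding pred_def using op[of i "1 / real (Suc k)"] by simp
    then show "(\<lambda>f. N (\<lambda>x. f x - s i x) < 1 / real (Suc k)) \<in> measurable \<mu> (count_space UNIV)" .
  qed
  have approx_m: "(\<lambda>fx. s (idx k (fst fx)) (snd fx)) \<in> borel_measurable (\<mu> \<Otimes>\<^sub>M \<nu>)" for k
  proof (rule measurable_compose_countable[where f="\<lambda>i fx. s i (snd fx)"])
    show "(\<lambda>fx. s i (snd fx)) \<in> borel_measurable (\<mu> \<Otimes>\<^sub>M \<nu>)" for i
      using V_measurable[OF s[of i]] by (intro measurable_compose[OF measurable_snd]) (simp cong: measurable_cong_sets)
    show "(\<lambda>fx. idx k (fst fx)) \<in> measurable (\<mu> \<Otimes>\<^sub>M \<nu>) (count_space UNIV)"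
      by (rule measurable_compose[OF measurable_fst idx_m])
  qed
  have lim: "(\<lambda>k. s (idx k f) x) \<longlonglongrightarrow> f x" if f: "f \<in> V" for f x
  proof (cases "x \<in> D")
    case True
    obtain C where C: "\<forall>f\<in>V. \<bar>f x\<bar> \<le> C * N f" using evaluation[OF True] by blast
    have le: "\<bar>f x - s (idx k f) x\<bar> \<le> \<bar>C\<bar> * (1 / real (Suc k))" for k
    proof -
      have "N (\<lambda>x. f x - s (idx k f) x) < 1 / real (Suc k)"
        unfolding idx_def by (rule LeastI_ex) (rule dense[OF f], simp)
      moreover have "\<bar>f x - s (idx k f) x\<bar> \<le> C * N (\<lambda>x. f x - s (idx k f) x)"
        by (rule bspec[OF C V_diff[OF f s]])
      moreover have "\<dots> \<le> \<bar>C\<bar> * N (\<lambda>x. f x - s (idx k f) x)"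
        by (intro mult_right_mono N_nonneg V_diff f s) simp
      moreover have "\<bar>C\<bar> * N (\<lambda>x. f x - s (idx k f) x) \<le> \<bar>C\<bar> * (1 / real (Suc k))"
        using calculation(1) by (intro mult_left_mono) auto
      ultimately show ?thesis by linarith
    qed
    have "(\<lambda>k. \<bar>C\<bar> * (1 / real (Suc k))) \<longlonglongrightarrow> \<bar>C\<bar> * 0"
      by (intro tendsto_mult_left LIMSEQ_Suc[OF lim_const_over_n])
    then have "(\<lambda>k. \<bar>C\<bar> * (1 / real (Suc k))) \<longlonglongrightarrow> 0" by simp
    then have "(\<lambda>k. f x - s (idx k f) x) \<longlonglongrightarrow> 0"
      by (rule Lim_null_comparison[rotated]) (use le in \<open>auto intro!: always_eventually\<close>)
    then have "(\<lambda>k. f x - (f x - s (idx k f) x)) \<longlonglongrightarrow> f x - 0" by (intro tendsto_diff tendsto_const)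
    then show ?thesis by simp
  next
    case False
    then show ?thesis using V_off[OF f False] V_off[OF s False] by simp
  qed
  have "(\<lambda>fx. fst fx (snd fx)) \<in> borel_measurable (\<mu> \<Otimes>\<^sub>M \<nu>)"
    by (rule borel_measurable_LIMSEQ_real[where u="\<lambda>k fx. s (idx k (fst fx)) (snd fx)", OF _ approx_m])
      (auto simp: space_pair_measure lim)
  then show ?thesis by (simp add: case_prod_beta')
qed

lemma evaluation_measurable [measurable]:
  assumes [measurable]: "F \<in> measurable M \<mu>" "X \<in> measurable M \<nu>"
  shows "(\<lambda>w. F w (X w)) \<in> borel_measurable M"
  using measurable_compose[OF measurable_Pair[OF assms] evaluation_jointly_measurable] by simp

section \<open>Finiteness of the second moment\<close>

text \<open>Uses \<open>y - y\<^sup>2 / (6 \<sigma>\<^sup>2) \<le> min y (3 \<sigma>\<^sup>2 / 2)\<close> for \<open>y = (L f)\<^sup>2\<close> and the fourth moment \<open>3 \<sigma>\<^sup>4\<close>.\<close>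

lemma truncated_second_moment:
  assumes L: "cont_lin_fun V N L"
  shows "ip \<mu> L L / 2 \<le> (\<integral>f. min ((L f)\<^sup>2) (3 / 2 * ip \<mu> L L) \<partial>\<mu>)"
proof -
  obtain \<sigma> where s: "sqint \<mu> L" "ip \<mu> L L = \<sigma>\<^sup>2" "integrable \<mu> (\<lambda>f. (L f)^4)" "(\<integral>f. (L f)^4 \<partial>\<mu>) = 3 * \<sigma>^4"
    using gaussian_moments[OF L] by metis
  have [measurable]: "L \<in> borel_measurable \<mu>" by (rule cont_lin_measurable[OF L])
  show ?thesis
  proof (cases "\<sigma> = 0")
    case True
    then show ?thesis using s by simp
  next
    case False
    \<comment> \<open>With this coefficient the fourth moment costs
      \<open>3 * \<sigma>^4 / (6 * \<sigma>^2)\<close>, exactly half the variance. The parabola has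
      its maximum at \<open>y = 3 * \<sigma>^2\<close> with value \<open>3 / 2 * \<sigma>^2\<close>,
      which fixes the truncation level.\<close>
    let ?a = "1 / (6 * \<sigma>\<^sup>2)"
    have i: "integrable \<mu> (\<lambda>f. (L f)\<^sup>2)" by (rule sqint_integrable[OF s(1)])
    have im: "integrable \<mu> (\<lambda>f. min ((L f)\<^sup>2) (3 / 2 * \<sigma>\<^sup>2))"
      by (rule Bochner_Integration.integrable_bound[OF i]) (auto simp: min_def)
    have "ip \<mu> L L / 2 = (\<integral>f. (L f)\<^sup>2 - ?a * (L f)^4 \<partial>\<mu>)"
    proof -
      have "(\<integral>f. (L f)\<^sup>2 - ?a * (L f)^4 \<partial>\<mu>) = \<sigma>\<^sup>2 - ?a * (3 * \<sigma>^4)"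
        using i s by (subst Bochner_Integration.integral_diff) (auto simp: ip_self)
      also have "\<dots> = \<sigma>\<^sup>2 / 2" using False by (simp add: field_simps power4_eq_xxxx power2_eq_square)
      finally show ?thesis using s by simp
    qed
    also have "\<dots> \<le> (\<integral>f. min ((L f)\<^sup>2) (3 / 2 * \<sigma>\<^sup>2) \<partial>\<mu>)"
    proof (rule integral_mono[OF _ im])
      show "integrable \<mu> (\<lambda>f. (L f)\<^sup>2 - ?a * (L f)^4)" using i s(3) by simp
      fix f
      define y where "y = (L f)\<^sup>2"
      have y4: "(L f)^4 = y\<^sup>2" by (simp add: y_def)
      have "0 \<le> ?a * (y - 3 * \<sigma>\<^sup>2)\<^sup>2" by simp
      also have "\<dots> = ?a * y\<^sup>2 - y + 3 / 2 * \<sigma>\<^sup>2"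
        using False by (simp add: field_simps power2_eq_square)
      finally have "y - ?a * y\<^sup>2 \<le> 3 / 2 * \<sigma>\<^sup>2" by simp
      then show "(L f)\<^sup>2 - ?a * (L f)^4 \<le> min ((L f)\<^sup>2) (3 / 2 * \<sigma>\<^sup>2)"
        unfolding y4 y_def[symmetric] by simp
    qed
    finally show ?thesis using s by simp
  qed
qed

text \<open>The diagonal of the covariance kernel. Its integral over \<open>\<nu>\<close> is the
  mean squared norm in G, the trace of the covariance operator.\<close>

abbreviation K :: "point \<Rightarrow> real" where
  "K x \<equiv> ip \<mu> (\<lambda>f. f x) (\<lambda>f. f x)"

lemma nn_K: "(\<integral>\<^sup>+f. ennreal ((f x)\<^sup>2) \<partial>\<mu>) = ennreal (K x)"
  by (rule nn_sqint[OF sqint_cont_lin[OF cont_lin_eval]])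

lemma K_measurable [measurable]: "K \<in> borel_measurable \<nu>"
  unfolding ip_def
  by (rule mu.borel_measurable_lebesgue_integral) (simp add: case_prod_beta', measurable)

text \<open>
  A special case of Fernique's theorem: \<open>\<parallel>f\<parallel>\<^sup>2\<close> is finite everywhere, so it is at most some \<open>j\<close> outside an
  event of probability 1/6, whereas by the truncated moments it is of the order of its mean with probability
  bounded away from 0.
\<close>

lemma finite_trace: "(\<integral>\<^sup>+x. ennreal (K x) \<partial>\<nu>) < \<infinity>"
proof -
  have K0: "0 \<le> K x" for x by (rule ip_self_nonneg)
  define A where "A j = {f \<in> V. real j < ip \<nu> f f}" for j :: nat
  have ipm: "(\<lambda>f. ip \<nu> f f) \<in> borel_measurable \<mu>"
    unfolding ip_def by (rule nu.borel_measurable_lebesgue_integral) (simp add: case_prod_beta', measurable)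
  have A[measurable]: "A j \<in> sets \<mu>" for j
  proof -
    have "{f \<in> space \<mu>. real j < ip \<nu> f f} \<in> sets \<mu>" using ipm by measurable
    then show ?thesis by (simp add: A_def)
  qed
  have "(\<lambda>j. measure \<mu> (A j)) \<longlonglongrightarrow> measure \<mu> (\<Inter>j. A j)"
  proof (rule mu.finite_Lim_measure_decseq)
    show "range A \<subseteq> sets \<mu>" using A by blast
  qed (auto simp: A_def decseq_def)
  moreover have "(\<Inter>j. A j) = {}"
  proof -
    have False if "\<forall>j. real j < ip \<nu> f f" for f
      using reals_Archimedean2[of "ip \<nu> f f"] that by (meson less_asym)
    then show ?thesis by (auto simp: A_def)
  qed
  ultimately have "(\<lambda>j. measure \<mu> (A j)) \<longlonglongrightarrow> 0" by simp
  then have "eventually (\<lambda>j. measure \<mu> (A j) < 1 / 6) sequentially"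
    by (rule order_tendstoD) simp
  then obtain j where j: "measure \<mu> (A j) < 1 / 6" by (auto simp: eventually_sequentially)
  have bound: "(\<integral>\<^sup>+x. ennreal (K x) * indicator {x. K x \<le> real k} x \<partial>\<nu>) \<le> ennreal (4 * real j)" for k :: nat
  proof -
    let ?I = "\<lambda>x. indicator {x. K x \<le> real k} x :: ennreal"
    have [measurable]: "Measurable.pred \<nu> (\<lambda>x. K x \<le> real k)" by measurable
    have Im[measurable]: "?I \<in> borel_measurable \<nu>"
      by (rule borel_measurable_indicator') measurable
    \<comment> \<open>Restricting to \<open>K x \<le> real k\<close> makes \<open>T\<close> finite,
      so that a multiple of \<open>T\<close> can later be moved from one side to the other.\<close>
    define T where "T = (\<integral>\<^sup>+x. ennreal (K x) * ?I x \<partial>\<nu>)"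
    have "T \<le> (\<integral>\<^sup>+x. ennreal (real k) \<partial>\<nu>)"
      unfolding T_def by (intro nn_integral_mono) (auto simp: indicator_def ennreal_leI)
    then have "T < \<infinity>" by (simp add: le_less_trans)
    then obtain t where t: "t \<ge> 0" "T = ennreal t" by (cases T) auto
    define H where "H f x = ennreal (min ((f x)\<^sup>2) (3 / 2 * K x)) * ?I x" for f :: fn and x
    have Hm[measurable]: "case_prod H \<in> borel_measurable (\<mu> \<Otimes>\<^sub>M \<nu>)"
      unfolding H_def case_prod_beta' by measurable
    have "ennreal (1 / 2) * T \<le> (\<integral>\<^sup>+x. (\<integral>\<^sup>+f. H f x \<partial>\<mu>) \<partial>\<nu>)"
      unfolding T_def
    proof (subst nn_integral_cmult[symmetric], measurable, intro nn_integral_mono)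
      fix x assume x: "x \<in> space \<nu>"
      have sq: "sqint \<mu> (\<lambda>f. f x)" by (rule sqint_cont_lin[OF cont_lin_eval])
      have [measurable]: "(\<lambda>f. f x) \<in> borel_measurable \<mu>" using sq by (rule sqint_measurable)
      have "integrable \<mu> (\<lambda>f. min ((f x)\<^sup>2) (3 / 2 * K x))"
        by (rule Bochner_Integration.integrable_bound[OF sqint_integrable[OF sq]]) (auto simp: min_def K0)
      then have "(\<integral>\<^sup>+f. ennreal (min ((f x)\<^sup>2) (3 / 2 * K x)) \<partial>\<mu>) = ennreal (\<integral>f. min ((f x)\<^sup>2) (3 / 2 * K x) \<partial>\<mu>)"
        by (rule nn_integral_eq_integral) (simp add: K0)
      moreover have "ennreal (1 / 2) * ennreal (K x) = ennreal (K x / 2)"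
        by (subst ennreal_mult[symmetric]) (auto simp: K0)
      ultimately have "ennreal (1 / 2) * ennreal (K x) \<le> (\<integral>\<^sup>+f. ennreal (min ((f x)\<^sup>2) (3 / 2 * K x)) \<partial>\<mu>)"
        using truncated_second_moment[OF cont_lin_eval[of x]] by (simp add: ennreal_leI)
      then show "ennreal (1 / 2) * (ennreal (K x) * ?I x) \<le> (\<integral>\<^sup>+f. H f x \<partial>\<mu>)"
        unfolding H_def by (simp add: nn_integral_multc mult.assoc[symmetric] mult_right_mono)
    qed
    also have "\<dots> = (\<integral>\<^sup>+f. (\<integral>\<^sup>+x. H f x \<partial>\<nu>) \<partial>\<mu>)"
      by (rule mu_nu.Fubini') simp
    \<comment> \<open>Outside \<open>A j\<close> the squared norm of \<open>f\<close> is at most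
      \<open>j\<close>; on \<open>A j\<close> the truncation bounds the inner integral by
      \<open>3 / 2 * T\<close>.\<close>
    also have "\<dots> \<le> (\<integral>\<^sup>+f. ennreal (real j) + ennreal (3 / 2) * T * indicator (A j) f \<partial>\<mu>)"
    proof (rule nn_integral_mono)
      fix f assume "f \<in> space \<mu>"
      then have f: "f \<in> V" by simp
      have "(\<integral>\<^sup>+x. H f x \<partial>\<nu>) \<le> (\<integral>\<^sup>+x. ennreal ((f x)\<^sup>2) \<partial>\<nu>)"
        unfolding H_def by (intro nn_integral_mono) (auto simp: indicator_def ennreal_leI)
      then have 1: "(\<integral>\<^sup>+x. H f x \<partial>\<nu>) \<le> ennreal (ip \<nu> f f)"
        by (simp add: nn_sqint sqint_V f)
      have "(\<integral>\<^sup>+x. H f x \<partial>\<nu>) \<le> (\<integral>\<^sup>+x. ennreal (3 / 2) * (ennreal (K x) * ?I x) \<partial>\<nu>)"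
        unfolding H_def
        by (intro nn_integral_mono) (auto simp: indicator_def K0 ennreal_mult[symmetric] intro!: ennreal_leI)
      then have 2: "(\<integral>\<^sup>+x. H f x \<partial>\<nu>) \<le> ennreal (3 / 2) * T"
        unfolding T_def by (subst (asm) nn_integral_cmult) auto
      show "(\<integral>\<^sup>+x. H f x \<partial>\<nu>) \<le> ennreal (real j) + ennreal (3 / 2) * T * indicator (A j) f"
      proof (cases "f \<in> A j")
        case True
        then show ?thesis using 2 by (simp add: add_increasing)
      next
        case False
        then have "ip \<nu> f f \<le> real j" using f by (simp add: A_def)
        then show ?thesis using 1 False by (simp add: order_trans[OF _ ennreal_leI])
      qed
    qed
    also have "\<dots> = ennreal (real j) + ennreal (3 / 2) * T * ennreal (measure \<mu> (A j))"
      by (subst nn_integral_add) (auto simp: nn_integral_cmult_indicator mu.emeasure_eq_measure mu.prob_space[simplified])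
    also have "\<dots> = ennreal (real j + 3 / 2 * t * measure \<mu> (A j))"
      using t by (simp add: ennreal_mult[symmetric] ennreal_plus[symmetric] del: ennreal_plus)
    finally have "ennreal (1 / 2) * T \<le> ennreal (real j + 3 / 2 * t * measure \<mu> (A j))" .
    moreover have "ennreal (1 / 2) * T = ennreal (1 / 2 * t)"
      unfolding t(2) using t(1) by (subst ennreal_mult[symmetric]) auto
    ultimately have "ennreal (1 / 2 * t) \<le> ennreal (real j + 3 / 2 * t * measure \<mu> (A j))"
      by (simp only:)
    then have "1 / 2 * t \<le> real j + 3 / 2 * t * measure \<mu> (A j)"
      using t by (subst (asm) ennreal_le_iff) auto
    \<comment> \<open>Here 1/6 pays off: \<open>3 / 2 * (1 / 6) = 1 / 4\<close> leaves
      \<open>t / 2 \<le> j + t / 4\<close>, a bound that does not depend on the cutoff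
      \<open>k\<close>.\<close>
    moreover have "3 / 2 * t * measure \<mu> (A j) \<le> 3 / 2 * t * (1 / 6)"
      using t j by (intro mult_left_mono) auto
    ultimately have "t \<le> 4 * real j" by simp
    then show ?thesis using t unfolding T_def by (simp add: ennreal_leI)
  qed
  have "(\<integral>\<^sup>+x. ennreal (K x) \<partial>\<nu>) = (\<integral>\<^sup>+x. (SUP k::nat. ennreal (K x) * indicator {x. K x \<le> real k} x) \<partial>\<nu>)"
  proof (intro nn_integral_cong antisym SUP_least)
    fix x
    obtain k :: nat where "K x \<le> real k" using real_arch_simple by blast
    then show "ennreal (K x) \<le> (SUP k::nat. ennreal (K x) * indicator {x. K x \<le> real k} x)"
      by (intro SUP_upper2[of k]) auto
  qed (auto simp: indicator_def)
  also have "\<dots> = (SUP k::nat. (\<integral>\<^sup>+x. ennreal (K x) * indicator {x. K x \<le> real k} x \<partial>\<nu>))"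
  proof (rule nn_integral_monotone_convergence_SUP)
    show "incseq (\<lambda>k::nat. \<lambda>x. ennreal (K x) * indicator {x. K x \<le> real k} x)"
      by (auto simp: incseq_def le_fun_def indicator_def)
    show "(\<lambda>x. ennreal (K x) * indicator {x. K x \<le> real k} x) \<in> borel_measurable \<nu>" for k :: nat
      by (intro borel_measurable_times_ennreal borel_measurable_indicator') measurable
  qed
  also have "\<dots> \<le> ennreal (4 * real j)" by (intro SUP_least bound)
  finally show ?thesis by (simp add: le_less_trans)
qed

section \<open>Standard versus arbitrary linear information\<close>

definition resid :: "nat \<Rightarrow> (nat \<Rightarrow> point \<Rightarrow> real) \<Rightarrow> fn \<Rightarrow> fn" where
  "resid m b f = (\<lambda>x. f x - proj \<nu> m b f x)"

definition rerr :: "nat \<Rightarrow> (nat \<Rightarrow> point \<Rightarrow> real) \<Rightarrow> fn \<Rightarrow> real" where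
  "rerr m b f = ip \<nu> (resid m b f) (resid m b f)"

lemma rerr_nonneg: "0 \<le> rerr m b f"
  unfolding rerr_def by (rule ip_self_nonneg)

lemma sqint_resid_V: "orthonormal \<nu> m b \<Longrightarrow> f \<in> V \<Longrightarrow> sqint \<nu> (resid m b f)"
  unfolding resid_def by (intro sqint_resid sqint_V)

lemma rerr_le: "orthonormal \<nu> m b \<Longrightarrow> f \<in> V \<Longrightarrow> rerr m b f \<le> ip \<nu> f f"
  unfolding rerr_def resid_def using resid_le[of \<nu> m b f "\<lambda>_. 0" "\<lambda>_. 0"] by (simp add: sqint_V sqint_zero)

lemma cont_lin_ip_orthonormal: "orthonormal \<nu> m b \<Longrightarrow> j < m \<Longrightarrow> cont_lin_fun V N (\<lambda>f. ip \<nu> f (b j))"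
  by (rule cont_lin_ip) (auto simp: orthonormal_def)

lemma resid_measurable:
  assumes b: "orthonormal \<nu> m b" and [measurable]: "F \<in> measurable M \<mu>" "X \<in> measurable M \<nu>"
  shows "(\<lambda>w. resid m b (F w) (X w)) \<in> borel_measurable M"
  unfolding resid_def proj_def
proof (intro borel_measurable_diff borel_measurable_sum borel_measurable_times)
  fix j assume "j \<in> {..<m}"
  then have j: "j < m" by simp
  show "(\<lambda>w. ip \<nu> (F w) (b j)) \<in> borel_measurable M"
    by (rule measurable_compose[OF assms(2) cont_lin_measurable[OF cont_lin_ip_orthonormal[OF b j]]])
  show "(\<lambda>w. b j (X w)) \<in> borel_measurable M"
    by (rule measurable_compose[OF assms(3) sqint_measurable[OF sqint_orthonormal[OF b j]]])
qed measurable

lemma rerr_measurable: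
  assumes b: "orthonormal \<nu> m b"
  shows "rerr m b \<in> borel_measurable \<mu>"
  unfolding rerr_def[abs_def] ip_def
  by (rule nu.borel_measurable_lebesgue_integral)
    (simp add: case_prod_beta', intro borel_measurable_times resid_measurable[OF b] measurable_fst measurable_snd)

lemma nn_second_moment: "(\<integral>\<^sup>+f. ennreal (ip \<nu> f f) \<partial>\<mu>) < \<infinity>"
proof -
  have "(\<integral>\<^sup>+f. ennreal (ip \<nu> f f) \<partial>\<mu>) = (\<integral>\<^sup>+f. (\<integral>\<^sup>+x. ennreal ((f x)\<^sup>2) \<partial>\<nu>) \<partial>\<mu>)"
    by (intro nn_integral_cong) (simp add: nn_sqint sqint_V)
  also have "\<dots> = (\<integral>\<^sup>+x. (\<integral>\<^sup>+f. ennreal ((f x)\<^sup>2) \<partial>\<mu>) \<partial>\<nu>)"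
    by (rule mu_nu.Fubini'[symmetric]) (simp add: case_prod_beta', measurable)
  also have "\<dots> < \<infinity>" using finite_trace by (simp add: nn_K)
  finally show ?thesis .
qed

lemma nn_rerr_finite:
  assumes b: "orthonormal \<nu> m b"
  shows "(\<integral>\<^sup>+f. ennreal (rerr m b f) \<partial>\<mu>) < \<infinity>"
proof -
  have "(\<integral>\<^sup>+f. ennreal (rerr m b f) \<partial>\<mu>) \<le> (\<integral>\<^sup>+f. ennreal (ip \<nu> f f) \<partial>\<mu>)"
    by (intro nn_integral_mono ennreal_leI rerr_le[OF b]) simp
  then show ?thesis using nn_second_moment by (rule le_less_trans)
qed

lemma info_measurable:
  assumes "\<And>i. i < n \<Longrightarrow> cont_lin_fun V N (Ls i)"
  shows "(\<lambda>f. restrict (\<lambda>i. Ls i f) {..<n}) \<in> measurable \<mu> (Rd n)"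
  unfolding Rd_def using cont_lin_measurable[OF assms]
  by (intro measurable_restrict) (auto simp: measurable_lborel1)

text \<open>Gram-Schmidt is applied twice: over \<open>\<mu>\<close>, to replace the information by
  uncorrelated functionals \<open>B\<close> of unit variance, and over \<open>\<nu>\<close>, to
  obtain an orthonormal basis of the space in which the best linear predictor takes its values. That
  the basis vanishes off \<open>D\<close> is recorded for the placement of the nodes.\<close>

lemma algorithm_lower_bound:
  assumes Ls: "\<And>i. i < n \<Longrightarrow> cont_lin_fun V N (Ls i)"
    and \<phi>: "(\<lambda>(y, x). \<phi> y x) \<in> borel_measurable (Rd n \<Otimes>\<^sub>M Rd d)"
  shows "\<exists>m b. m \<le> n \<and> orthonormal \<nu> m b \<and> (\<forall>j<m. \<forall>x. x \<notin> D \<longrightarrow> b j x = 0) \<and>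
    (\<integral>\<^sup>+f. ennreal (rerr m b f) \<partial>\<mu>) \<le> err_sq d D \<rho> \<mu> n Ls \<phi>"
proof -
  have sLs: "sqint \<mu> (Ls i)" if "i < n" for i by (rule sqint_cont_lin[OF Ls[OF that]])
  have "\<exists>m b A. m \<le> n \<and> orthonormal \<mu> m b \<and> (\<forall>j<m. b j = (\<lambda>x. \<Sum>i<n. A j i * Ls i x)) \<and>
      (\<forall>i<n. AE x in \<mu>. Ls i x = proj \<mu> m b (Ls i) x)"
    by (rule gram_schmidt) (rule sLs)
  then obtain k B A where k: "k \<le> n" and B: "orthonormal \<mu> k B"
    and "\<forall>j<k. B j = (\<lambda>f. \<Sum>i<n. A j i * Ls i f)" "\<forall>i<n. AE f in \<mu>. Ls i f = proj \<mu> k B (Ls i) f"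
    by (elim exE conjE)
  then have B_eq: "\<And>j. j < k \<Longrightarrow> B j = (\<lambda>f. \<Sum>i<n. A j i * Ls i f)"
    and L_ae: "\<And>i. i < n \<Longrightarrow> AE f in \<mu>. Ls i f = proj \<mu> k B (Ls i) f" by simp_all
  have cB: "cont_lin_fun V N (B j)" if "j < k" for j
    unfolding B_eq[OF that] by (intro cont_lin_sum Ls) simp
  have sB: "sqint \<mu> (B j)" "ip \<mu> (B j) (B j) = 1" if "j < k" for j
    using B that by (auto simp: orthonormal_def)
  have [measurable]: "B j \<in> borel_measurable \<mu>" if "j < k" for j by (rule cont_lin_measurable[OF cB[OF that]])
  have sev: "sqint \<mu> (\<lambda>f. f x)" for x by (rule sqint_cont_lin[OF cont_lin_eval])
  \<comment> \<open>The covariance of \<open>f x\<close> with \<open>B j f\<close>, which is the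
    coefficient of \<open>B j\<close> in the best linear prediction of \<open>f x\<close>. Its
    square is at most \<open>K x\<close>, so finiteness of the trace yields square
    integrability.\<close>
  define g where "g j x = ip \<mu> (\<lambda>f. f x) (B j)" for j x
  have g_m: "g j \<in> borel_measurable \<nu>" if "j < k" for j
    unfolding g_def ip_def
  proof (rule mu.borel_measurable_lebesgue_integral)
    have [measurable]: "B j \<in> borel_measurable \<mu>" using that by measurable
    show "(\<lambda>(x, f). f x * B j f) \<in> borel_measurable (\<nu> \<Otimes>\<^sub>M \<mu>)"
      unfolding case_prod_beta' by measurable
  qed
  have g_sq: "sqint \<nu> (g j)" if j: "j < k" for j
  proof (rule sqintI[OF g_m[OF j]])
    have "(\<integral>\<^sup>+x. ennreal ((g j x)\<^sup>2) \<partial>\<nu>) \<le> (\<integral>\<^sup>+x. ennreal (K x) \<partial>\<nu>)"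
      unfolding g_def by (intro nn_integral_mono ennreal_leI ip_sq_le sev sB j)
    then show "(\<integral>\<^sup>+x. ennreal ((g j x)\<^sup>2) \<partial>\<nu>) < \<infinity>" using finite_trace by (rule le_less_trans)
  qed
  have g_off: "g j x = 0" if "x \<notin> D" for j x
  proof -
    have "ip \<mu> (\<lambda>f. f x) (B j) = (\<integral>f. 0 \<partial>\<mu>)"
      unfolding ip_def using V_off that by (intro Bochner_Integration.integral_cong refl) auto
    then show ?thesis by (simp add: g_def)
  qed
  define Z where "Z x f = f x - (\<Sum>j<k. g j x * B j f)" for x f
  have Z_resid: "Z x = (\<lambda>f. f x - proj \<mu> k B (\<lambda>f. f x) f)" for x
    by (simp add: Z_def proj_def g_def fun_eq_iff)
  have cZ: "cont_lin_fun V N (Z x)" for x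
  proof -
    have "cont_lin_fun V N (\<lambda>f. f x + (-1) * (\<Sum>j<k. g j x * B j f))"
      by (intro cont_lin_add cont_lin_cmult cont_lin_eval cont_lin_sum cB) simp
    then show ?thesis by (simp add: Z_def[abs_def])
  qed
  have ZL: "ip \<mu> (Z x) (Ls i) = 0" if i: "i < n" for x i
  proof -
    have sZ: "sqint \<mu> (Z x)" by (rule sqint_cont_lin[OF cZ])
    have ZB: "ip \<mu> (Z x) (B j) = 0" if "j < k" for j
      unfolding Z_resid by (rule ip_resid[OF B sev that])
    have "ip \<mu> (Ls i) (Z x) = ip \<mu> (proj \<mu> k B (Ls i)) (Z x)"
      by (intro ip_cong_AE L_ae i sLs sqint_proj[OF B] sZ)
    also have "\<dots> = 0"
      unfolding proj_def[abs_def]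
      by (subst ip_sum_left) (auto simp: sB sZ ZB ip_commute[of \<mu> _ "Z x"])
    finally show ?thesis by (simp add: ip_commute)
  qed
  have Lm: "(\<lambda>f. restrict (\<lambda>i. Ls i f) {..<n}) \<in> measurable \<mu> (Rd n)" by (rule info_measurable[OF Ls])
  have \<phi>': "(\<lambda>yx. \<phi> (fst yx) (snd yx)) \<in> borel_measurable (Rd n \<Otimes>\<^sub>M Rd d)"
    using \<phi> by (simp add: case_prod_beta')
  have \<phi>m: "(\<lambda>w. \<phi> (Y w) (X w)) \<in> borel_measurable M"
    if "Y \<in> measurable M (Rd n)" "X \<in> measurable M (Rd d)" for Y X and M :: "'c measure"
    using measurable_compose[OF measurable_Pair[OF that] \<phi>'] by simp
  let ?L = "\<lambda>f. restrict (\<lambda>i. Ls i f) {..<n}"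
  have pw: "(\<integral>\<^sup>+f. ennreal ((Z x f)\<^sup>2) \<partial>\<mu>) \<le> (\<integral>\<^sup>+f. ennreal ((f x - \<phi> (?L f) x)\<^sup>2) \<partial>\<mu>)"
    if x: "x \<in> space \<nu>" for x
  proof -
    \<comment> \<open>The linear prediction minus the output of the given algorithm. It is a
      function of the information \<open>y\<close> alone, because \<open>A\<close> expresses each
      \<open>B j\<close> exactly through the \<open>Ls i\<close>.\<close>
    define h where "h y = (\<Sum>j<k. g j x * (\<Sum>i<n. A j i * y i)) - \<phi> y x" for y
    have "(\<lambda>y. y i) \<in> borel_measurable (Rd n)" if "i < n" for i
      unfolding Rd_def using that measurable_component_singleton[of i "{..<n}" "\<lambda>_. lborel"]
      by (simp add: measurable_lborel1)
    then have hm: "h \<in> borel_measurable (Rd n)"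
      unfolding h_def using x
      by (intro borel_measurable_diff borel_measurable_sum borel_measurable_times \<phi>m) auto
    have "f x - \<phi> (?L f) x = Z x f + h (?L f)" for f
    proof -
      have "(\<Sum>j<k. g j x * (\<Sum>i<n. A j i * ?L f i)) = (\<Sum>j<k. g j x * B j f)"
        by (intro sum.cong refl) (simp add: B_eq)
      then show ?thesis by (simp add: Z_def h_def)
    qed
    then show ?thesis
      using gaussian_nonlinear_no_better[OF cZ Ls ZL hm] by simp
  qed
  have B_joint: "(\<lambda>w. B j (F w)) \<in> borel_measurable M" if "j < k" "F \<in> measurable M \<mu>" for j F and M :: "'c measure"
    using measurable_compose[OF that(2) cont_lin_measurable[OF cB[OF that(1)]]] .
  have g_joint: "(\<lambda>w. g j (X w)) \<in> borel_measurable M" if "j < k" "X \<in> measurable M \<nu>" for j X and M :: "'c measure"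
    using measurable_compose[OF that(2) g_m[OF that(1)]] .
  have Z_joint: "(\<lambda>(f, x). ennreal ((Z x f)\<^sup>2)) \<in> borel_measurable (\<mu> \<Otimes>\<^sub>M \<nu>)"
    unfolding Z_def case_prod_beta'
    by (intro measurable_compose[OF _ measurable_ennreal] borel_measurable_power borel_measurable_diff borel_measurable_sum
        borel_measurable_times B_joint g_joint evaluation_measurable) auto
  have err_joint: "(\<lambda>(f, x). ennreal ((f x - \<phi> (?L f) x)\<^sup>2)) \<in> borel_measurable (\<mu> \<Otimes>\<^sub>M \<nu>)"
    unfolding case_prod_beta'
    by (intro measurable_compose[OF _ measurable_ennreal] borel_measurable_power borel_measurable_diff
        \<phi>m evaluation_measurable measurable_compose[OF measurable_fst Lm] measurable_fst) (auto cong: measurable_cong_sets)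
  have "(\<integral>\<^sup>+f. (\<integral>\<^sup>+x. ennreal ((Z x f)\<^sup>2) \<partial>\<nu>) \<partial>\<mu>) = (\<integral>\<^sup>+x. (\<integral>\<^sup>+f. ennreal ((Z x f)\<^sup>2) \<partial>\<mu>) \<partial>\<nu>)"
    by (rule mu_nu.Fubini'[OF Z_joint, symmetric])
  also have "\<dots> \<le> (\<integral>\<^sup>+x. (\<integral>\<^sup>+f. ennreal ((f x - \<phi> (?L f) x)\<^sup>2) \<partial>\<mu>) \<partial>\<nu>)"
    by (rule nn_integral_mono) (rule pw)
  also have "\<dots> = (\<integral>\<^sup>+f. (\<integral>\<^sup>+x. ennreal ((f x - \<phi> (?L f) x)\<^sup>2) \<partial>\<nu>) \<partial>\<mu>)"
    by (rule mu_nu.Fubini'[OF err_joint])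
  also have "\<dots> = err_sq d D \<rho> \<mu> n Ls \<phi>"
    unfolding err_sq_def
  proof (intro nn_integral_cong G_sqnorm_eq[symmetric] borel_measurable_diff \<phi>m)
    fix f assume f: "f \<in> space \<mu>"
    then show "f \<in> borel_measurable (Rd d)" by (simp add: V_measurable)
    show "(\<lambda>x. ?L f) \<in> measurable (Rd d) (Rd n)"
      using measurable_space[OF Lm f] by simp
  qed simp
  finally have le1: "(\<integral>\<^sup>+f. (\<integral>\<^sup>+x. ennreal ((Z x f)\<^sup>2) \<partial>\<nu>) \<partial>\<mu>) \<le> err_sq d D \<rho> \<mu> n Ls \<phi>" .
  have "\<exists>m b A'. m \<le> k \<and> orthonormal \<nu> m b \<and> (\<forall>j<m. b j = (\<lambda>x. \<Sum>i<k. A' j i * g i x)) \<and>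
      (\<forall>i<k. AE x in \<nu>. g i x = proj \<nu> m b (g i) x)"
    by (rule gram_schmidt) (rule g_sq)
  then obtain m b A' where m: "m \<le> k" and b: "orthonormal \<nu> m b"
    and "\<forall>j<m. b j = (\<lambda>x. \<Sum>i<k. A' j i * g i x)" "\<forall>i<k. AE x in \<nu>. g i x = proj \<nu> m b (g i) x"
    by (elim exE conjE)
  then have b_eq: "\<And>j. j < m \<Longrightarrow> b j = (\<lambda>x. \<Sum>i<k. A' j i * g i x)"
    and g_ae: "\<And>i. i < k \<Longrightarrow> AE x in \<nu>. g i x = proj \<nu> m b (g i) x" by simp_all
  \<comment> \<open>For fixed \<open>f\<close> the predictor, as a function of x, is a combination
    of the \<open>g i\<close> and hence almost everywhere in the span of \<open>b\<close>; the
    projection of \<open>f\<close> is at least as close.\<close>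
  have le2: "ennreal (rerr m b f) \<le> (\<integral>\<^sup>+x. ennreal ((Z x f)\<^sup>2) \<partial>\<nu>)" if f: "f \<in> V" for f
  proof -
    define h where "h x = (\<Sum>i<k. B i f * g i x)" for x
    define c where "c j = (\<Sum>i<k. B i f * ip \<nu> (g i) (b j))" for j
    have sh: "sqint \<nu> h" unfolding h_def[abs_def] by (rule sqint_lincomb) (simp add: g_sq)
    have "AE x in \<nu>. \<forall>i\<in>{..<k}. g i x = proj \<nu> m b (g i) x"
      using g_ae by (intro AE_finite_allI) auto
    then have "AE x in \<nu>. h x = (\<Sum>j<m. c j * b j x)"
    proof eventually_elim
      case (elim x)
      have "h x = (\<Sum>i<k. B i f * proj \<nu> m b (g i) x)"
        unfolding h_def by (rule sum.cong[OF refl]) (use elim in auto)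
      also have "\<dots> = (\<Sum>j<m. c j * b j x)"
        unfolding proj_def c_def sum_distrib_left sum_distrib_right
        by (subst sum.swap) (simp add: ac_simps)
      finally show ?case .
    qed
    then have "rerr m b f \<le> ip \<nu> (\<lambda>x. f x - h x) (\<lambda>x. f x - h x)"
      unfolding rerr_def resid_def by (rule resid_le[OF b sqint_V[OF f] sh])
    then have "ennreal (rerr m b f) \<le> (\<integral>\<^sup>+x. ennreal ((f x - h x)\<^sup>2) \<partial>\<nu>)"
      by (subst nn_sqint[OF sqint_diff[OF sqint_V[OF f] sh]]) (rule ennreal_leI)
    then show ?thesis by (simp add: Z_def h_def mult.commute)
  qed
  show ?thesis
  proof (intro exI conjI allI impI)
    show "m \<le> n" using m k by simp
    show "orthonormal \<nu> m b" by (rule b)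
    show "b j x = 0" if "j < m" "x \<notin> D" for j x
      using that by (simp add: b_eq g_off)
    have "(\<integral>\<^sup>+f. ennreal (rerr m b f) \<partial>\<mu>) \<le> (\<integral>\<^sup>+f. (\<integral>\<^sup>+x. ennreal ((Z x f)\<^sup>2) \<partial>\<nu>) \<partial>\<mu>)"
      by (intro nn_integral_mono le2) simp
    then show "(\<integral>\<^sup>+f. ennreal (rerr m b f) \<partial>\<mu>) \<le> err_sq d D \<rho> \<mu> n Ls \<phi>"
      using le1 by (rule order_trans)
  qed
qed

text \<open>With \<open>n\<close> copies of \<open>m\<close> nodes, projection error and sampling
  error have squared means of at most \<open>?R\<close> each. The bound
  \<open>(u - v)^2 \<le> 2 * u^2 + 2 * v^2\<close> then gives the constant 4, that is, a factor 2 in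
  the error.\<close>

lemma sampling_upper_bound:
  assumes n: "n \<ge> 1" and m: "m \<le> n" and b: "orthonormal \<nu> m b"
    and b_off: "\<And>j x. j < m \<Longrightarrow> x \<notin> D \<Longrightarrow> b j x = 0"
  shows "e_avg_sq Lambda_std d D \<rho> V N \<mu> (n * n) \<le> 4 * (\<integral>\<^sup>+f. ennreal (rerr m b f) \<partial>\<mu>)"
proof -
  let ?R = "\<integral>\<^sup>+f. ennreal (rerr m b f) \<partial>\<mu>"
  let ?T = "tilted \<nu> m b"
  \<comment> \<open>The error of the coefficient estimated from one copy. It is built from the
    residual, which is orthogonal to the basis as \<open>tilted_interpolation\<close> requires;
    \<open>cofac_info\<close> relates it to the quantity computed from samples of
    \<open>f\<close>.\<close>
  define c where "c j X f = cofac m b X j (\<lambda>i. resid m b f (X i)) / vdet m b X" for j X f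
  have setsT: "sets ?T = sets (Pi\<^sub>M {..<m} (\<lambda>_. \<nu>))" by (simp add: tilted_def)
  have bm: "b l \<in> borel_measurable \<nu>" if "l < m" for l
    using sqint_orthonormal[OF b that] by (rule sqint_measurable)
  have c_joint: "(\<lambda>(X, f). c j X f) \<in> borel_measurable (?T \<Otimes>\<^sub>M \<mu>)" if j: "j < m" for j
  proof -
    have comp: "(\<lambda>w. fst w i) \<in> measurable (?T \<Otimes>\<^sub>M \<mu>) \<nu>" if "i < m" for i
    proof -
      have "(\<lambda>X. X i) \<in> measurable ?T \<nu>"
        using measurable_component_singleton[of i "{..<m}" "\<lambda>_. \<nu>"] that
        by (simp add: measurable_cong_sets[OF setsT refl])
      then show ?thesis by (rule measurable_compose[OF measurable_fst])
    qed
    have vm: "(\<lambda>w. vdet m b (fst w)) \<in> borel_measurable (?T \<Otimes>\<^sub>M \<mu>)"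
    proof -
      have "vdet m b \<in> borel_measurable ?T"
        using vdet_measurable[OF nu.prob_space_axioms bm]
        by (simp add: measurable_cong_sets[OF setsT refl])
      then show ?thesis by (rule measurable_compose[OF measurable_fst])
    qed
    have "(\<lambda>w. cofac m b (fst w) j (\<lambda>i. resid m b (snd w) (fst w i))) \<in> borel_measurable (?T \<Otimes>\<^sub>M \<mu>)"
      unfolding cofac_def
    proof (intro borel_measurable_sum borel_measurable_times borel_measurable_const borel_measurable_prod)
      fix p assume "p \<in> {p. p permutes {..<m}}"
      then have lt: "l < m \<Longrightarrow> p l < m" for l using permutes_in_image[of p "{..<m}" l] by simp
      show "(\<lambda>w. resid m b (snd w) (fst w (p j))) \<in> borel_measurable (?T \<Otimes>\<^sub>M \<mu>)"
        by (intro resid_measurable[OF b] measurable_snd comp lt j)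
      fix l assume "l \<in> {..<m} - {j}"
      then have l: "l < m" by simp
      show "(\<lambda>w. b l (fst w (p l))) \<in> borel_measurable (?T \<Otimes>\<^sub>M \<mu>)"
        by (rule measurable_compose[OF comp[OF lt[OF l]] bm[OF l]])
    qed
    then show ?thesis
      unfolding c_def case_prod_beta' by (intro borel_measurable_divide vm)
  qed
  have cf: "sqint ?T (\<lambda>X. c j X f)" "(\<integral>X. c j X f \<partial>?T) = 0" "(\<integral>X. (c j X f)\<^sup>2 \<partial>?T) \<le> rerr m b f"
    if "j < m" "f \<in> space \<mu>" for j f
  proof -
    have f: "f \<in> V" using that by simp
    have o: "ip \<nu> (resid m b f) (b k) = 0" if "k < m" for k
      unfolding resid_def by (rule ip_resid[OF b sqint_V[OF f] that])
    note * = tilted_interpolation[OF nu.prob_space_axioms b sqint_resid_V[OF b f] o \<open>j < m\<close>]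
    show "sqint ?T (\<lambda>X. c j X f)" "(\<integral>X. c j X f \<partial>?T) = 0" "(\<integral>X. (c j X f)\<^sup>2 \<partial>?T) \<le> rerr m b f"
      using * unfolding c_def rerr_def by simp_all
  qed
  have "\<exists>X. (\<forall>i<n. X i \<in> space ?T \<and> vdet m b (X i) \<noteq> 0) \<and>
     (\<integral>\<^sup>+f. (\<Sum>j<m. ennreal ((\<Sum>i<n. c j (X i) f)\<^sup>2)) \<partial>\<mu>) \<le> of_nat (n * m) * ?R"
    by (rule averaging_selection[OF prob_space_tilted[OF nu.prob_space_axioms b] prob_mu])
      (fact c_joint cf rerr_measurable[OF b] nn_rerr_finite[OF b] AE_tilted[OF nu.prob_space_axioms b])+
  then obtain X where X': "\<forall>i<n. X i \<in> space ?T \<and> vdet m b (X i) \<noteq> 0"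
    and Xle: "(\<integral>\<^sup>+f. (\<Sum>j<m. ennreal ((\<Sum>i<n. c j (X i) f)\<^sup>2)) \<partial>\<mu>) \<le> of_nat (n * m) * ?R"
    by (elim exE conjE)
  from X' have X: "\<And>i. i < n \<Longrightarrow> vdet m b (X i) \<noteq> 0" and XT: "\<And>i. i < n \<Longrightarrow> X i \<in> space ?T"
    by simp_all
  have XD: "X i l \<in> D" if "i < n" "l < m" for i l
    using X[OF that(1)] vdet_zero_row[OF that(2), of b "X i"] b_off by blast
  \<comment> \<open>Padding nodes must also be admissible, and positive measure guarantees a point
    in \<open>D\<close>.\<close>
  obtain x0 where x0: "x0 \<in> D" using D_pos by (metis emeasure_empty equals0I less_irrefl)
  \<comment> \<open>Node \<open>l\<close> of copy \<open>i\<close> has number \<open>i * n + l\<close>; the numbers with \<open>l \<ge> m\<close> are padding.\<close>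
  define Q where "Q q = (if q mod n < m then X (q div n) (q mod n) else x0)" for q
  define Ls where "Ls q = (\<lambda>f::fn. f (Q q))" for q
  have Q_D: "Q q \<in> D" if "q < n * n" for q
    using that n by (auto simp: Q_def x0 intro!: XD less_mult_imp_div_less)
  have idx: "i * n + l < n * n" "(i * n + l) div n = i" "(i * n + l) mod n = l" if "i < n" "l < n" for i l
  proof -
    have "i * n + l < i * n + n" using that by simp
    also have "\<dots> = Suc i * n" by simp
    also have "\<dots> \<le> n * n" using that by (intro mult_right_mono) auto
    finally show "i * n + l < n * n" .
  qed (use that in auto)
  \<comment> \<open>The coefficient of \<open>b j\<close> is Cramer's quotient for the samples,
    averaged over the copies.\<close>
  define \<phi> where "\<phi> y z = (\<Sum>j<m. (1 / real n) * (\<Sum>i<n. cofac m b (X i) j (\<lambda>l. y (i * n + l)) / vdet m b (X i)) * b j z)"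
    for y :: point and z :: point
  define S where "S j f = (1 / real n) * (\<Sum>i<n. c j (X i) f)" for j f
  have adm: "admissible Lambda_std D V N (Ls q)" if "q < n * n" for q
    using Q_D[OF that] by (auto simp: admissible_def Ls_def)
  have \<phi>_m: "(\<lambda>(y, z). \<phi> y z) \<in> borel_measurable (Rd (n * n) \<Otimes>\<^sub>M Rd d)"
    unfolding case_prod_beta' \<phi>_def cofac_def
  proof (intro borel_measurable_sum borel_measurable_times borel_measurable_const borel_measurable_divide)
    fix j assume "j \<in> {..<m}"
    then have j: "j < m" by simp
    show "(\<lambda>w. b j (snd w)) \<in> borel_measurable (Rd (n * n) \<Otimes>\<^sub>M Rd d)"
      using bm[OF j] by (intro measurable_compose[OF measurable_snd]) (simp cong: measurable_cong_sets)
    fix i p assume "i \<in> {..<n}" "p \<in> {p. p permutes {..<m}}"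
    then have i: "i < n" and "p j < m" using permutes_in_image[of p "{..<m}" j] j by auto
    then have "i * n + p j < n * n" using m by (intro idx) auto
    then have "(\<lambda>y. y (i * n + p j)) \<in> borel_measurable (Rd (n * n))"
      unfolding Rd_def using measurable_component_singleton[of "i * n + p j" "{..<n*n}" "\<lambda>_. lborel"]
      by (simp add: measurable_lborel1)
    then show "(\<lambda>w. fst w (i * n + p j)) \<in> borel_measurable (Rd (n * n) \<Otimes>\<^sub>M Rd d)"
      by (rule measurable_compose[OF measurable_fst])
  qed
  \<comment> \<open>Split \<open>f\<close> into projection and residual: the projection contributes
    its exact coefficient, the residual the error \<open>c\<close>.\<close>
  have cofac_info: "cofac m b (X i) j (\<lambda>l. restrict (\<lambda>q. Ls q f) {..<n*n} (i * n + l)) / vdet m b (X i)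
      = c j (X i) f + ip \<nu> f (b j)" if i: "i < n" and j: "j < m" and f: "f \<in> V" for i j f
  proof -
    have "cofac m b (X i) j (\<lambda>l. restrict (\<lambda>q. Ls q f) {..<n*n} (i * n + l)) = cofac m b (X i) j (\<lambda>l. f (X i l))"
      using m i by (intro cofac_cong[OF j]) (auto simp: idx Ls_def Q_def)
    moreover have "cofac m b (X i) j (\<lambda>l. resid m b f (X i l)) = cofac m b (X i) j (\<lambda>l. f (X i l))
        - (\<Sum>k<m. ip \<nu> f (b k) * cofac m b (X i) j (\<lambda>l. b k (X i l)))"
      unfolding resid_def proj_def cofac_diff cofac_sum ..
    moreover have "(\<Sum>k<m. ip \<nu> f (b k) * cofac m b (X i) j (\<lambda>l. b k (X i l))) = ip \<nu> f (b j) * vdet m b (X i)"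
      using j by (simp add: cofac_basis if_distrib[of "(*) _"] cong: if_cong)
    ultimately show ?thesis
      using X[OF i] by (simp add: c_def diff_divide_distrib)
  qed
  have S_m: "S j \<in> borel_measurable \<mu>" if "j < m" for j
    unfolding S_def[abs_def]
  proof (intro borel_measurable_times borel_measurable_const borel_measurable_sum)
    fix i assume "i \<in> {..<n}"
    then show "(\<lambda>f. c j (X i) f) \<in> borel_measurable \<mu>"
      using measurable_compose[OF measurable_Pair1'[OF XT] c_joint[OF that]] by simp
  qed
  have G: "G_sqnorm d D \<rho> (\<lambda>x. f x - \<phi> (restrict (\<lambda>q. Ls q f) {..<n*n}) x)
      \<le> 2 * ennreal (rerr m b f) + 2 * (\<Sum>j<m. ennreal ((S j f)\<^sup>2))" if f: "f \<in> V" for f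
  proof -
    define h where "h x = (\<Sum>j<m. S j f * b j x)" for x
    have sr: "sqint \<nu> (resid m b f)" by (rule sqint_resid_V[OF b f])
    have sh: "sqint \<nu> h" unfolding h_def[abs_def] by (rule sqint_lincomb_orthonormal[OF b])
    have "f x - \<phi> (restrict (\<lambda>q. Ls q f) {..<n*n}) x = resid m b f x - h x" for x
    proof -
      have "\<phi> (restrict (\<lambda>q. Ls q f) {..<n*n}) x = (\<Sum>j<m. (S j f + ip \<nu> f (b j)) * b j x)"
        unfolding \<phi>_def
      proof (intro sum.cong refl)
        fix j assume "j \<in> {..<m}"
        then have j: "j < m" by simp
        have "(\<Sum>i<n. cofac m b (X i) j (\<lambda>l. restrict (\<lambda>q. Ls q f) {..<n*n} (i * n + l)) / vdet m b (X i))
            = (\<Sum>i<n. c j (X i) f + ip \<nu> f (b j))"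
          by (intro sum.cong refl cofac_info j f) simp
        then show "1 / real n * (\<Sum>i<n. cofac m b (X i) j (\<lambda>l. restrict (\<lambda>q. Ls q f) {..<n*n} (i * n + l)) / vdet m b (X i)) * b j x
            = (S j f + ip \<nu> f (b j)) * b j x"
          using n by (simp add: S_def sum.distrib add_divide_distrib)
      qed
      then show ?thesis
        by (simp add: resid_def proj_def h_def distrib_right sum.distrib)
    qed
    then have "G_sqnorm d D \<rho> (\<lambda>x. f x - \<phi> (restrict (\<lambda>q. Ls q f) {..<n*n}) x)
        = (\<integral>\<^sup>+x. ennreal ((resid m b f x - h x)\<^sup>2) \<partial>\<nu>)"
      using sqint_measurable[OF sqint_diff[OF sr sh]] by (simp add: G_sqnorm_eq cong: measurable_cong_sets)
    also have "\<dots> \<le> (\<integral>\<^sup>+x. 2 * ennreal ((resid m b f x)\<^sup>2) + 2 * ennreal ((h x)\<^sup>2) \<partial>\<nu>)"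
    proof (rule nn_integral_mono)
      fix x
      have "(u - v)\<^sup>2 \<le> 2 * u\<^sup>2 + 2 * v\<^sup>2" for u v :: real
        using zero_le_power2[of "u + v"] by (simp add: power2_sum power2_diff)
      then have "ennreal ((resid m b f x - h x)\<^sup>2) \<le> ennreal (2 * (resid m b f x)\<^sup>2 + 2 * (h x)\<^sup>2)"
        by (rule ennreal_leI)
      also have "\<dots> = 2 * ennreal ((resid m b f x)\<^sup>2) + 2 * ennreal ((h x)\<^sup>2)"
        by (simp add: ennreal_mult)
      finally show "ennreal ((resid m b f x - h x)\<^sup>2) \<le> 2 * ennreal ((resid m b f x)\<^sup>2) + 2 * ennreal ((h x)\<^sup>2)" .
    qed
    also have "\<dots> = 2 * ennreal (rerr m b f) + 2 * ennreal (ip \<nu> h h)"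
      using sqint_measurable[OF sr] sqint_measurable[OF sh]
      by (subst nn_integral_add) (auto simp: nn_integral_cmult nn_sqint sr sh rerr_def)
    also have "ennreal (ip \<nu> h h) = (\<Sum>j<m. ennreal ((S j f)\<^sup>2))"
      unfolding h_def[abs_def] ip_lincomb_self[OF b] by (rule sum_ennreal[symmetric]) simp
    finally show ?thesis .
  qed
  \<comment> \<open>Selection gives \<open>n * m\<close> times \<open>?R\<close> for the sum over
    the copies, and averaging divides by \<open>n^2\<close>; what remains is
    \<open>m / n \<le> 1\<close>.\<close>
  have SS: "(\<integral>\<^sup>+f. (\<Sum>j<m. ennreal ((S j f)\<^sup>2)) \<partial>\<mu>) \<le> ?R"
  proof -
    have meas: "(\<lambda>f. \<Sum>j<m. ennreal ((\<Sum>i<n. c j (X i) f)\<^sup>2)) \<in> borel_measurable \<mu>"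
    proof (intro borel_measurable_sum)
      fix j assume "j \<in> {..<m}"
      then have [measurable]: "S j \<in> borel_measurable \<mu>" by (simp add: S_m)
      have "(\<lambda>f. ennreal ((real n * S j f)\<^sup>2)) \<in> borel_measurable \<mu>" by measurable
      then show "(\<lambda>f. ennreal ((\<Sum>i<n. c j (X i) f)\<^sup>2)) \<in> borel_measurable \<mu>"
        using n by (simp add: S_def)
    qed
    have "(\<integral>\<^sup>+f. (\<Sum>j<m. ennreal ((S j f)\<^sup>2)) \<partial>\<mu>)
        = (\<integral>\<^sup>+f. ennreal (1 / (real n)\<^sup>2) * (\<Sum>j<m. ennreal ((\<Sum>i<n. c j (X i) f)\<^sup>2)) \<partial>\<mu>)"
      unfolding S_def sum_distrib_left
      by (intro nn_integral_cong sum.cong refl) (simp add: ennreal_mult[symmetric] power_divide sum_divide_distrib[symmetric])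
    also have "\<dots> = ennreal (1 / (real n)\<^sup>2) * (\<integral>\<^sup>+f. (\<Sum>j<m. ennreal ((\<Sum>i<n. c j (X i) f)\<^sup>2)) \<partial>\<mu>)"
      by (rule nn_integral_cmult[OF meas])
    also have "\<dots> \<le> ennreal (1 / (real n)\<^sup>2) * (of_nat (n * m) * ?R)"
      by (intro mult_left_mono Xle) simp
    also have "\<dots> = ennreal (1 / (real n)\<^sup>2 * real (n * m)) * ?R"
      by (subst ennreal_mult) (auto simp: ennreal_of_nat_eq_real_of_nat[symmetric] mult.assoc simp del: of_nat_mult)
    also have "\<dots> \<le> 1 * ?R"
    proof (intro mult_right_mono)
      have "1 / (real n)\<^sup>2 * real (n * m) \<le> 1"
        using n m by (simp add: field_simps power2_eq_square)
      then show "ennreal (1 / (real n)\<^sup>2 * real (n * m)) \<le> 1"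
        using ennreal_leI by fastforce
    qed simp
    finally show ?thesis by simp
  qed
  have "e_avg_sq Lambda_std d D \<rho> V N \<mu> (n * n) \<le> err_sq d D \<rho> \<mu> (n * n) Ls \<phi>"
    unfolding e_avg_sq_def using n adm \<phi>_m
    by (auto intro!: INF_lower2[of "(Ls, \<phi>)"])
  also have "\<dots> \<le> (\<integral>\<^sup>+f. 2 * ennreal (rerr m b f) + 2 * (\<Sum>j<m. ennreal ((S j f)\<^sup>2)) \<partial>\<mu>)"
    unfolding err_sq_def by (intro nn_integral_mono G) simp
  also have "\<dots> = 2 * ?R + 2 * (\<integral>\<^sup>+f. (\<Sum>j<m. ennreal ((S j f)\<^sup>2)) \<partial>\<mu>)"
  proof -
    have [measurable]: "rerr m b \<in> borel_measurable \<mu>" by (rule rerr_measurable[OF b])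
    have [measurable]: "(\<lambda>f. \<Sum>j<m. ennreal ((S j f)\<^sup>2)) \<in> borel_measurable \<mu>"
      using S_m by (intro borel_measurable_sum) auto
    show ?thesis by (subst nn_integral_add) (auto simp: nn_integral_cmult simp del: sum_ennreal)
  qed
  also have "\<dots> \<le> 2 * ?R + 2 * ?R"
    by (intro add_left_mono mult_left_mono SS) simp
  also have "\<dots> = 4 * ?R" by (simp add: distrib_right[symmetric])
  finally show ?thesis .
qed

section \<open>Comparison of minimal errors and of complexities\<close>

lemma e_std_le_e_all:
  "e_avg_sq Lambda_std d D \<rho> V N \<mu> (n * n) \<le> 4 * e_avg_sq Lambda_all d D \<rho> V N \<mu> n"
proof (cases "n = 0")
  case True
  have "1 * x \<le> 4 * x" for x :: ennreal by (intro mult_right_mono) auto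
  then show ?thesis using True by (simp add: e_avg_sq_def)
next
  case False
  let ?P = "{(Ls :: nat \<Rightarrow> fn \<Rightarrow> real, \<phi> :: point \<Rightarrow> point \<Rightarrow> real). (\<forall>i<n. admissible Lambda_all D V N (Ls i)) \<and>
                      (\<lambda>(y, x). \<phi> y x) \<in> borel_measurable (Rd n \<Otimes>\<^sub>M Rd d)}"
  let ?E = "e_avg_sq Lambda_std d D \<rho> V N \<mu> (n * n)"
  have four: "ennreal (1 / 4) * (4 * x) = x" "4 * (ennreal (1 / 4) * x) = x" for x
  proof -
    have "ennreal (1 / 4) * ennreal 4 = 1" by (subst ennreal_mult[symmetric]) auto
    then have "ennreal (1 / 4) * 4 = 1" by simp
    then have "(ennreal (1 / 4) * 4) * x = x" by simp
    then show "ennreal (1 / 4) * (4 * x) = x" "4 * (ennreal (1 / 4) * x) = x"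
      by (simp_all only: ac_simps)
  qed
  \<comment> \<open>The factor 4 is moved to the left so that the claim becomes a lower bound for
    each algorithm in the infimum.\<close>
  have "ennreal (1 / 4) * ?E \<le> (INF p\<in>?P. err_sq d D \<rho> \<mu> n (fst p) (snd p))"
  proof (rule INF_greatest)
    fix p assume p: "p \<in> ?P"
    then have Ls: "\<And>i. i < n \<Longrightarrow> cont_lin_fun V N (fst p i)"
      and \<phi>: "(\<lambda>(y, x). snd p y x) \<in> borel_measurable (Rd n \<Otimes>\<^sub>M Rd d)"
      by (auto simp: admissible_def)
    have "\<exists>m b. m \<le> n \<and> orthonormal \<nu> m b \<and> (\<forall>j<m. \<forall>x. x \<notin> D \<longrightarrow> b j x = 0) \<and>
        (\<integral>\<^sup>+f. ennreal (rerr m b f) \<partial>\<mu>) \<le> err_sq d D \<rho> \<mu> n (fst p) (snd p)"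
      by (rule algorithm_lower_bound[OF Ls \<phi>])
    then obtain m b where mb: "m \<le> n" "orthonormal \<nu> m b" "\<forall>j<m. \<forall>x. x \<notin> D \<longrightarrow> b j x = 0"
      and le: "(\<integral>\<^sup>+f. ennreal (rerr m b f) \<partial>\<mu>) \<le> err_sq d D \<rho> \<mu> n (fst p) (snd p)"
      by (elim exE conjE)
    have "?E \<le> 4 * (\<integral>\<^sup>+f. ennreal (rerr m b f) \<partial>\<mu>)"
      by (rule sampling_upper_bound) (use False mb in auto)
    also have "\<dots> \<le> 4 * err_sq d D \<rho> \<mu> n (fst p) (snd p)"
      by (intro mult_left_mono le) simp
    finally have "ennreal (1 / 4) * ?E \<le> ennreal (1 / 4) * (4 * err_sq d D \<rho> \<mu> n (fst p) (snd p))"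
      by (intro mult_left_mono) auto
    then show "ennreal (1 / 4) * ?E \<le> err_sq d D \<rho> \<mu> n (fst p) (snd p)" by (simp only: four)
  qed
  then have "ennreal (1 / 4) * ?E \<le> e_avg_sq Lambda_all d D \<rho> V N \<mu> n"
    using False by (simp add: e_avg_sq_def)
  then have "4 * (ennreal (1 / 4) * ?E) \<le> 4 * e_avg_sq Lambda_all d D \<rho> V N \<mu> n"
    by (intro mult_left_mono) auto
  then show ?thesis by (simp only: four)
qed

lemma e_all_le_e_std: "e_avg_sq Lambda_all d D \<rho> V N \<mu> n \<le> e_avg_sq Lambda_std d D \<rho> V N \<mu> n"
proof -
  have "admissible Lambda_std D V N L \<Longrightarrow> admissible Lambda_all D V N L" for L
    using cont_lin_eval by (auto simp: admissible_def)
  then show ?thesis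
    unfolding e_avg_sq_def by (auto intro!: INF_superset_mono)
qed

text \<open>Orthogonal projection is itself an algorithm with the coefficients as information; zero
  functionals fill up the remaining \<open>n - m\<close> places.\<close>

lemma e_all_le_rerr:
  assumes n: "n \<ge> 1" and m: "m \<le> n" and b: "orthonormal \<nu> m b"
  shows "e_avg_sq Lambda_all d D \<rho> V N \<mu> n \<le> (\<integral>\<^sup>+f. ennreal (rerr m b f) \<partial>\<mu>)"
proof -
  define Ls where "Ls i = (if i < m then (\<lambda>f. ip \<nu> f (b i)) else (\<lambda>_. 0))" for i
  define \<phi> where "\<phi> y z = (\<Sum>j<m. y j * b j z)" for y z :: point
  have adm: "admissible Lambda_all D V N (Ls i)" for i
    by (auto simp: admissible_def Ls_def cont_lin_zero cont_lin_ip_orthonormal[OF b])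
  have \<phi>_m: "(\<lambda>(y, z). \<phi> y z) \<in> borel_measurable (Rd n \<Otimes>\<^sub>M Rd d)"
    unfolding case_prod_beta' \<phi>_def
  proof (intro borel_measurable_sum borel_measurable_times)
    fix j assume "j \<in> {..<m}"
    then have j: "j < m" by simp
    have "b j \<in> borel_measurable \<nu>" by (rule sqint_measurable[OF sqint_orthonormal[OF b j]])
    then show "(\<lambda>w. b j (snd w)) \<in> borel_measurable (Rd n \<Otimes>\<^sub>M Rd d)"
      by (intro measurable_compose[OF measurable_snd]) (simp cong: measurable_cong_sets)
    have "(\<lambda>y. y j) \<in> borel_measurable (Rd n)"
      unfolding Rd_def using j m measurable_component_singleton[of j "{..<n}" "\<lambda>_. lborel"]
      by (simp add: measurable_lborel1)
    then show "(\<lambda>w. fst w j) \<in> borel_measurable (Rd n \<Otimes>\<^sub>M Rd d)"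
      by (rule measurable_compose[OF measurable_fst])
  qed
  have "e_avg_sq Lambda_all d D \<rho> V N \<mu> n \<le> err_sq d D \<rho> \<mu> n Ls \<phi>"
    unfolding e_avg_sq_def using n adm \<phi>_m
    by (auto intro!: INF_lower2[of "(Ls, \<phi>)"])
  also have "\<dots> = (\<integral>\<^sup>+f. ennreal (rerr m b f) \<partial>\<mu>)"
    unfolding err_sq_def
  proof (intro nn_integral_cong)
    fix f assume "f \<in> space \<mu>"
    then have f: "f \<in> V" by simp
    have "(\<lambda>x. f x - \<phi> (restrict (\<lambda>i. Ls i f) {..<n}) x) = resid m b f"
      using m by (auto simp: fun_eq_iff \<phi>_def Ls_def resid_def proj_def intro!: sum.cong)
    then show "G_sqnorm d D \<rho> (\<lambda>x. f x - \<phi> (restrict (\<lambda>i. Ls i f) {..<n}) x) = ennreal (rerr m b f)"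
      using sqint_measurable[OF sqint_resid_V[OF b f]] nn_sqint[OF sqint_resid_V[OF b f]]
      by (simp add: G_sqnorm_eq rerr_def cong: measurable_cong_sets)
  qed
  finally show ?thesis .
qed

text \<open>Project onto the span of the first \<open>n\<close> members of a dense sequence. The
  residual tends to zero for every \<open>f\<close> by the embedding, and the integrable squared
  norm dominates it.\<close>

lemma e_all_tendsto_zero:
  assumes "\<delta> > 0"
  shows "\<exists>n. e_avg_sq Lambda_all d D \<rho> V N \<mu> n \<le> ennreal \<delta>"
proof -
  obtain s where sd: "\<forall>i. s i \<in> V" "\<forall>f\<in>V. \<forall>e>0. \<exists>i::nat. N (\<lambda>x. f x - s i x) < e"
    using dense_sequence by (elim exE conjE)
  then have s: "\<And>i. s i \<in> V" and dense: "\<And>f e. f \<in> V \<Longrightarrow> e > 0 \<Longrightarrow> \<exists>i. N (\<lambda>x. f x - s i x) < e"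
    by simp_all
  have "\<forall>n. \<exists>m b. m \<le> n \<and> orthonormal \<nu> m b \<and> (\<forall>i<n. AE x in \<nu>. s i x = proj \<nu> m b (s i) x)"
  proof
    fix n
    show "\<exists>m b. m \<le> n \<and> orthonormal \<nu> m b \<and> (\<forall>i<n. AE x in \<nu>. s i x = proj \<nu> m b (s i) x)"
    proof -
      have "\<exists>m b A. m \<le> n \<and> orthonormal \<nu> m b \<and> (\<forall>j<m. b j = (\<lambda>x. \<Sum>i<n. A j i * s i x)) \<and>
          (\<forall>i<n. AE x in \<nu>. s i x = proj \<nu> m b (s i) x)"
        by (rule gram_schmidt) (rule sqint_V[OF s])
      then show ?thesis by (elim exE conjE) (intro exI conjI)
    qed
  qed
  from choice[OF this] obtain m where
    "\<forall>n. \<exists>b. m n \<le> n \<and> orthonormal \<nu> (m n) b \<and> (\<forall>i<n. AE x in \<nu>. s i x = proj \<nu> (m n) b (s i) x)"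
    by (elim exE)
  from choice[OF this] obtain b where
    mb: "\<forall>n. m n \<le> n \<and> orthonormal \<nu> (m n) (b n) \<and> (\<forall>i<n. AE x in \<nu>. s i x = proj \<nu> (m n) (b n) (s i) x)"
    by (elim exE)
  then have m: "\<And>n. m n \<le> n" and b: "\<And>n. orthonormal \<nu> (m n) (b n)"
    and ae: "\<And>n i. i < n \<Longrightarrow> AE x in \<nu>. s i x = proj \<nu> (m n) (b n) (s i) x"
    by simp_all
  obtain C where C: "\<And>f. f \<in> V \<Longrightarrow> ip \<nu> f f \<le> (C * N f)\<^sup>2" using ip_nu_embedding by blast
  have lim: "(\<lambda>n. rerr (m n) (b n) f) \<longlonglongrightarrow> 0" if f: "f \<in> V" for f
  proof (rule LIMSEQ_I)
    fix e :: real assume e: "e > 0"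
    define C' where "C' = \<bar>C\<bar> + 1"
    have C': "C' > 0" "\<bar>C\<bar> \<le> C'" by (auto simp: C'_def)
    obtain i where i: "N (\<lambda>x. f x - s i x) < sqrt e / C'"
      using dense[OF f, of "sqrt e / C'"] e C' by auto
    have v: "(\<lambda>x. f x - s i x) \<in> V" by (rule V_diff[OF f s])
    have "\<bar>C * N (\<lambda>x. f x - s i x)\<bar> \<le> C' * N (\<lambda>x. f x - s i x)"
      using C' N_nonneg[OF v] by (simp add: abs_mult mult_right_mono)
    also have "\<dots> < sqrt e" using i C' by (simp add: field_simps)
    finally have "\<bar>C * N (\<lambda>x. f x - s i x)\<bar>\<^sup>2 < (sqrt e)\<^sup>2"
      by (intro power_strict_mono) auto
    then have "(C * N (\<lambda>x. f x - s i x))\<^sup>2 < e" using e by simp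
    then have le: "ip \<nu> (\<lambda>x. f x - s i x) (\<lambda>x. f x - s i x) < e"
      using C[OF v] by simp
    have "rerr (m n) (b n) f \<le> ip \<nu> (\<lambda>x. f x - s i x) (\<lambda>x. f x - s i x)" if "n \<ge> Suc i" for n
      unfolding rerr_def resid_def using that
      by (intro resid_le[OF b sqint_V[OF f] sqint_V[OF s] ae[unfolded proj_def]]) simp
    then show "\<exists>no. \<forall>n\<ge>no. norm (rerr (m n) (b n) f - 0) < e"
      using le rerr_nonneg by (intro exI[of _ "Suc i"]) (auto intro: le_less_trans)
  qed
  have "(\<lambda>n. \<integral>\<^sup>+f. ennreal (rerr (m n) (b n) f) \<partial>\<mu>) \<longlonglongrightarrow> (\<integral>\<^sup>+f. 0 \<partial>\<mu>)"
  proof (rule nn_integral_dominated_convergence[where w="\<lambda>f. ennreal (ip \<nu> f f)"])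
    show "(\<lambda>f. ennreal (rerr (m n) (b n) f)) \<in> borel_measurable \<mu>" for n
      using rerr_measurable[OF b] by measurable
    show "AE f in \<mu>. ennreal (rerr (m n) (b n) f) \<le> ennreal (ip \<nu> f f)" for n
      by (intro AE_I2 ennreal_leI rerr_le[OF b]) simp
    show "AE f in \<mu>. (\<lambda>n. ennreal (rerr (m n) (b n) f)) \<longlonglongrightarrow> 0"
      using tendsto_ennrealI[OF lim] by (intro AE_I2) simp
    have "rerr 0 (\<lambda>_ _. 0) = (\<lambda>f. ip \<nu> f f)" by (simp add: rerr_def resid_def proj_def fun_eq_iff)
    moreover have "orthonormal \<nu> 0 (\<lambda>_ _. 0)" by (simp add: orthonormal_def)
    ultimately show "(\<lambda>f. ennreal (ip \<nu> f f)) \<in> borel_measurable \<mu>"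
      using rerr_measurable[of 0 "\<lambda>_ _. 0"] by simp
  qed (use nn_second_moment in auto)
  then have "(\<lambda>n. \<integral>\<^sup>+f. ennreal (rerr (m n) (b n) f) \<partial>\<mu>) \<longlonglongrightarrow> 0" by simp
  then have "eventually (\<lambda>n. (\<integral>\<^sup>+f. ennreal (rerr (m n) (b n) f) \<partial>\<mu>) < ennreal \<delta>) sequentially"
    by (rule order_tendstoD) (use assms in simp)
  then obtain n0 where n0: "\<And>n. n \<ge> n0 \<Longrightarrow> (\<integral>\<^sup>+f. ennreal (rerr (m n) (b n) f) \<partial>\<mu>) < ennreal \<delta>"
    by (auto simp: eventually_sequentially)
  have "e_avg_sq Lambda_all d D \<rho> V N \<mu> (Suc n0) \<le> (\<integral>\<^sup>+f. ennreal (rerr (m (Suc n0)) (b (Suc n0)) f) \<partial>\<mu>)"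
    by (rule e_all_le_rerr[OF _ m b]) simp
  also have "\<dots> \<le> ennreal \<delta>" using n0[of "Suc n0"] by simp
  finally show ?thesis by blast
qed

text \<open>A \<open>LEAST\<close> says something only if the threshold is reached. For arbitrary
  information this is convergence of the errors to zero, and the comparison of \<open>n * n\<close>
  samples with \<open>n\<close> functionals carries it over to function values.\<close>

lemma n_ABS_comparison:
  assumes "\<epsilon> > 0"
  shows "n_ABS Lambda_all \<epsilon> d D \<rho> V N \<mu> \<le> n_ABS Lambda_std \<epsilon> d D \<rho> V N \<mu>"
    and "n_ABS Lambda_std \<epsilon> d D \<rho> V N \<mu> \<le> (n_ABS Lambda_all (\<epsilon> / 2) d D \<rho> V N \<mu>)\<^sup>2"
proof -
  define n where "n = n_ABS Lambda_all (\<epsilon> / 2) d D \<rho> V N \<mu>"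
  have "e_avg_sq Lambda_all d D \<rho> V N \<mu> n \<le> ennreal ((\<epsilon> / 2)\<^sup>2)"
    unfolding n_def n_ABS_def by (rule LeastI_ex) (rule e_all_tendsto_zero, use assms in simp)
  then have "4 * e_avg_sq Lambda_all d D \<rho> V N \<mu> n \<le> 4 * ennreal ((\<epsilon> / 2)\<^sup>2)"
    by (intro mult_left_mono) auto
  also have "\<dots> = ennreal (4 * (\<epsilon> / 2)\<^sup>2)" by (simp add: ennreal_mult)
  finally have std: "e_avg_sq Lambda_std d D \<rho> V N \<mu> (n * n) \<le> ennreal (\<epsilon>\<^sup>2)"
    using e_std_le_e_all[of n] by (simp add: power_divide)
  then show "n_ABS Lambda_std \<epsilon> d D \<rho> V N \<mu> \<le> (n_ABS Lambda_all (\<epsilon> / 2) d D \<rho> V N \<mu>)\<^sup>2"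
    unfolding n_def[symmetric] n_ABS_def[of Lambda_std] power2_eq_square by (rule Least_le)
  have "e_avg_sq Lambda_std d D \<rho> V N \<mu> (n_ABS Lambda_std \<epsilon> d D \<rho> V N \<mu>) \<le> ennreal (\<epsilon>\<^sup>2)"
    unfolding n_ABS_def by (rule LeastI[of _ "n * n"]) (rule std)
  then show "n_ABS Lambda_all \<epsilon> d D \<rho> V N \<mu> \<le> n_ABS Lambda_std \<epsilon> d D \<rho> V N \<mu>"
    unfolding n_ABS_def[of Lambda_all] by (intro Least_le order_trans[OF e_all_le_e_std])
qed

end

section \<open>Transfer of the complexity bounds to EXP-UWT\<close>

theorem theorem5p6:
  fixes D :: "nat \<Rightarrow> point set" and \<rho> :: "nat \<Rightarrow> point \<Rightarrow> real"
    and V :: "nat \<Rightarrow> fn set" and N :: "nat \<Rightarrow> fn \<Rightarrow> real" and \<mu> :: "nat \<Rightarrow> fn measure"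
  assumes "\<forall>d\<ge>1. avg_setting d (D d) (\<rho> d) (V d) (N d) (\<mu> d)"
  shows "EXP_UWT Lambda_all D \<rho> V N \<mu> \<longleftrightarrow> EXP_UWT Lambda_std D \<rho> V N \<mu>"
proof -
  define na where "na \<epsilon> d = n_ABS Lambda_all \<epsilon> d (D d) (\<rho> d) (V d) (N d) (\<mu> d)" for \<epsilon> d
  define ns where "ns \<epsilon> d = n_ABS Lambda_std \<epsilon> d (D d) (\<rho> d) (V d) (N d) (\<mu> d)" for \<epsilon> d
  have le: "na \<epsilon> d \<le> ns \<epsilon> d" "ns \<epsilon> d \<le> (na (\<epsilon> / 2) d)\<^sup>2" if "d \<ge> 1" "\<epsilon> > 0" for \<epsilon> d
  proof -
    interpret avg_case d "D d" "\<rho> d" "V d" "N d" "\<mu> d"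
      using assms that by unfold_locales simp
    show "na \<epsilon> d \<le> ns \<epsilon> d" "ns \<epsilon> d \<le> (na (\<epsilon> / 2) d)\<^sup>2"
      unfolding na_def ns_def by (rule n_ABS_comparison[OF that(2)])+
  qed
  \<comment> \<open>In HOL, \<open>ln 0 = 0\<close>.\<close>
  have ln_mono0: "ln (real k) \<le> ln (real l)" if "k \<le> l" for k l :: nat
  proof (cases "k = 0")
    case True
    then show ?thesis by (cases "l = 0") auto
  qed (use that in auto)
  show ?thesis
  proof
    assume all: "EXP_UWT Lambda_all D \<rho> V N \<mu>"
    show "EXP_UWT Lambda_std D \<rho> V N \<mu>"
      unfolding EXP_UWT_def
    proof (intro allI impI)
      fix \<alpha> \<beta> \<eta> :: real assume pos: "\<alpha> > 0" "\<beta> > 0" "\<eta> > 0"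
      \<comment> \<open>Halving \<open>\<epsilon>\<close> at most doubles
        \<open>1 + ln (1 / \<epsilon>)\<close>, since \<open>ln 2 \<le> 1\<close>, so the
        denominator grows at most by the factor \<open>q\<close>. The tolerance
        \<open>\<eta> / (2 * q)\<close> pays for this and for the 2 coming from the logarithm of the
        square.\<close>
      define q where "q = 2 powr \<alpha>"
      have q: "q \<ge> 1" using pos by (simp add: q_def ge_one_powr_ge_zero)
      have "\<eta> / (2 * q) > 0" using pos q by simp
      have "\<exists>M. \<forall>d\<ge>1. \<forall>\<epsilon>. 0 < \<epsilon> \<and> \<epsilon> < 1 \<and> M < 1 / \<epsilon> + real d \<longrightarrow>
          ln (real (na \<epsilon> d)) / ((1 + ln (1 / \<epsilon>)) powr \<alpha> + real d powr \<beta>) < \<eta> / (2 * q)"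
        using all[unfolded EXP_UWT_def, folded na_def, THEN spec, THEN mp, OF pos(1), THEN spec, THEN mp, OF pos(2),
            THEN spec, THEN mp, OF \<open>\<eta> / (2 * q) > 0\<close>] .
      then obtain M where M0: "\<forall>d\<ge>1. \<forall>\<epsilon>. 0 < \<epsilon> \<and> \<epsilon> < 1 \<and> M < 1 / \<epsilon> + real d \<longrightarrow>
          ln (real (na \<epsilon> d)) / ((1 + ln (1 / \<epsilon>)) powr \<alpha> + real d powr \<beta>) < \<eta> / (2 * q)"
        by (elim exE)
      have M: "ln (real (na \<epsilon> d)) / ((1 + ln (1 / \<epsilon>)) powr \<alpha> + real d powr \<beta>) < \<eta> / (2 * q)"
        if "d \<ge> 1" "0 < \<epsilon>" "\<epsilon> < 1" "1 / \<epsilon> + real d > M" for d \<epsilon>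
        by (rule M0[THEN spec, THEN mp, THEN spec, THEN mp]) (intro conjI that)+
      have "ln (real (ns \<epsilon> d)) / ((1 + ln (1 / \<epsilon>)) powr \<alpha> + real d powr \<beta>) < \<eta>"
        if d: "d \<ge> 1" and \<epsilon>: "0 < \<epsilon>" "\<epsilon> < 1" and gt: "1 / \<epsilon> + real d > M" for d \<epsilon>
      proof -
        define W where "W = (1 + ln (1 / \<epsilon>)) powr \<alpha> + real d powr \<beta>"
        define W' where "W' = (1 + ln (1 / (\<epsilon> / 2))) powr \<alpha> + real d powr \<beta>"
        have L: "ln (1 / \<epsilon>) > 0" using \<epsilon> by simp
        have W: "W > 0" unfolding W_def using d by (intro add_nonneg_pos) auto
        have L2: "ln (1 / (\<epsilon> / 2)) = ln 2 + ln (1 / \<epsilon>)"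
          using \<epsilon> by (simp add: ln_div)
        have "ln 2 \<le> (1::real)" using ln_le_minus_one[of 2] by simp
        then have "1 + ln (1 / (\<epsilon> / 2)) \<le> 2 * (1 + ln (1 / \<epsilon>))" using L unfolding L2 by (simp del: ln_inverse add: algebra_simps)
        moreover have "0 \<le> 1 + ln (1 / (\<epsilon> / 2))" using L L2 by (simp add: add_nonneg_nonneg)
        ultimately have "(1 + ln (1 / (\<epsilon> / 2))) powr \<alpha> \<le> (2 * (1 + ln (1 / \<epsilon>))) powr \<alpha>"
          using pos by (intro powr_mono2) auto
        also have "\<dots> = q * (1 + ln (1 / \<epsilon>)) powr \<alpha>"
          unfolding q_def by (rule powr_mult)
        finally have "W' \<le> q * (1 + ln (1 / \<epsilon>)) powr \<alpha> + q * real d powr \<beta>"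
          unfolding W'_def using mult_right_mono[OF q, of "real d powr \<beta>"] by simp
        then have WW: "W' \<le> q * W" by (simp add: W_def distrib_left)
        have W': "W' > 0" unfolding W'_def using d by (intro add_nonneg_pos) auto
        \<comment> \<open>Halving \<open>\<epsilon>\<close> only increases
          \<open>1 / \<epsilon> + d\<close>, so the same threshold \<open>M\<close> serves.\<close>
        have "1 / (\<epsilon> / 2) \<ge> 1 / \<epsilon>" using \<epsilon> by (simp add: field_simps)
        then have "ln (real (na (\<epsilon> / 2) d)) / W' < \<eta> / (2 * q)"
          unfolding W'_def using d \<epsilon> gt by (intro M) auto
        then have "ln (real (na (\<epsilon> / 2) d)) < \<eta> / (2 * q) * W'"
          using W' by (simp add: field_simps)
        also have "\<dots> \<le> \<eta> / (2 * q) * (q * W)"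
          using pos q by (intro mult_left_mono WW) auto
        also have "\<dots> = \<eta> * W / 2" using q by simp
        finally have "2 * ln (real (na (\<epsilon> / 2) d)) < \<eta> * W" by simp
        moreover have "ln (real (ns \<epsilon> d)) \<le> ln (real ((na (\<epsilon> / 2) d)\<^sup>2))"
          by (intro ln_mono0 le d \<epsilon>)
        moreover have "ln (real ((na (\<epsilon> / 2) d)\<^sup>2)) = 2 * ln (real (na (\<epsilon> / 2) d))"
          by (cases "na (\<epsilon> / 2) d = 0") (auto simp: ln_realpow)
        ultimately have "ln (real (ns \<epsilon> d)) < \<eta> * W" by linarith
        then show ?thesis unfolding W_def[symmetric] using W by (simp add: pos_divide_less_eq)
      qed
      then show "\<exists>M. \<forall>d\<ge>1. \<forall>\<epsilon>. 0 < \<epsilon> \<and> \<epsilon> < 1 \<and> M < 1 / \<epsilon> + real d \<longrightarrow>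
          ln (real (n_ABS Lambda_std \<epsilon> d (D d) (\<rho> d) (V d) (N d) (\<mu> d)))
          / ((1 + ln (1 / \<epsilon>)) powr \<alpha> + real d powr \<beta>) < \<eta>"
        unfolding ns_def by blast
    qed
  next
    assume std: "EXP_UWT Lambda_std D \<rho> V N \<mu>"
    show "EXP_UWT Lambda_all D \<rho> V N \<mu>"
      unfolding EXP_UWT_def
    proof (intro allI impI)
      fix \<alpha> \<beta> \<eta> :: real assume pos: "\<alpha> > 0" "\<beta> > 0" "\<eta> > 0"
      have "\<exists>M. \<forall>d\<ge>1. \<forall>\<epsilon>. 0 < \<epsilon> \<and> \<epsilon> < 1 \<and> M < 1 / \<epsilon> + real d \<longrightarrow>
          ln (real (ns \<epsilon> d)) / ((1 + ln (1 / \<epsilon>)) powr \<alpha> + real d powr \<beta>) < \<eta>"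
        using std[unfolded EXP_UWT_def, folded ns_def, THEN spec, THEN mp, OF pos(1), THEN spec, THEN mp, OF pos(2),
            THEN spec, THEN mp, OF pos(3)] .
      then obtain M where M0: "\<forall>d\<ge>1. \<forall>\<epsilon>. 0 < \<epsilon> \<and> \<epsilon> < 1 \<and> M < 1 / \<epsilon> + real d \<longrightarrow>
          ln (real (ns \<epsilon> d)) / ((1 + ln (1 / \<epsilon>)) powr \<alpha> + real d powr \<beta>) < \<eta>"
        by (elim exE)
      have M: "ln (real (ns \<epsilon> d)) / ((1 + ln (1 / \<epsilon>)) powr \<alpha> + real d powr \<beta>) < \<eta>"
        if "d \<ge> 1" "0 < \<epsilon>" "\<epsilon> < 1" "1 / \<epsilon> + real d > M" for d \<epsilon>
        by (rule M0[THEN spec, THEN mp, THEN spec, THEN mp]) (intro conjI that)+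
      have "ln (real (na \<epsilon> d)) / ((1 + ln (1 / \<epsilon>)) powr \<alpha> + real d powr \<beta>) < \<eta>"
        if d: "d \<ge> 1" and \<epsilon>: "0 < \<epsilon>" "\<epsilon> < 1" and gt: "1 / \<epsilon> + real d > M" for d \<epsilon>
      proof -
        have "ln (real (na \<epsilon> d)) / ((1 + ln (1 / \<epsilon>)) powr \<alpha> + real d powr \<beta>)
            \<le> ln (real (ns \<epsilon> d)) / ((1 + ln (1 / \<epsilon>)) powr \<alpha> + real d powr \<beta>)"
          by (intro divide_right_mono ln_mono0 le d \<epsilon>) (auto intro: add_nonneg_nonneg)
        also have "\<dots> < \<eta>" by (rule M[OF d \<epsilon> gt])
        finally show ?thesis .
      qed
      then show "\<exists>M. \<forall>d\<ge>1. \<forall>\<epsilon>. 0 < \<epsilon> \<and> \<epsilon> < 1 \<and> M < 1 / \<epsilon> + real d \<longrightarrow>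
          ln (real (n_ABS Lambda_all \<epsilon> d (D d) (\<rho> d) (V d) (N d) (\<mu> d)))
          / ((1 + ln (1 / \<epsilon>)) powr \<alpha> + real d powr \<beta>) < \<eta>"
        unfolding na_def by blast
    qed
  qed
qed

end
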